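(* Given two (distinct) connected components of the fixed tongue $T_0$, the intersection of their extensions in $\mathbb{A}_{1,2}=\{a\in\mathbb{C}:1<|a|<2\}$ is empty. The boundary of every connected component of the extended fixed tongue $ET_0$ consists of two disjoint connected components. The exterior component consists of parameters $a$ for which $B_a|_{\mathbb{S}^1}$ has a parabolic fixed point of multiplier $1$. The interior component consists of parameters $a$ for which $B_a|_{\mathbb{S}^1}$ has a parabolic fixed point of multiplier $-1$. Moreover, there is a period doubling bifurcation taking place throughout the curve of interior boundary parameters.
   Context: For $a\in\mathbb{C}$ let $B_a(z)=z^3\frac{z-a}{1-\bar a z}$, a rational map of $\widehat{\mathbb{C}}$ leaving the unit circle $\mathbb{S}^1$ invariant. Its critical points $0$ and $\infty$ are superattracting fixed points; the other two (free) critical points are $c_\pm=\frac{a}{3|a|^2}\left(2+|a|^2\pm\sqrt{(|a|^2-4)(|a|^2-1)}\right)$. Let $|a|\ge 2$. Then $B_a|_{\mathbb{S}^1}$ is an orientation preserving degree $2$ covering of $\mathbb{S}^1$. If $F_a:\mathbb{R}\to\mathbb{R}$ is a lift of it (under $x\mapsto e^{2\pi i x}$), then $H_a(x)=\lim_{n\to\infty}F_a^n(x)/2^n$ exists, is continuous and increasing, satisfies $H_a(x+1)=H_a(x)+1$, and semiconjugates $F_a$ to multiplication by $2$; modulo $1$ it is independent of the choice of lift. $B_a$ has at most one attracting cycle in $\mathbb{S}^1$, and if there is one, both free critical points lie in the same connected component of its immediate basin of attraction; the point $x_0$ of the cycle lying in that component is called the marked point. The parameter $a$ is of type $\tau\in\mathbb{R}/\mathbb{Z}$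 if $B_a|_{\mathbb{S}^1}$ has an attracting cycle with marked point $x_0$ and $H_a(x_0)=\tau \pmod 1$. The tongue $T_\tau$ is the set of parameters $a$, $|a|\ge2$, of type $\tau$. The fixed tongue $T_0$ is the one with $\tau=0$ (the attracting cycle is then a fixed point); it has three connected components. The extended fixed tongue $ET_0$ is the set of parameters $a$ with $|a|>1$ such that $B_a|_{\mathbb{S}^1}$ has an attracting fixed point and there is a curve of parameters $\gamma(t)$, $t\in[0,1]$, (with $|\gamma(t)|>1$) with $\gamma(0)=a$, $\gamma(1)\in T_0$, and such that $B_{\gamma(t)}|_{\mathbb{S}^1}$ has an attracting fixed point depending continuously on $t$ which continues the one of $B_a$ to that of $B_{\gamma(1)}$. The extension of a connected component of $T_0$ is the set of such $a$ for which $\gamma(1)$ can be taken in that component. Boundaries of (components of) $ET_0$ are taken within $\{a:|a|>1\}$. *)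

theory Defs
  imports "HOL-Analysis.Analysis"
begin

section \<open>The Blaschke family\<close>

text \<open>
  The maps act on the complex plane rather than on the Riemann sphere. The only pole is
  \<open>1 / cnj a\<close>, where division by zero yields the value 0. The points 0 and infinity are both
  superattracting fixed points off the unit circle, so this convention changes neither the basin of
  a cycle on the circle (infinity and its preimages are outside it) nor, for \<open>norm a > 1\<close>,
  the map near the circle.
\<close>

definition blaschke :: "complex \<Rightarrow> complex \<Rightarrow> complex" where
  "blaschke a z = z ^ 3 * ((z - a) / (1 - cnj a * z))"

definition crit_plus :: "complex \<Rightarrow> complex" where
  "crit_plus a = a / of_real (3 * (norm a)\<^sup>2) *
     (of_real (2 + (norm a)\<^sup>2) + csqrt (of_real (((norm a)\<^sup>2 - 4) * ((norm a)\<^sup>2 - 1))))"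

definition crit_minus :: "complex \<Rightarrow> complex" where
  "crit_minus a = a / of_real (3 * (norm a)\<^sup>2) *
     (of_real (2 + (norm a)\<^sup>2) - csqrt (of_real (((norm a)\<^sup>2 - 4) * ((norm a)\<^sup>2 - 1))))"


section \<open>Periodic points on the circle\<close>

definition circle_periodic :: "complex \<Rightarrow> nat \<Rightarrow> complex \<Rightarrow> bool" where
  "circle_periodic a p z \<longleftrightarrow>
     z \<in> sphere 0 1 \<and> 0 < p \<and> (blaschke a ^^ p) z = z \<and>
     (\<forall>k. 0 < k \<and> k < p \<longrightarrow> (blaschke a ^^ k) z \<noteq> z)"

definition multiplier :: "complex \<Rightarrow> nat \<Rightarrow> complex \<Rightarrow> complex" where
  "multiplier a p z = deriv (blaschke a ^^ p) z"

definition attracting_periodic :: "complex \<Rightarrow> nat \<Rightarrow> complex \<Rightarrow> bool" where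
  "attracting_periodic a p z \<longleftrightarrow> circle_periodic a p z \<and> norm (multiplier a p z) < 1"

definition parabolic_fixed_point :: "complex \<Rightarrow> complex \<Rightarrow> bool" where
  "parabolic_fixed_point a z \<longleftrightarrow>
     circle_periodic a 1 z \<and> (\<exists>n>0. multiplier a 1 z ^ n = 1)"

definition cycle :: "complex \<Rightarrow> complex \<Rightarrow> complex set" where
  "cycle a z = range (\<lambda>n. (blaschke a ^^ n) z)"

definition basin :: "complex \<Rightarrow> complex set \<Rightarrow> complex set" where
  "basin a X = {z. (\<lambda>n. infdist ((blaschke a ^^ n) z) X) \<longlonglongrightarrow> 0}"

definition immediate_basin :: "complex \<Rightarrow> complex set \<Rightarrow> complex set" where
  "immediate_basin a X = (\<Union>x\<in>X. connected_component_set (basin a X) x)"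

definition marked_point :: "complex \<Rightarrow> complex \<Rightarrow> bool" where
  "marked_point a z \<longleftrightarrow>
     (\<exists>p. attracting_periodic a p z) \<and>
     (\<exists>U\<in>components (immediate_basin a (cycle a z)).
        z \<in> U \<and> crit_plus a \<in> U \<and> crit_minus a \<in> U)"


section \<open>Tongues\<close>

definition circle_lift :: "complex \<Rightarrow> (real \<Rightarrow> real) \<Rightarrow> bool" where
  "circle_lift a F \<longleftrightarrow>
     continuous_on UNIV F \<and> (\<forall>x. cis (2 * pi * F x) = blaschke a (cis (2 * pi * x)))"

definition semiconj :: "(real \<Rightarrow> real) \<Rightarrow> real \<Rightarrow> real" where
  "semiconj F x = lim (\<lambda>n. (F ^^ n) x / 2 ^ n)"

text \<open>The class of \<open>\<tau>\<close> modulo 1 is represented by any real number in it.\<close>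

definition has_type :: "complex \<Rightarrow> real \<Rightarrow> bool" where
  "has_type a \<tau> \<longleftrightarrow>
     (\<exists>F x. circle_lift a F \<and> marked_point a (cis (2 * pi * x)) \<and> semiconj F x - \<tau> \<in> \<int>)"

definition tongue :: "real \<Rightarrow> complex set" where
  "tongue \<tau> = {a. 2 \<le> norm a \<and> has_type a \<tau>}"

definition outer_plane :: "complex set" where
  "outer_plane = {a. 1 < norm a}"

definition annulus12 :: "complex set" where
  "annulus12 = {a. 1 < norm a \<and> norm a < 2}"

text \<open>
  The path \<open>\<xi>\<close> is the continuation, along the parameter path \<open>\<gamma>\<close>, of the
  attracting fixed point.
\<close>

definition extension :: "complex set \<Rightarrow> complex set" where
  "extension K = {a. \<exists>\<gamma> \<xi>.
     path \<gamma> \<and> path_image \<gamma> \<subseteq> outer_plane \<and> pathstart \<gamma> = a \<and> pathfinish \<gamma> \<in> K \<and>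
     path \<xi> \<and> (\<forall>t\<in>{0..1}. attracting_periodic (\<gamma> t) 1 (\<xi> t))}"

definition extended_fixed_tongue :: "complex set" where
  "extended_fixed_tongue = extension (tongue 0)"


section \<open>Boundaries\<close>

definition boundary_in_plane :: "complex set \<Rightarrow> complex set" where
  "boundary_in_plane C = frontier C \<inter> outer_plane"

text \<open>
  The complement of the closure of \<open>C\<close> in the parameter space \<open>norm a > 1\<close> is split into its
  unbounded component and its bounded ones (library notions \<^const>\<open>outside\<close> and
  \<^const>\<open>inside\<close>). Exterior boundary points are those adherent to the former, interior
  boundary points those adherent to the latter.
\<close>

definition exterior_boundary :: "complex set \<Rightarrow> complex set" where
  "exterior_boundary C =
     boundary_in_plane C \<inter> closure (outside (closure C \<union> cball 0 1))"

definition interior_boundary :: "complex set \<Rightarrow> complex set" where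
  "interior_boundary C =
     boundary_in_plane C \<inter> closure (inside (closure C \<union> cball 0 1))"


section \<open>Period doubling\<close>

definition two_periodic_in :: "complex \<Rightarrow> complex set \<Rightarrow> complex set" where
  "two_periodic_in a V = {z \<in> V. circle_periodic a 2 z}"

text \<open>
  When the parameter leaves \<open>S\<close> through its boundary near \<open>a0\<close>, an attracting fixed point
  \<open>\<zeta> a\<close> on the circle becomes repelling through multiplier \<open>-1\<close>, and exactly one 2-cycle on the
  circle, which is attracting, branches off from it. Since \<open>W\<close> is an arbitrary neighbourhood of the
  bifurcating fixed point \<open>z0\<close>, the 2-cycle shrinks to \<open>z0\<close> as the parameter tends to \<open>a0\<close>.
  The condition on the closure of the exterior of \<open>S\<close> says that the side on which the 2-cycle lives
  is present at \<open>a0\<close>.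
\<close>

definition period_doubling_bifurcation :: "complex set \<Rightarrow> complex \<Rightarrow> bool" where
  "period_doubling_bifurcation S a0 \<longleftrightarrow>
     a0 \<in> frontier S \<and> a0 \<in> closure (- closure S) \<and>
     (\<exists>z0. circle_periodic a0 1 z0 \<and> multiplier a0 1 z0 = - 1 \<and>
       (\<forall>W. open W \<and> z0 \<in> W \<longrightarrow>
         (\<exists>U V \<zeta>. open U \<and> a0 \<in> U \<and> open V \<and> z0 \<in> V \<and> V \<subseteq> W \<and>
            continuous_on U \<zeta> \<and> \<zeta> a0 = z0 \<and>
            (\<forall>a\<in>U.
               {z \<in> V. circle_periodic a 1 z} = {\<zeta> a} \<and>
               (a \<in> S \<longrightarrow>
                  norm (multiplier a 1 (\<zeta> a)) < 1 \<and> two_periodic_in a V = {}) \<and>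
               (a \<in> frontier S \<longrightarrow>
                  multiplier a 1 (\<zeta> a) = - 1 \<and> two_periodic_in a V = {}) \<and>
               (a \<notin> closure S \<longrightarrow>
                  norm (multiplier a 1 (\<zeta> a)) > 1 \<and>
                  (\<exists>w. attracting_periodic a 2 w \<and>
                       two_periodic_in a V = {w, blaschke a w}))))))"

end

theory Submission
  imports Defs "HOL-Complex_Analysis.Complex_Analysis"
begin


text \<open>
  Write \<open>f = blaschke a\<close> and \<open>norm a > 1\<close>. On the unit circle
  \<open>f z = z\<^sup>2 (z - a) / cnj (z - a)\<close>, so the fixed points there are the unimodular roots of
  \<open>z ^ 3 - a * z\<^sup>2 + cnj a * z - 1\<close>, and the multiplier at such a point is the real number
  \<open>2 + 2 * Re (z / (z - a))\<close>. Solving for the parameter instead of the fixed point makes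
  everything explicit: \<open>z\<close> is fixed with multiplier \<open>2 - 1 / t < 2\<close> exactly if
  \<open>a = z + t * (z + cnj z ^ 2)\<close> with \<open>t > 0\<close> and \<open>z ^ 3 \<noteq> -1\<close>. As there is at most one fixed
  point with multiplier at most 1 (\<open>unique_nonrepelling\<close>), the pair of the argument of \<open>z\<close>
  and \<open>t \<in> {0<..1}\<close> is a coordinate system for the parameters that have one. The condition
  \<open>z ^ 3 \<noteq> -1\<close> cuts the circle into three arcs, and the images of the three
  resulting open rectangles \<open>1/3 < t < 1\<close> are the components of the extended fixed tongue.

  Each of these rectangles has its edge \<open>t = 1\<close> (multiplier 1) on the deltoid
  \<open>2 * z + cnj z ^ 2\<close> and its edge \<open>t = 1/3\<close> (multiplier -1) on a second curve, whereas the two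
  remaining edges are mapped to single points of the unit circle; this gives the boundary within
  \<open>norm a > 1\<close>. The region \<open>t < 1/3\<close> is bounded by the second curve and the unit circle, hence
  lies inside, and the region beyond the deltoid arc lies outside because the deltoid is star-shaped
  with respect to 0, as its equation (the discriminant of the cubic) shows.

  It remains to identify the fixed tongue itself with the parameters \<open>norm a \<ge> 2\<close> having an
  attracting fixed point (\<open>tongue_0_eq\<close>). If \<open>a\<close> has type 0, a suitable lift of \<open>f\<close>
  has a periodic point over the marked point, and a monotone map of the line has no periodic points
  except fixed points. Conversely the immediate basin of an attracting fixed point
  contains a free critical point by Fatou's theorem: otherwise \<open>f\<close> would be an unramified covering
  of the immediate basin by itself, and inverse branches of the iterates would form a normal family
  with unbounded derivatives. By reflection in the circle it then contains both.

  For the period doubling, the 2-cycles \<open>{cis (m + d), cis (m - d)}\<close> are parametrized in the same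
  way: the parameter is an explicit function of \<open>m\<close> and \<open>c = cos d\<close>, defined for \<open>c > 1\<close> too,
  which restricts to the bifurcation curve at \<open>c = 1\<close>. Its derivative is invertible there, so
  \<open>(m, c)\<close> is a second local coordinate system, in which a 2-cycle exists if and only if
  \<open>c < 1\<close>. Comparing with the coordinate \<open>t\<close> shows that this is the side where the fixed point
  repels, and a closed formula for the multiplier of the cycle shows that it attracts.
\<close>
section \<open>Fixed points on the unit circle\<close>

lemma unit_circle_cnj:
  assumes "norm z = (1::real)" shows "z * cnj z = 1" "cnj z * z = 1"
  using assms complex_norm_square[of z] by (auto simp: mult.commute)

lemma unit_circle_neq:
  assumes "norm z = 1" "1 < norm a"
  shows "z \<noteq> 0" "z \<noteq> a" "1 - cnj a * z \<noteq> 0"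
proof -
  show "z \<noteq> 0" "z \<noteq> a" using assms by auto
  show "1 - cnj a * z \<noteq> 0"
  proof
    assume "1 - cnj a * z = 0"
    then have "cnj a * z = 1" by simp
    then have "norm (cnj a * z) = 1" by simp
    then show False using assms by (simp add: norm_mult)
  qed
qed

lemma blaschke_circle_denominator:
  assumes "norm z = 1"
  shows "1 - cnj a * z = z * cnj (z - a)"
  using unit_circle_cnj[OF assms] by (simp add: algebra_simps)

lemma blaschke_on_circle:
  assumes "norm z = 1" "1 < norm a"
  shows "blaschke a z = z\<^sup>2 * ((z - a) / cnj (z - a))"
  using unit_circle_neq[OF assms]
  by (simp add: blaschke_def blaschke_circle_denominator[OF assms(1)] power2_eq_square power3_eq_cube
      del: complex_cnj_diff)

lemma norm_blaschke_circle:
  assumes "norm z = 1" "1 < norm a" shows "norm (blaschke a z) = 1"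
  using unit_circle_neq[OF assms]
  by (simp add: blaschke_on_circle[OF assms] norm_mult norm_divide assms norm_power del: complex_cnj_diff)

lemma blaschke_eq_iff:
  assumes "norm x = 1" "1 < norm a"
  shows "blaschke a x = y \<longleftrightarrow> x ^ 3 * (x - a) = y * (1 - cnj a * x)"
  using unit_circle_neq[OF assms] by (auto simp: blaschke_def field_simps)

text \<open>
  On the unit circle this is the logarithmic derivative \<open>z f'(z) / f(z)\<close>, which is real there since
  the circle is invariant.
\<close>
definition circle_slope :: "complex \<Rightarrow> complex \<Rightarrow> real" where
  "circle_slope a z = 2 + 2 * Re (z / (z - a))"

lemma blaschke_field_derivative:
  assumes "cnj a * z \<noteq> 1"
  shows "(blaschke a has_field_derivative
    (3 * z ^ 2 * (z - a) * (1 - cnj a * z) + z ^ 3 * (1 - cnj a * z) + cnj a * z ^ 3 * (z - a))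
      / (1 - cnj a * z)\<^sup>2) (at z)"
  unfolding blaschke_def
  by (rule derivative_eq_intros refl | (use assms in \<open>force\<close>))+
     (use assms in \<open>simp add: divide_simps power2_eq_square power3_eq_cube\<close>, algebra?)

lemma blaschke_derivative_circle:
  assumes "norm z = 1" "1 < norm a"
  shows "(blaschke a has_field_derivative of_real (circle_slope a z) * blaschke a z / z) (at z)"
proof -
  note n = unit_circle_neq[OF assms]
  have n2: "cnj a * z \<noteq> 1" using n by auto
  have 1: "z / (z - a) + cnj (z / (z - a)) = z / (z - a) + 1 / (1 - cnj a * z)"
  proof -
    have "cnj (z / (z - a)) = cnj z / cnj (z - a)" by simp
    also have "\<dots> = 1 / (z * cnj (z - a))"
      using n unit_circle_cnj[OF assms(1)] by (simp add: frac_eq_eq del: complex_cnj_diff)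
    finally show ?thesis by (simp add: blaschke_circle_denominator[OF assms(1)] del: complex_cnj_diff)
  qed
  have 2: "complex_of_real (circle_slope a z) = 2 + z / (z - a) + 1 / (1 - cnj a * z)"
    unfolding circle_slope_def using complex_add_cnj[of "z / (z - a)"] 1 by simp
  have n3: "z - a \<noteq> 0" using n by auto
  have "(3 * z ^ 2 * (z - a) * (1 - cnj a * z) + z ^ 3 * (1 - cnj a * z) + cnj a * z ^ 3 * (z - a))
      / (1 - cnj a * z)\<^sup>2 = (2 + z / (z - a) + 1 / (1 - cnj a * z)) * blaschke a z / z"
    unfolding blaschke_def using n n3 
    apply (simp add: divide_simps power2_eq_square power3_eq_cube)
    apply algebra
    done
  then show ?thesis using blaschke_field_derivative[OF n2] 2 by simp
qed

lemma multiplier_fixed: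
  assumes "norm z = 1" "1 < norm a" "blaschke a z = z"
  shows "multiplier a 1 z = of_real (circle_slope a z)"
  using DERIV_imp_deriv[OF blaschke_derivative_circle[OF assms(1,2)]] unit_circle_neq[OF assms(1,2)] assms(3)
  by (simp add: multiplier_def)

lemma circle_periodic_1: "circle_periodic a 1 z \<longleftrightarrow> norm z = 1 \<and> blaschke a z = z"
  by (auto simp: circle_periodic_def)

lemma circle_periodic_2: "circle_periodic a 2 z \<longleftrightarrow>
   norm z = 1 \<and> blaschke a (blaschke a z) = z \<and> blaschke a z \<noteq> z"
  apply (auto simp: circle_periodic_def numeral_2_eq_2)
  by (metis One_nat_def less_one less_Suc_eq funpow_0 funpow_simps_right(2) id_apply comp_apply funpow.simps less_antisym neq0_conv)

lemma attracting_1: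
  assumes "1 < norm a"
  shows "attracting_periodic a 1 z \<longleftrightarrow> norm z = 1 \<and> blaschke a z = z \<and> \<bar>circle_slope a z\<bar> < 1"
  unfolding attracting_periodic_def circle_periodic_1 using multiplier_fixed[OF _ assms] by auto

text \<open>
  For fixed \<open>z\<close> on the circle these parameters form a line, tangent at \<open>t = 1\<close> to the deltoid
  \<open>2 * z + cnj z ^ 2\<close>, on which \<open>z\<close> is a double root of the fixed point equation.
\<close>
definition tangent_point :: "complex \<Rightarrow> real \<Rightarrow> complex" where
  "tangent_point z t = z + of_real t * (z + cnj z ^ 2)"

lemma norm_tangent_point:
  assumes "norm z = 1"
  shows "(norm (tangent_point z t))\<^sup>2 = 1 + 2 * t * (1 + t) * (1 + Re (z ^ 3))"
proof -
  have zc: "z * cnj z = 1" using unit_circle_cnj assms by auto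
  have c: "complex_of_real (Re (z^3)) = (z^3 + cnj z ^ 3) / 2"
    using complex_add_cnj[of "z^3"] by simp
  have "complex_of_real ((norm (tangent_point z t))\<^sup>2) = tangent_point z t * cnj (tangent_point z t)"
    using complex_norm_square by auto
  also have "\<dots> = 1 + 2 * t * (1 + t) * (1 + (z^3 + cnj z ^ 3) / 2)"
    unfolding tangent_point_def using zc by (simp, algebra)
  also have "\<dots> = of_real (1 + 2 * t * (1 + t) * (1 + Re (z ^ 3)))"
    by (simp only: c of_real_add of_real_mult of_real_1 of_real_numeral)
  finally show ?thesis using of_real_eq_iff by blast
qed

lemma Re_cube_ge: assumes "norm z = 1" shows "- 1 \<le> Re (z^3)" "Re (z^3) \<le> 1"
  using abs_Re_le_cmod[of "z^3"] assms by (auto simp: norm_power)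

lemma Re_cube_eq_m1: assumes "norm z = 1" shows "Re (z^3) = -1 \<longleftrightarrow> z^3 = -1"
proof
  assume h: "Re (z^3) = -1"
  have "(Re (z^3))\<^sup>2 + (Im (z^3))\<^sup>2 = 1" using assms by (metis cmod_power2 norm_power power_one)
  then have "Im (z^3) = 0" using h by auto
  then show "z^3 = -1" using h complex_eq_iff by auto
qed simp

lemma norm_tangent_point_gt_1:
  assumes "norm z = 1" "z ^ 3 \<noteq> -1" "0 < t" shows "1 < norm (tangent_point z t)"
proof -
  have "1 + Re (z^3) > 0" using Re_cube_ge[OF assms(1)] Re_cube_eq_m1[OF assms(1)] assms(2) by linarith
  then have "0 < 2 * t * (1 + t) * (1 + Re (z ^ 3))" using assms by simp
  then have "1 < (norm (tangent_point z t))\<^sup>2" using norm_tangent_point[OF assms(1), of t] by linarith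
  then show ?thesis by (metis one_power2 power2_less_imp_less norm_ge_zero)
qed

lemma tangent_point_fixed:
  assumes "norm z = 1" "z ^ 3 \<noteq> -1" "0 < t" and that: "a = tangent_point z t"
  shows "blaschke a z = z" "circle_slope a z = 2 - 1 / t"
proof -
  have na: "1 < norm a" using norm_tangent_point_gt_1 assms that by auto
  have zc: "z * cnj z = 1" using unit_circle_cnj assms by auto
  have z0: "z \<noteq> 0" using assms by auto
  show "blaschke a z = z"
    unfolding blaschke_eq_iff[OF assms(1) na]
    unfolding that tangent_point_def using zc by (simp, algebra)
  have z3: "1 + z^3 \<noteq> 0" using assms(2) by (metis add_eq_0_iff)
  have za: "z - a = - of_real t * (z + cnj z ^ 2)" unfolding that tangent_point_def by simp
  have e: "z + cnj z ^ 2 = cnj z ^ 2 * (1 + z^3)" using zc by algebra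
  have c0: "cnj z \<noteq> 0" using z0 by simp
  have q: "z / (z - a) = of_real (- (1 / t)) * (z^3 / (1 + z^3))"
    unfolding za e using z3 assms(3) c0 z0 zc 
    by (simp add: divide_simps) algebra
  have c: "cnj (z^3 / (1 + z^3)) = 1 / (1 + z^3)"
  proof -
    have "1 + cnj z ^ 3 \<noteq> 0" using z3 by (metis complex_cnj_add complex_cnj_one complex_cnj_power complex_cnj_zero_iff)
    then show ?thesis using z3 zc by (simp add: divide_simps) algebra
  qed
  have "z^3 / (1 + z^3) + cnj (z^3 / (1 + z^3)) = 1"
    unfolding c using z3 by (simp add: divide_simps)
  then have "Re (z^3 / (1 + z^3)) = 1/2"
    by (metis complex_add_cnj of_real_eq_1_iff mult.commute mult_cancel_right2 nonzero_eq_divide_eq zero_neq_numeral)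
  moreover have "Re (z / (z - a)) = - (1 / t) * Re (z^3 / (1 + z^3))"
    unfolding q times_complex.sel Re_complex_of_real Im_complex_of_real by (simp only: mult_zero_left diff_zero)
  ultimately have "Re (z / (z - a)) = - (1 / t) * (1/2)" by (simp only:)
  then show "circle_slope a z = 2 - 1 / t" unfolding circle_slope_def by simp
qed

text \<open>
  With \<open>v = z / (a - z)\<close> the fixed point equation becomes \<open>cnj v = cnj z ^ 3 * v\<close>, while
  \<open>v + cnj v\<close> is given by the multiplier. Together these determine \<open>v\<close>, and thereby \<open>a\<close>.
\<close>
lemma fixed_imp_tangent_point:
  assumes "norm z = 1" "1 < norm a" "blaschke a z = z" "circle_slope a z < 2"
  defines "t \<equiv> 1 / (2 - circle_slope a z)"
  shows "z ^ 3 \<noteq> -1" "0 < t" "a = tangent_point z t" "circle_slope a z = 2 - 1 / t"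
proof -
  note n = unit_circle_neq[OF assms(1,2)]
  have zc: "z * cnj z = 1" using unit_circle_cnj assms by auto
  define s where "s = 2 - circle_slope a z"
  have s: "s > 0" using assms s_def by auto
  define v where "v = z / (a - z)"
  have v0: "v \<noteq> 0" using n v_def by auto
  have "s = 2 * Re v" unfolding s_def circle_slope_def v_def
    by (metis add_diff_cancel_left' diff_minus_eq_add minus_diff_eq minus_divide_right minus_mult_right
         uminus_complex.simps(1) add_uminus_conv_diff diff_diff_eq diff_self group_cancel.rule0 minus_diff_eq)
  then have sv: "v + cnj v = of_real s" by (simp add: complex_add_cnj)
  have "z ^ 3 * (z - a) = z * (1 - cnj a * z)" using assms blaschke_eq_iff by auto
  then have "z ^ 3 * (z - a) = z * (z * cnj (z - a))" using blaschke_circle_denominator assms by auto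
  then have "z * (z - a) = cnj (z - a)" using n by (simp add: power3_eq_cube del: complex_cnj_diff)
  then have h: "z * (a - z) = cnj (a - z)" by (simp add: algebra_simps)
  have cv: "cnj v = cnj z ^ 3 * v"
  proof -
    have "cnj v = cnj z / (z * (a - z))" unfolding h v_def by simp
    also have "\<dots> = cnj z ^ 3 * v" unfolding v_def using n zc 
      by (simp add: divide_simps) algebra
    finally show ?thesis .
  qed
  have sv2: "v * (1 + cnj z ^ 3) = of_real s" using sv cv by (simp add: algebra_simps)
  show z3: "z^3 \<noteq> -1"
  proof
    assume "z^3 = -1"
    then have "cnj z ^ 3 = -1" by (metis complex_cnj_power complex_cnj_minus complex_cnj_one)
    then show False using sv2 s by auto
  qed
  have t: "t = 1 / s" unfolding t_def s_def ..
  show "0 < t" using t s by auto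
  have "a - z = z / v" unfolding v_def using n by auto
  also have "\<dots> = z * (1 + cnj z ^ 3) / of_real s" using sv2 v0 s by (simp add: divide_simps mult.commute)
  also have "z * (1 + cnj z ^ 3) = z + cnj z ^ 2" using zc by algebra
  finally show "a = tangent_point z t" unfolding tangent_point_def t by (simp add: algebra_simps add_divide_distrib)
  show "circle_slope a z = 2 - 1 / t" unfolding t s_def by simp
qed

section \<open>Uniqueness of the non-repelling fixed point\<close>

text \<open>
  The fixed point equation is a cubic whose roots have sum \<open>a\<close> and product 1, so two unimodular
  roots force the third one to be unimodular.
\<close>
lemma fixed_point_third:
  assumes "norm z1 = 1" "norm z2 = 1" "1 < norm a" "blaschke a z1 = z1" "blaschke a z2 = z2" "z1 \<noteq> z2"
  shows "a = z1 + z2 + cnj (z1 * z2)"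
proof -
  have c: "z1 * cnj z1 = 1" "z2 * cnj z2 = 1" using unit_circle_cnj assms by auto
  have e: "z1 ^ 3 * (z1 - a) = z1 * (1 - cnj a * z1)" "z2 ^ 3 * (z2 - a) = z2 * (1 - cnj a * z2)"
    using assms blaschke_eq_iff by blast+
  have "z1 \<noteq> 0" "z2 \<noteq> 0" using assms by auto
  then have e2: "z1 ^ 2 * (z1 - a) = (1 - cnj a * z1)" "z2 ^ 2 * (z2 - a) = (1 - cnj a * z2)"
    using e by (auto simp: power2_eq_square power3_eq_cube mult.assoc)
  have "(z1 - z2) * (z1 * z2 * (z1 + z2 - a) + 1) = 0" using e2 by algebra
  then have "z1 * z2 * (z1 + z2 - a) + 1 = 0" using assms by simp
  then have "a = z1 + z2 + cnj z1 * cnj z2" using c by algebra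
  then show ?thesis by simp
qed

text \<open>
  Compare the squared norm of \<open>t * (z1 + cnj z1 ^ 2) = z2 + z3\<close> with its inner product with
  \<open>z1\<close>: the sides of the claim turn out to have ratio \<open>t\<close>.
\<close>
lemma nonrepelling_inner:
  assumes n: "norm z1 = 1" "norm z2 = 1" "norm z3 = 1" and p: "z1 * z2 * z3 = 1"
    and e: "tangent_point z1 t = z1 + z2 + z3" and t: "0 < t" "t \<le> 1"
  shows "1 + Re (z2 * cnj z3) \<le> Re (z1 * cnj z2) + Re (z1 * cnj z3)"
proof -
  have c: "z1 * cnj z1 = 1" "z2 * cnj z2 = 1" "z3 * cnj z3 = 1" using unit_circle_cnj n by auto
  have e1: "of_real t * (z1 + cnj z1 ^ 2) = z2 + z3" using e unfolding tangent_point_def by (simp add: add.assoc)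
  have "(z2 + z3) * cnj z1 = of_real t * (1 + cnj (z1 ^ 3))"
    unfolding e1[symmetric] complex_cnj_power using c by algebra
  then have r1: "Re ((z2 + z3) * cnj z1) = t * (1 + Re (z1 ^ 3))"
    by (simp only: times_complex.sel Re_complex_of_real Im_complex_of_real plus_complex.sel one_complex.sel
        complex_cnj mult_zero_left diff_zero cnj.sel)
  have r2: "Re ((z2 + z3) * cnj z1) = Re (z1 * cnj z2) + Re (z1 * cnj z3)"
    by (simp add: algebra_simps)
  have "(norm (z2 + z3))\<^sup>2 = t\<^sup>2 * (norm (z1 + cnj z1 ^ 2))\<^sup>2"
    unfolding e1[symmetric] by (simp add: norm_mult power_mult_distrib)
  moreover have "(norm (z1 + cnj z1 ^ 2))\<^sup>2 = 2 + 2 * Re (z1 ^ 3)"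
  proof -
    have "complex_of_real ((norm (z1 + cnj z1 ^ 2))\<^sup>2) = (z1 + cnj z1 ^ 2) * (cnj z1 + z1 ^ 2)"
      by (subst complex_norm_square) simp
    also have "\<dots> = 2 + (z1 ^ 3 + cnj (z1 ^ 3))" using c by (simp, algebra)
    also have "\<dots> = of_real (2 + 2 * Re (z1 ^ 3))" by (simp only: complex_add_cnj) simp
    finally show ?thesis using of_real_eq_iff by blast
  qed
  moreover have "(norm (z2 + z3))\<^sup>2 = 2 + 2 * Re (z2 * cnj z3)"
  proof -
    have "(z2 + z3) * (cnj z2 + cnj z3) = 2 + (z2 * cnj z3 + cnj (z2 * cnj z3))"
      using c by (simp add: algebra_simps)
    then have "complex_of_real ((norm (z2 + z3))\<^sup>2) = 2 + (z2 * cnj z3 + cnj (z2 * cnj z3))"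
      by (subst complex_norm_square) simp
    also have "\<dots> = of_real (2 + 2 * Re (z2 * cnj z3))" by (simp only: complex_add_cnj) simp
    finally show ?thesis using of_real_eq_iff by blast
  qed
  ultimately have "1 + Re (z2 * cnj z3) = t * (t * (1 + Re (z1 ^ 3)))"
    by (simp add: power2_eq_square algebra_simps)
  also have "\<dots> \<le> 1 * (t * (1 + Re (z1 ^ 3)))"
    using Re_cube_ge[OF n(1)] t by (intro mult_right_mono) auto
  finally show ?thesis using r1 r2 by simp
qed

text \<open>
  For two distinct such points, adding the previous inequality at both of them cancels everything
  except their inner product, which would have to be 1.
\<close>
lemma unique_nonrepelling:
  assumes "norm z1 = 1" "norm z2 = 1" "1 < norm a" "blaschke a z1 = z1" "blaschke a z2 = z2"
    and "circle_slope a z1 \<le> 1" "circle_slope a z2 \<le> 1"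
  shows "z1 = z2"
proof (rule ccontr)
  assume ne: "z1 \<noteq> z2"
  define z3 where "z3 = cnj (z1 * z2)"
  have c: "z1 * cnj z1 = 1" "z2 * cnj z2 = 1" using unit_circle_cnj assms by auto
  have n3: "norm z3 = 1" unfolding z3_def using assms by (simp add: norm_mult)
  have p: "z1 * z2 * z3 = 1" unfolding z3_def using c by (simp, algebra)
  have a: "a = z1 + z2 + z3" using fixed_point_third assms ne z3_def by blast
  define t1 where "t1 = 1 / (2 - circle_slope a z1)"
  define t2 where "t2 = 1 / (2 - circle_slope a z2)"
  have t: "0 < t1" "t1 \<le> 1" "0 < t2" "t2 \<le> 1" using assms unfolding t1_def t2_def by auto
  have e: "a = tangent_point z1 t1" "a = tangent_point z2 t2" unfolding t1_def t2_def using fixed_imp_tangent_point(3) assms by force+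
  have "1 + Re (z2 * cnj z3) \<le> Re (z1 * cnj z2) + Re (z1 * cnj z3)"
    using nonrepelling_inner[OF assms(1,2) n3 p _ t(1,2)] a e by simp
  moreover have "1 + Re (z1 * cnj z3) \<le> Re (z2 * cnj z1) + Re (z2 * cnj z3)"
    using nonrepelling_inner[OF assms(2,1) n3 _ _ t(3,4)] a e p by (simp add: ac_simps)
  ultimately have "1 \<le> Re (z1 * cnj z2)" by (simp add: algebra_simps)
  moreover have "(norm (z1 - z2))\<^sup>2 = 2 - 2 * Re (z1 * cnj z2)"
  proof -
    have "(z1 - z2) * (cnj z1 - cnj z2) = 2 - (z1 * cnj z2 + cnj (z1 * cnj z2))"
      using c by (simp add: algebra_simps)
    then have "complex_of_real ((norm (z1 - z2))\<^sup>2) = 2 - (z1 * cnj z2 + cnj (z1 * cnj z2))"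
      by (subst complex_norm_square) simp
    also have "\<dots> = of_real (2 - 2 * Re (z1 * cnj z2))" by (simp only: complex_add_cnj) simp
    finally show ?thesis using of_real_eq_iff by blast
  qed
  ultimately have "(norm (z1 - z2))\<^sup>2 \<le> 0" by simp
  then show False using ne by simp
qed

section \<open>The discriminant of the fixed point equation\<close>

text \<open>
  The discriminant of \<open>z ^ 3 - a * z\<^sup>2 + cnj a * z - 1\<close>. It vanishes on the deltoid and is
  negative inside, where all three roots are distinct and unimodular.
\<close>
definition deltoid :: "complex \<Rightarrow> real" where
  "deltoid a = norm a ^ 4 - 8 * Re (a ^ 3) + 18 * (norm a)\<^sup>2 - 27"

lemma deltoid_tangent_point:
  assumes "norm z = 1"
  defines "C \<equiv> Re (z ^ 3)"
  shows "deltoid (tangent_point z t) = (1 - t)\<^sup>2 * (2 + 2 * C) * (t\<^sup>2 * (2 + 2 * C) - 4)"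
proof -
  let ?w = "cnj z"
  have zc: "z * ?w = 1" using unit_circle_cnj assms by auto
  have C: "complex_of_real C = (z^3 + ?w ^ 3) / 2"
    unfolding C_def using complex_add_cnj[of "z^3"] by simp
  have R: "complex_of_real (Re (tangent_point z t ^ 3)) = (tangent_point z t ^ 3 + (?w + of_real t * (?w + z ^ 2)) ^ 3) / 2"
    using complex_add_cnj[of "tangent_point z t ^ 3"] unfolding tangent_point_def by simp
  have N: "complex_of_real ((norm (tangent_point z t))\<^sup>2) = 1 + 2 * of_real t * (1 + of_real t) * (1 + of_real C)"
    unfolding C_def norm_tangent_point[OF assms(1)] by simp
  have n4: "norm (tangent_point z t) ^ 4 = ((norm (tangent_point z t))\<^sup>2)\<^sup>2" by simp
  have "complex_of_real (deltoid (tangent_point z t)) = (of_real ((norm (tangent_point z t))\<^sup>2))\<^sup>2 - 8 * of_real (Re (tangent_point z t ^ 3))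
     + 18 * of_real ((norm (tangent_point z t))\<^sup>2) - 27"
    unfolding deltoid_def n4 by simp
  also have "\<dots> = (1 - of_real t)\<^sup>2 * (2 + 2 * of_real C) * (of_real t ^ 2 * (2 + 2 * of_real C) - 4)"
    unfolding N R C unfolding tangent_point_def using zc by algebra
  also have "\<dots> = of_real ((1 - t)\<^sup>2 * (2 + 2 * C) * (t\<^sup>2 * (2 + 2 * C) - 4))" by simp
  finally show ?thesis using of_real_eq_iff by blast
qed

lemma deltoid_tangent_point_le:
  assumes "norm z = 1" "0 < t" "t \<le> 1"
  shows "deltoid (tangent_point z t) \<le> 0" "t < 1 \<Longrightarrow> z ^ 3 \<noteq> -1 \<Longrightarrow> deltoid (tangent_point z t) < 0"
proof -
  define C where "C = Re (z ^ 3)"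
  have C: "-1 \<le> C" "C \<le> 1" using Re_cube_ge assms C_def by auto
  have d: "deltoid (tangent_point z t) = (1 - t)\<^sup>2 * (2 + 2 * C) * (t\<^sup>2 * (2 + 2 * C) - 4)"
    using deltoid_tangent_point assms C_def by auto
  have t2: "t\<^sup>2 \<le> 1" "t < 1 \<Longrightarrow> t\<^sup>2 < 1" using assms by (auto simp: power_le_one_iff abs_square_less_1)
  have le: "t\<^sup>2 * (2 + 2 * C) \<le> 1 * (2 + 2 * C)" using t2 C by (intro mult_right_mono) auto
  then have le4: "t\<^sup>2 * (2 + 2 * C) - 4 \<le> 0" using C order_trans[OF le, of 4] by simp
  show "deltoid (tangent_point z t) \<le> 0" unfolding d using C le4 by (intro mult_nonneg_nonpos) auto
  assume "t < 1" "z ^ 3 \<noteq> -1"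
  then have C1: "-1 < C" using C(1) Re_cube_eq_m1[OF assms(1)] C_def by linarith
  have "t\<^sup>2 * (2 + 2 * C) < 1 * (2 + 2 * C)" using t2 C1 \<open>t < 1\<close> by (intro mult_strict_right_mono) auto
  then have "t\<^sup>2 * (2 + 2 * C) - 4 < 0" using C less_le_trans[of _ "1 * (2 + 2 * C)" 4] by simp
  then show "deltoid (tangent_point z t) < 0" unfolding d using C1 \<open>t < 1\<close> by (intro mult_pos_neg mult_pos_pos) auto
qed

text \<open>
  On the ray \<open>a = r * cis \<beta>\<close> the sign is that of \<open>r + 18 / r - 27 / r ^ 3 - 8 * cos (3 * \<beta>)\<close>,
  whose derivative in \<open>r\<close> is the square of \<open>1 - 9 / r\<^sup>2\<close>. So the deltoid is star-shaped.
\<close>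
lemma deltoid_scale:
  assumes "0 \<le> deltoid a" "1 < s" "a \<noteq> 0"
  shows "0 < deltoid (of_real s * a)"
proof -
  define r where "r = (norm a)\<^sup>2"
  have r0: "r > 0" unfolding r_def using assms by simp
  have n4: "norm a ^ 4 = r\<^sup>2" unfolding r_def by simp
  have c: "Re ((of_real s * a) ^ 3) = s ^ 3 * Re (a ^ 3)"
    by (simp add: power_mult_distrib flip: of_real_power)
  have d: "deltoid (of_real s * a) = s ^ 4 * r\<^sup>2 - 8 * (s ^ 3 * Re (a ^ 3)) + 18 * s\<^sup>2 * r - 27"
    unfolding deltoid_def c using assms n4 by (simp add: norm_mult power_mult_distrib r_def)
  have h: "8 * Re (a ^ 3) \<le> r\<^sup>2 + 18 * r - 27" using assms(1) unfolding deltoid_def n4 by (simp add: r_def)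
  have "s ^ 3 * (8 * Re (a ^ 3)) \<le> s ^ 3 * (r\<^sup>2 + 18 * r - 27)"
    using h assms by (intro mult_left_mono) auto
  then have "deltoid (of_real s * a) \<ge> s ^ 4 * r\<^sup>2 - s ^ 3 * (r\<^sup>2 + 18 * r - 27) + 18 * s\<^sup>2 * r - 27"
    unfolding d by linarith
  also have "s ^ 4 * r\<^sup>2 - s ^ 3 * (r\<^sup>2 + 18 * r - 27) + 18 * s\<^sup>2 * r - 27
     = (s - 1) * (s ^ 3 * r\<^sup>2 - 18 * s\<^sup>2 * r + 27 * (s\<^sup>2 + s + 1))"
    by algebra
  finally have 1: "deltoid (of_real s * a) \<ge> (s - 1) * (s ^ 3 * r\<^sup>2 - 18 * s\<^sup>2 * r + 27 * (s\<^sup>2 + s + 1))" .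
  have "s * (s ^ 3 * r\<^sup>2 - 18 * s\<^sup>2 * r + 27 * (s\<^sup>2 + s + 1)) = (s\<^sup>2 * r - 9 * s)\<^sup>2 + 27 * s * (s - 1)\<^sup>2"
    by algebra
  moreover have "27 * s * (s - 1)\<^sup>2 > 0" using assms by auto
  ultimately have "s * (s ^ 3 * r\<^sup>2 - 18 * s\<^sup>2 * r + 27 * (s\<^sup>2 + s + 1)) > 0"
    using zero_le_power2[of "s\<^sup>2 * r - 9 * s"] by linarith
  then have "s ^ 3 * r\<^sup>2 - 18 * s\<^sup>2 * r + 27 * (s\<^sup>2 + s + 1) > 0" using assms by (simp add: zero_less_mult_iff)
  then have "(s - 1) * (s ^ 3 * r\<^sup>2 - 18 * s\<^sup>2 * r + 27 * (s\<^sup>2 + s + 1)) > 0" using assms by simp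
  then show ?thesis using 1 by linarith
qed


section \<open>Coordinates on the parameters with a non-repelling fixed point\<close>

text \<open>
  For \<open>k < 3\<close> these are the arguments of the three arcs into which the third roots of -1 divide the
  circle.
\<close>
definition arc_interval :: "nat \<Rightarrow> real set" where
  "arc_interval k = {2 * pi * real k / 3 - pi / 3 <..< 2 * pi * real k / 3 + pi / 3}"

text \<open>
  A point of the coordinate plane stands for the argument \<open>Re p\<close> of the fixed point and for the
  value \<open>t = Im p\<close>; using complex numbers as coordinates makes invariance of domain applicable.
\<close>
definition fix_param :: "complex \<Rightarrow> complex" where
  "fix_param p = tangent_point (cis (Re p)) (Im p)"

definition strip :: "nat \<Rightarrow> real set \<Rightarrow> complex set" where
  "strip k J = {p. Re p \<in> arc_interval k \<and> Im p \<in> J}"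

definition region :: "nat \<Rightarrow> real set \<Rightarrow> complex set" where
  "region k J = fix_param ` strip k J"

lemma cos_triple_arc:
  assumes "x \<in> arc_interval k" shows "- 1 < cos (3 * x)"
proof -
  define y where "y = \<bar>3 * x - 2 * pi * real k\<bar>"
  have "3 * x - 2 * pi * real k < pi" "- pi < 3 * x - 2 * pi * real k"
    using assms unfolding arc_interval_def by (auto simp: field_simps)
  then have y: "0 \<le> y" "y < pi" unfolding y_def by auto
  have "cos (3 * x) = cos (3 * x - 2 * pi * real k)"
    using cos_int_2pin[of "int k"] sin_int_2pin[of "int k"] by (simp add: cos_diff)
  also have "\<dots> = cos y" unfolding y_def by (simp only: cos_abs_real)
  also have "\<dots> > cos pi" using y by (intro cos_monotone_0_pi) auto
  finally show ?thesis by simp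
qed

lemma cis_cube: "cis x ^ 3 = cis (3 * x)"
  using Complex.DeMoivre[of x 3] by simp

lemma cis_arc_cube:
  assumes "x \<in> arc_interval k" shows "cis x ^ 3 \<noteq> -1"
proof
  assume "cis x ^ 3 = -1"
  then have "Re (cis (3 * x)) = -1" unfolding cis_cube by simp
  then show False using cos_triple_arc[OF assms] by simp
qed

lemma cis_arc_inj:
  assumes "x \<in> arc_interval j" "y \<in> arc_interval k" "j < 3" "k < 3" "cis x = cis y"
  shows "x = y" "j = k"
proof -
  have j: "j \<in> {0,1,2}" "k \<in> {0,1,2}" using assms by auto
  then have r: "-pi/3 < x" "x < 5*pi/3" "-pi/3 < y" "y < 5*pi/3"
    using assms(1,2) pi_gt_zero unfolding arc_interval_def by (auto simp: field_simps)
  have "sin x = sin y \<and> cos x = cos y" using assms(5) by (simp add: complex_eq_iff)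
  then obtain n :: int where n: "x = y + 2 * pi * of_int n" using sin_cos_eq_iff by blast
  have "\<bar>2 * pi * real_of_int n\<bar> < 2 * pi" using r n by auto
  then have "\<bar>real_of_int n\<bar> < 1" using pi_gt_zero by (simp add: abs_mult)
  then have "n = 0" by linarith
  then show "x = y" using n by simp
  then show "j = k" using assms(1,2) j pi_gt_zero unfolding arc_interval_def by (auto simp: field_simps)
qed

lemma cis_arc_surj:
  assumes "norm z = 1" "z ^ 3 \<noteq> -1"
  obtains k x where "k < 3" "x \<in> arc_interval k" "z = cis x"
proof -
  define t where "t = Arg2pi z"
  have t: "0 \<le> t" "t < 2 * pi" "z = cis t"
    using Arg2pi[of z] assms(1) by (auto simp: t_def cis_conv_exp is_Arg_def)
  have "cis pi = -1" "cis (3*pi) = -1" "cis (5 * pi) = -1"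
  proof -
    show 1: "cis pi = -1" by simp
    show "cis (3*pi) = -1" using Complex.DeMoivre[of pi 3] 1 by simp
    show "cis (5*pi) = -1" using Complex.DeMoivre[of pi 5] 1 by simp
  qed
  moreover have "cis (3 * t) \<noteq> -1" using assms(2) t(3) cis_cube[of t] by simp
  ultimately have "3 * t \<noteq> pi" "3 * t \<noteq> 3 * pi" "3 * t \<noteq> 5 * pi" by metis+
  then have ne: "t \<noteq> pi/3" "t \<noteq> pi" "t \<noteq> 5*pi/3" by auto
  consider "t < pi/3" | "pi/3 < t" "t < pi" | "pi < t" "t < 5*pi/3" | "5*pi/3 < t" using ne by linarith
  then show ?thesis
  proof cases
    case 1 then show ?thesis using that[of 0 t] t by (auto simp: arc_interval_def)
  next
    case 2 then show ?thesis using that[of 1 t] t by (auto simp: arc_interval_def)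
  next
    case 3 then show ?thesis using that[of 2 t] t by (auto simp: arc_interval_def)
  next
    case 4 
    have "cis (t - 2*pi) = z" using t by (simp add: cis_divide[symmetric])
    then show ?thesis using 4 that[of 0 "t - 2*pi"] t by (auto simp: arc_interval_def)
  qed
qed

lemma fix_param_continuous: "continuous_on S fix_param"
  unfolding fix_param_def tangent_point_def cis_conv_exp by (intro continuous_intros)

lemma fix_param_fixed:
  assumes "p \<in> strip k J" "0 < Im p"
  shows "1 < norm (fix_param p)" "blaschke (fix_param p) (cis (Re p)) = cis (Re p)"
    "circle_slope (fix_param p) (cis (Re p)) = 2 - 1 / Im p"
  using assms norm_tangent_point_gt_1 tangent_point_fixed[OF _ _ _ refl, of "cis (Re p)" "Im p"] cis_arc_cube unfolding fix_param_def strip_def by auto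

lemma fix_param_inj:
  assumes "p \<in> strip j {0<..1}" "q \<in> strip k {0<..1}" "j < 3" "k < 3" "fix_param p = fix_param q"
  shows "p = q" "j = k"
proof -
  have i: "0 < Im p" "Im p \<le> 1" "0 < Im q" "Im q \<le> 1" using assms by (auto simp: strip_def)
  then have s: "2 - 1 / Im p \<le> 1" "2 - 1 / Im q \<le> 1" by (auto simp: field_simps)
  note P = fix_param_fixed[OF assms(1) i(1)]
  note Q = fix_param_fixed[OF assms(2) i(3)]
  have c: "cis (Re p) = cis (Re q)"
    by (rule unique_nonrepelling[of _ _ "fix_param p"]) (use P Q s assms(5) in auto)
  then have "2 - 1 / Im p = 2 - 1 / Im q" using P Q assms(5) by simp
  then have "Im p = Im q" using i by (simp add: field_simps)
  moreover have "Re p = Re q" "j = k" using cis_arc_inj[OF _ _ assms(3,4) c] assms(1,2) by (auto simp: strip_def)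
  ultimately show "p = q" "j = k" by (auto simp: complex_eq_iff)
qed

lemma fix_param_inj_on: "k < 3 \<Longrightarrow> J \<subseteq> {0<..1} \<Longrightarrow> inj_on fix_param (strip k J)"
  using fix_param_inj(1)[of _ k _ k] unfolding inj_on_def strip_def by blast

lemma strip_open: "open J \<Longrightarrow> open (strip k J)"
proof -
  assume J: "open J"
  have "strip k J = Re -` arc_interval k \<inter> Im -` J" unfolding strip_def by auto
  moreover have "open (Re -` arc_interval k)" "open (Im -` J)"
    using J by (auto intro!: open_vimage continuous_intros simp: arc_interval_def)
  ultimately show ?thesis by (simp add: open_Int)
qed

lemma region_open: "k < 3 \<Longrightarrow> open J \<Longrightarrow> J \<subseteq> {0<..1} \<Longrightarrow> open (region k J)"
  unfolding region_def by (intro invariance_of_domain fix_param_continuous strip_open fix_param_inj_on)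

lemma region_disjoint:
  assumes "i < 3" "j < 3" "J \<subseteq> {0<..1}" "K \<subseteq> {0<..1}" "i \<noteq> j \<or> J \<inter> K = {}"
  shows "region i J \<inter> region j K = {}"
proof (rule ccontr)
  assume "region i J \<inter> region j K \<noteq> {}"
  then obtain p q where pq: "p \<in> strip i J" "q \<in> strip j K" "fix_param p = fix_param q" unfolding region_def by auto
  have "p \<in> strip i {0<..1}" "q \<in> strip j {0<..1}" using pq assms unfolding strip_def by auto
  from fix_param_inj[OF this assms(1,2) pq(3)] show False using pq assms unfolding strip_def by auto
qed

lemma strip_convex: "convex J \<Longrightarrow> convex (strip k J)"
proof -
  assume J: "convex J"
  have "strip k J = Re -` arc_interval k \<inter> Im -` J" unfolding strip_def by auto
  moreover have "convex (Re -` arc_interval k)" "convex (Im -` J)"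
    using J by (auto intro!: convex_linear_vimage simp: arc_interval_def linear_iff)
  ultimately show ?thesis by (simp add: convex_Int)
qed

lemma region_connected: "convex J \<Longrightarrow> connected (region k J)"
  unfolding region_def
  by (intro connected_continuous_image fix_param_continuous convex_connected strip_convex)

lemma strip_nonempty: "t \<in> J \<Longrightarrow> Complex (2 * pi * real k / 3) t \<in> strip k J"
  using pi_gt_zero by (auto simp: strip_def arc_interval_def)

lemma region_nonempty: "J \<noteq> {} \<Longrightarrow> region k J \<noteq> {}"
  using strip_nonempty unfolding region_def by blast

lemma region_outer: "k < 3 \<Longrightarrow> J \<subseteq> {0<..} \<Longrightarrow> region k J \<subseteq> outer_plane"
  using fix_param_fixed(1) unfolding region_def outer_plane_def strip_def by fastforce

lemma region_mono: "J \<subseteq> K \<Longrightarrow> region k J \<subseteq> region k K"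
  unfolding region_def strip_def by auto

lemma region_Un: "region k (J \<union> K) = region k J \<union> region k K"
  unfolding region_def strip_def by auto

text \<open>
  The vertical edges of the closed rectangle and its edge at height 0 are mapped into the unit circle.
  So closures within \<open>norm a > 1\<close> can be read off from this image, which is compact for
  compact \<open>J\<close>.
\<close>
definition region_hull :: "nat \<Rightarrow> real set \<Rightarrow> complex set" where
  "region_hull k J = fix_param ` {p. Re p \<in> closure (arc_interval k) \<and> Im p \<in> J}"

lemma region_hull_outer:
  assumes "J \<subseteq> {0..}"
  shows "region_hull k J \<inter> outer_plane = region k (J - {0})"
proof
  show "region_hull k J \<inter> outer_plane \<subseteq> region k (J - {0})"
  proof
    fix a assume a: "a \<in> region_hull k J \<inter> outer_plane"
    then obtain p where p: "a = fix_param p" "Re p \<in> closure (arc_interval k)" "Im p \<in> J"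
      unfolding region_hull_def by auto
    define z where "z = cis (Re p)"
    have nz: "norm z = 1" unfolding z_def by simp
    have "1 < norm a" using a unfolding outer_plane_def by auto
    then have "1 < (norm (tangent_point z (Im p)))\<^sup>2" unfolding p(1) fix_param_def z_def by (simp add: one_less_power)
    then have pos: "0 < 2 * Im p * (1 + Im p) * (1 + Re (z ^ 3))" using norm_tangent_point[OF nz, of "Im p"] by linarith
    then have "Im p \<noteq> 0" by auto
    moreover have "z ^ 3 \<noteq> -1" using pos Re_cube_eq_m1[OF nz] by auto
    have "Re p \<in> arc_interval k"
    proof (rule ccontr)
      assume n: "Re p \<notin> arc_interval k"
      have "closure (arc_interval k) = {2 * pi * real k / 3 - pi / 3 .. 2 * pi * real k / 3 + pi / 3}"
        unfolding arc_interval_def by (rule closure_greaterThanLessThan) (use pi_gt_zero in simp)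
      with p(2) n have "Re p = 2 * pi * real k / 3 - pi / 3 \<or> Re p = 2 * pi * real k / 3 + pi / 3"
        unfolding arc_interval_def by auto
      then have "3 * Re p = 2 * pi * real k - pi \<or> 3 * Re p = 2 * pi * real k + pi" by auto
      moreover have "cos (2 * pi * real k - pi) = -1" "cos (2 * pi * real k + pi) = -1"
        using cos_int_2pin[of "int k"] sin_int_2pin[of "int k"] by (auto simp: cos_diff cos_add)
      ultimately have "cos (3 * Re p) = -1" by metis
      then have "Re (z ^ 3) = -1" unfolding z_def cis_cube by simp
      then show False using pos by simp
    qed
    ultimately show "a \<in> region k (J - {0})" using p unfolding region_def strip_def by auto
  qed
  have 1: "region k (J - {0}) \<subseteq> region_hull k J"
    unfolding region_def strip_def region_hull_def using closure_subset[of "arc_interval k"] by auto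
  have "J - {0} \<subseteq> {0<..}" using assms by force
  then have 2: "region k (J - {0}) \<subseteq> outer_plane"
    using fix_param_fixed(1) unfolding region_def outer_plane_def strip_def by fastforce
  show "region k (J - {0}) \<subseteq> region_hull k J \<inter> outer_plane" using 1 2 by auto
qed

lemma region_hull_compact: "compact J \<Longrightarrow> compact (region_hull k J)"
proof -
  assume J: "compact J"
  have "{p. Re p \<in> closure (arc_interval k) \<and> Im p \<in> J}
     = (\<lambda>(x, y). Complex x y) ` (closure (arc_interval k) \<times> J)"
    by (force simp: image_iff)
  moreover have "compact (closure (arc_interval k))" unfolding arc_interval_def by simp
  moreover have "continuous_on S (\<lambda>(x, y). Complex x y)" for S
    unfolding case_prod_unfold Complex_eq by (intro continuous_intros)
  ultimately have "compact {p. Re p \<in> closure (arc_interval k) \<and> Im p \<in> J}"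
    using J by (metis compact_continuous_image compact_Times)
  then show ?thesis unfolding region_hull_def by (intro compact_continuous_image fix_param_continuous)
qed

lemma region_subset_hull: "J \<subseteq> K \<Longrightarrow> region k J \<subseteq> region_hull k K"
  unfolding region_def strip_def region_hull_def using closure_subset[of "arc_interval k"] by auto

text \<open>The next two lemmas determine the closure of a region relative to the outer plane.\<close>
lemma region_closure_upper:
  assumes "J \<subseteq> {x..y}" "0 \<le> x"
  shows "closure (region k J) \<inter> outer_plane \<subseteq> region k ({x..y} - {0})"
proof -
  have "closure (region k J) \<subseteq> region_hull k {x..y}"
    using assms by (intro closure_minimal region_subset_hull compact_imp_closed region_hull_compact) auto
  then show ?thesis using region_hull_outer[of "{x..y}" k] assms by auto
qed

lemma region_closure_lower:
  assumes "J \<subseteq> closure K"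
  shows "region k J \<subseteq> closure (region k K)"
proof -
  have "strip k J \<subseteq> closure (strip k K)"
  proof
    fix p assume p: "p \<in> strip k J"
    then have "Im p \<in> closure K" using assms by (auto simp: strip_def)
    then obtain f where f: "\<And>n. f n \<in> K" "f \<longlonglongrightarrow> Im p" unfolding closure_sequential by auto
    have "(\<lambda>n. Complex (Re p) (f n)) \<longlonglongrightarrow> Complex (Re p) (Im p)"
      by (intro tendsto_Complex tendsto_const f)
    moreover have "\<And>n. Complex (Re p) (f n) \<in> strip k K" using p f by (auto simp: strip_def)
    ultimately show "p \<in> closure (strip k K)" unfolding closure_sequential complex_surj
      by (intro exI[of _ "\<lambda>n. Complex (Re p) (f n)"]) auto
  qed
  then show ?thesis unfolding region_def
    using image_closure_subset[OF fix_param_continuous closed_closure closure_subset, of "strip k K"] by blast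
qed


section \<open>Boundary of an extended tongue\<close>

lemma components_eq_open_partition:
  assumes U: "\<Union>F = S" and d: "pairwise disjnt F"
    and A: "\<And>A. A \<in> F \<Longrightarrow> connected A" "\<And>A. A \<in> F \<Longrightarrow> A \<noteq> {}"
      "\<And>A. A \<in> F \<Longrightarrow> openin (top_of_set S) A"
  shows "components S = F"
proof -
  have sub: "C \<in> F" if C: "C \<in> components S" for C
  proof -
    obtain x where x: "x \<in> C" using C in_components_nonempty by blast
    have CS: "C \<subseteq> S" using C in_components_subset by blast
    obtain B where B: "B \<in> F" "x \<in> B" using x CS U by blast
    have BC: "B \<subseteq> C" using components_maximal[OF C A(1)[OF B(1)]] B x U by blast
    have o1: "openin (top_of_set C) B" using A(3)[OF B(1)] BC CS openin_subset_trans by blast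
    have "openin (top_of_set S) (\<Union>(F - {B}))" using A(3) by blast
    then obtain T where T: "open T" "\<Union>(F - {B}) = S \<inter> T" unfolding openin_open by blast
    have "C - B = \<Union>(F - {B}) \<inter> C" using d B U CS unfolding pairwise_def disjnt_def by blast
    then have "C - B = C \<inter> T" using T CS by blast
    then have "openin (top_of_set C) (C - B)" using T unfolding openin_open by blast
    then have "closedin (top_of_set C) B" using BC by (simp add: closedin_def double_diff)
    then have "B = C" using o1 in_components_connected[OF C] connected_clopen A(2)[OF B(1)] by blast
    then show ?thesis using B by simp
  qed
  moreover have "B \<in> components S" if B: "B \<in> F" for B
  proof -
    obtain x where x: "x \<in> B" using A(2) B by blast
    have c: "connected_component_set S x \<in> components S" using x B U by (auto simp: components_def)
    then have "connected_component_set S x \<in> F" using sub by blast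
    moreover have "x \<in> connected_component_set S x" using x B U by auto
    ultimately have "connected_component_set S x = B"
      using pairwiseD[OF d _ B, of "connected_component_set S x"] x unfolding disjnt_iff by metis
    then show ?thesis using c by simp
  qed
  ultimately show ?thesis by blast
qed

lemma attracting_iff_sheet:
  assumes "1 < norm a"
  shows "attracting_periodic a 1 z \<longleftrightarrow>
    (\<exists>k<3. \<exists>p\<in>strip k {1/3<..<1}. a = fix_param p \<and> z = cis (Re p))"
proof
  assume "attracting_periodic a 1 z"
  then have h: "norm z = 1" "blaschke a z = z" "\<bar>circle_slope a z\<bar> < 1" using attracting_1[OF assms] by auto
  define t where "t = 1 / (2 - circle_slope a z)"
  have t: "1/3 < t" "t < 1" using h(3) unfolding t_def by (auto simp: field_simps)
  have f: "z ^ 3 \<noteq> -1" "a = tangent_point z t" using fixed_imp_tangent_point[OF h(1) assms h(2)] h(3) t_def by auto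
  obtain k x where kx: "k < 3" "x \<in> arc_interval k" "z = cis x" using cis_arc_surj h(1) f(1) by blast
  show "\<exists>k<3. \<exists>p\<in>strip k {1/3<..<1}. a = fix_param p \<and> z = cis (Re p)"
    using kx t f by (intro exI[of _ k] conjI bexI[of _ "Complex x t"]) (auto simp: fix_param_def strip_def)
next
  assume "\<exists>k<3. \<exists>p\<in>strip k {1/3<..<1}. a = fix_param p \<and> z = cis (Re p)"
  then obtain k p where p: "p \<in> strip k {1/3<..<1}" "a = fix_param p" "z = cis (Re p)" by auto
  then have i: "1/3 < Im p" "Im p < 1" by (auto simp: strip_def)
  then have "0 < Im p" by linarith
  from fix_param_fixed[OF p(1) this] show "attracting_periodic a 1 z"
  proof -
    assume f: "blaschke (fix_param p) (cis (Re p)) = cis (Re p)" "circle_slope (fix_param p) (cis (Re p)) = 2 - 1 / Im p"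
    have "1 < 1 / Im p" "1 / Im p < 3" using i \<open>0 < Im p\<close> by (simp_all add: field_simps)
    then have "\<bar>2 - 1 / Im p\<bar> < 1" by linarith
    then show ?thesis unfolding attracting_1[OF assms] using p f by simp
  qed
qed

lemma region_line_deltoid:
  assumes "a \<in> region k {1}" shows "deltoid a = 0"
  using assms deltoid_tangent_point[of "cis _" 1] unfolding region_def strip_def fix_param_def by auto

lemma region_deltoid_neg:
  assumes "a \<in> region k {0<..<1}" shows "deltoid a < 0"
  using assms deltoid_tangent_point_le(2)[of "cis _"] cis_arc_cube unfolding region_def strip_def fix_param_def by auto

lemma region_hull_diff: "region k {0<..1} = region_hull k {0..1} \<inter> outer_plane"
proof -
  have "{0..1} - {0} = {0<..1::real}" by auto
  then show ?thesis using region_hull_outer[of "{0..1}" k] by auto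
qed

lemma open_outer_plane: "open outer_plane"
  unfolding outer_plane_def by (intro open_Collect_less continuous_intros)

lemma unit_intervals:
  "{1/3<..<1} \<subseteq> {1/3..1::real}" "{1/3<..<1} \<subseteq> {0<..1::real}" "{0<..<1/3} \<subseteq> {0<..1::real}"
  "{0<..<1/3} \<subseteq> {0..1::real}" "{0<..<1} \<subseteq> {0<..1::real}" "{1::real} \<subseteq> {0<..1}" "{1/3::real} \<subseteq> {0<..1}"
  "{0<..1} \<subseteq> closure {0<..<1::real}" "{1/3::real} \<subseteq> {0<..<1}" "{1/3..1} \<subseteq> {0<..1::real}"
  "{0<..1} \<subseteq> {0..1::real}"
  by auto

context
  fixes k :: nat assumes k: "k < 3"
begin

definition "outer_side = outer_plane - region k {0<..1}"

lemma open_outer_side: "open outer_side"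
proof -
  have "outer_side = outer_plane - region_hull k {0..1}" unfolding outer_side_def region_hull_diff by auto
  then show ?thesis using open_outer_plane compact_imp_closed[OF region_hull_compact[of "{0..1}" k]] by auto
qed

text \<open>
  Moving radially inwards keeps the discriminant negative, so the deltoid is never met. Hence the
  part of the segment that lies in the region is both open and closed.
\<close>
lemma segment_in_region:
  assumes a: "a \<in> region k {0<..<1}" and s: "1 < s" "1 < norm a / s"
  shows "a / of_real s \<in> region k {0<..1}"
proof -
  define S where "S = (\<lambda>r. of_real r * a) ` {1/s..1}"
  have conn: "connected S" unfolding S_def
    by (intro connected_continuous_image continuous_intros) auto
  have Sout: "S \<subseteq> outer_plane"
  proof
    fix x assume "x \<in> S"
    then obtain r where r: "1/s \<le> r" "x = of_real r * a" unfolding S_def by auto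
    have "1 / s * norm a \<le> r * norm a" using r by (intro mult_right_mono) auto
    moreover have "r \<ge> 0" using r s by (smt (verit) divide_nonneg_nonneg)
    ultimately show "x \<in> outer_plane" unfolding outer_plane_def using r s(2) by (simp add: norm_mult)
  qed
  have eq: "S \<inter> region_hull k {0..1} = S \<inter> region k {0<..<1}"
  proof
    show "S \<inter> region_hull k {0..1} \<subseteq> S \<inter> region k {0<..<1}"
    proof
      fix x assume x: "x \<in> S \<inter> region_hull k {0..1}"
      then have x1: "x \<in> region k {0<..1}" using Sout region_hull_diff by auto
      obtain r where r: "1/s \<le> r" "r \<le> 1" "x = of_real r * a" using x unfolding S_def by auto
      have r0: "0 < r" using r s by (smt (verit) zero_less_divide_1_iff)
      have an: "a \<noteq> 0" using s by auto
      have "x \<notin> region k {1}"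
      proof
        assume "x \<in> region k {1}"
        then have d: "deltoid x = 0" by (rule region_line_deltoid)
        have xn: "x \<noteq> 0" using r r0 an by auto
        have "0 \<le> deltoid a"
        proof (cases "r = 1")
          case True then show ?thesis using d r by simp
        next
          case False
          then have "0 < deltoid (of_real (1/r) * x)" using deltoid_scale[of x "1/r"] d xn r r0 by simp
          then show ?thesis using r r0 by simp
        qed
        then show False using region_deltoid_neg[OF a] by simp
      qed
      moreover have "{0<..1} = {0<..<1} \<union> {1::real}" by auto
      then have "x \<in> region k {0<..<1} \<union> region k {1}" using x1 by (simp only: region_Un)
      ultimately have "x \<in> region k {0<..<1}" by blast
      then show "x \<in> S \<inter> region k {0<..<1}" using x by simp
    qed
    have "region k {0<..<1} \<subseteq> region_hull k {0..1}" by (rule region_subset_hull) auto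
    then show "S \<inter> region k {0<..<1} \<subseteq> S \<inter> region_hull k {0..1}" by auto
  qed
  have o: "openin (top_of_set S) (S \<inter> region k {0<..<1})"
    using k by (intro openin_open_Int region_open) auto
  have c: "closedin (top_of_set S) (S \<inter> region k {0<..<1})"
    unfolding eq[symmetric] by (intro closedin_closed_Int compact_imp_closed region_hull_compact) auto
  have "a \<in> S" unfolding S_def using s by (intro image_eqI[of _ _ 1]) auto
  then have "S \<inter> region k {0<..<1} = S" using o c conn a unfolding connected_clopen by blast
  moreover have "a / of_real s \<in> S" unfolding S_def using s by (intro image_eqI[of _ _ "1/s"]) auto
  ultimately have "a / of_real s \<in> region k {0<..<1}" by auto
  then show ?thesis using region_mono[OF unit_intervals(5), of k] by blast
qed

text \<open>
  A point of the outer side that is carried into the region by a dilation could be moved slightly so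
  that its image has negative discriminant, against the previous lemma.
\<close>
lemma outer_side_scale:
  assumes a: "a \<in> outer_side" and s: "1 \<le> s"
  shows "of_real s * a \<in> outer_side"
proof (cases "s = 1")
  case True then show ?thesis using a by simp
next
  case False
  then have s1: "1 < s" using s by simp
  have na: "1 < norm a" using a unfolding outer_side_def outer_plane_def by simp
  have "norm a \<le> s * norm a" using s na by (simp add: mult_le_cancel_right1)
  then have out: "of_real s * a \<in> outer_plane" unfolding outer_plane_def using s na by (simp add: norm_mult)
  have "of_real s * a \<notin> region k {0<..1}"
  proof
    assume "of_real s * a \<in> region k {0<..1}"
    then have cl: "of_real s * a \<in> closure (region k {0<..<1})"
      using region_closure_lower[OF unit_intervals(8), of k] by blast
    define W where "W = (\<lambda>b. b / of_real s) -` outer_side"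
    have "open W" unfolding W_def using s1 by (intro open_vimage open_outer_side continuous_intros) auto
    moreover have "of_real s * a \<in> W" unfolding W_def using a s1 by simp
    ultimately obtain b where b: "b \<in> region k {0<..<1}" "b \<in> W"
      using cl by (meson disjoint_iff open_Int_closure_eq_empty)
    then have "b / of_real s \<in> outer_side" unfolding W_def by simp
    then have o: "b / of_real s \<in> outer_plane" "b / of_real s \<notin> region k {0<..1}"
      unfolding outer_side_def by auto
    then have "1 < norm b / s" unfolding outer_plane_def using s1 by (simp add: norm_divide)
    then show False using segment_in_region[OF b(1) s1] o by blast
  qed
  then show ?thesis using out unfolding outer_side_def by simp
qed

text \<open>
  On this open sheet the multiplier runs through the interval from -1 to 1; the three sheets turn out to
  be the components of the extended fixed tongue.
\<close>
definition "tongue_sheet = region k {1/3<..<1}"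

lemma tongue_sheet_open: "open tongue_sheet"
  unfolding tongue_sheet_def using k by (intro region_open) auto

lemma tongue_sheet_outer: "tongue_sheet \<subseteq> outer_plane"
  unfolding tongue_sheet_def using k by (intro region_outer) auto

lemma closure_tongue_sheet: "closure tongue_sheet \<inter> outer_plane = region k {1/3..1}"
proof
  have "{1/3..1} - {0} = {1/3..1::real}" by auto
  then show "closure tongue_sheet \<inter> outer_plane \<subseteq> region k {1/3..1}"
    unfolding tongue_sheet_def using region_closure_upper[OF unit_intervals(1), of k] by simp
  have "region k {1/3..1} \<subseteq> closure tongue_sheet"
    unfolding tongue_sheet_def by (intro region_closure_lower) auto
  moreover have "region k {1/3..1} \<subseteq> outer_plane" using k by (intro region_outer) auto
  ultimately show "region k {1/3..1} \<subseteq> closure tongue_sheet \<inter> outer_plane" by auto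
qed

lemma boundary_tongue_sheet: "boundary_in_plane tongue_sheet = region k {1} \<union> region k {1/3}"
proof -
  have "boundary_in_plane tongue_sheet = (closure tongue_sheet \<inter> outer_plane) - tongue_sheet"
    unfolding boundary_in_plane_def frontier_def interior_open[OF tongue_sheet_open] by auto
  also have "\<dots> = region k {1/3..1} - region k {1/3<..<1}"
    unfolding closure_tongue_sheet unfolding tongue_sheet_def ..
  also have "\<dots> = (region k {1/3<..<1} \<union> region k {1} \<union> region k {1/3}) - region k {1/3<..<1}"
  proof -
    have "{1/3..1} = {1/3<..<1} \<union> {1} \<union> {1/3::real}" by auto
    then show ?thesis by (simp only: region_Un)
  qed
  also have "\<dots> = region k {1} \<union> region k {1/3}"
    using region_disjoint[OF k k unit_intervals(6,2)] region_disjoint[OF k k unit_intervals(7,2)] by auto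
  finally show ?thesis .
qed

definition "tongue_hull = closure tongue_sheet \<union> cball 0 1"

text \<open>
  The complement is split by the height \<open>t\<close> into the part with multiplier below -1 and the part
  outside the whole region \<open>t \<le> 1\<close>. The former is bounded and the latter is a union of rays to
  infinity, which identifies them as the inside and the outside.
\<close>
lemma compl_tongue_hull: "- tongue_hull = region k {0<..<1/3} \<union> outer_side"
proof -
  have "- tongue_hull = outer_plane - (closure tongue_sheet \<inter> outer_plane)"
    unfolding tongue_hull_def outer_plane_def by auto
  also have "\<dots> = outer_plane - region k {1/3..1}" unfolding closure_tongue_sheet ..
  also have "\<dots> = region k {0<..<1/3} \<union> outer_side"
  proof -
    have "{0<..1} = {0<..<1/3} \<union> {1/3..1::real}" by auto
    then have "region k {0<..1} = region k {0<..<1/3} \<union> region k {1/3..1}" by (simp only: region_Un)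
    moreover have "region k {0<..<1/3} \<inter> region k {1/3..1} = {}" using k by (intro region_disjoint) auto
    moreover have "region k {0<..<1/3} \<subseteq> outer_plane" using k by (intro region_outer) auto
    ultimately show ?thesis unfolding outer_side_def by auto
  qed
  finally show ?thesis .
qed

lemma inner_outer_disjoint: "region k {0<..<1/3} \<inter> outer_side = {}"
  using region_mono[OF unit_intervals(3), of k] unfolding outer_side_def by auto

lemma inner_side_open: "open (region k {0<..<1/3})"
  using k by (intro region_open) auto

lemma inside_tongue_hull: "region k {0<..<1/3} \<subseteq> inside tongue_hull"
proof
  fix x assume x: "x \<in> region k {0<..<1/3}"
  let ?C = "connected_component_set (- tongue_hull) x"
  have C: "?C \<subseteq> region k {0<..<1/3} \<union> outer_side"
    using connected_component_subset[of "- tongue_hull" x] compl_tongue_hull by auto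
  have xC: "x \<in> ?C" using x compl_tongue_hull by auto
  have "outer_side \<inter> ?C = {}"
    using connectedD[OF connected_connected_component inner_side_open open_outer_side, of "- tongue_hull" x] C x xC
      inner_outer_disjoint by blast
  then have "?C \<subseteq> region_hull k {0..1}" using C region_subset_hull[OF unit_intervals(4), of k] by blast
  moreover have "bounded (region_hull k {0..1})" by (intro compact_imp_bounded region_hull_compact) simp
  ultimately have "bounded ?C" using bounded_subset by blast
  then show "x \<in> inside tongue_hull" using x compl_tongue_hull unfolding inside_def by auto
qed

lemma outside_tongue_hull: "outer_side \<subseteq> outside tongue_hull"
proof
  fix x assume x: "x \<in> outer_side"
  let ?C = "connected_component_set (- tongue_hull) x"
  define R where "R = (\<lambda>s. of_real s * x) ` {1..}"
  have nx: "1 < norm x" using x unfolding outer_side_def outer_plane_def by simp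
  have "connected R" unfolding R_def by (intro connected_continuous_image continuous_intros) auto
  moreover have "x \<in> R" unfolding R_def by (intro image_eqI[of _ _ 1]) auto
  moreover have "R \<subseteq> - tongue_hull" using outer_side_scale[OF x] compl_tongue_hull unfolding R_def by auto
  ultimately have RC: "R \<subseteq> ?C" by (simp add: connected_component_maximal)
  have "\<not> bounded R"
  proof
    assume "bounded R"
    then obtain B where B: "\<And>y. y \<in> R \<Longrightarrow> norm y \<le> B" unfolding bounded_iff by auto
    define s where "s = max 1 (B + 1)"
    have "of_real s * x \<in> R" unfolding R_def s_def by auto
    then have "s * norm x \<le> B" using B[of "of_real s * x"] unfolding s_def by (simp add: norm_mult)
    moreover have "s * 1 \<le> s * norm x" using nx unfolding s_def by (intro mult_left_mono) auto
    ultimately show False unfolding s_def by simp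
  qed
  then have "\<not> bounded ?C" using RC bounded_subset by blast
  then show "x \<in> outside tongue_hull" using x compl_tongue_hull unfolding outside_def by auto
qed

lemma inside_outside_eq:
  "inside tongue_hull = region k {0<..<1/3}" "outside tongue_hull = outer_side"
proof -
  have *: "I = A \<and> E = B" if "A \<subseteq> I" "B \<subseteq> E" "- T = A \<union> B" "I \<inter> E = {}" "I \<inter> T = {}" "E \<inter> T = {}"
    for I E T A B :: "complex set" using that by blast
  show "inside tongue_hull = region k {0<..<1/3}" "outside tongue_hull = outer_side"
    using *[OF inside_tongue_hull outside_tongue_hull compl_tongue_hull inside_Int_outside
        inside_no_overlap outside_no_overlap] by blast+
qed

lemma interior_boundary_sheet: "interior_boundary tongue_sheet = region k {1/3}"
proof -
  have eq: "interior_boundary tongue_sheet = (region k {1} \<union> region k {1/3}) \<inter> closure (region k {0<..<1/3})"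
    unfolding interior_boundary_def boundary_tongue_sheet tongue_hull_def[symmetric] inside_outside_eq ..
  have 1: "region k {1/3} \<subseteq> closure (region k {0<..<1/3})"
    by (intro region_closure_lower) auto
  have "region k {1} \<subseteq> outer_plane" using k by (intro region_outer) auto
  moreover have "closure (region k {0<..<1/3}) \<inter> outer_plane \<subseteq> region k ({0..1/3} - {0})"
    by (intro region_closure_upper) auto
  moreover have "region k ({0..1/3} - {0}) \<inter> region k {1} = {}" using k by (intro region_disjoint) auto
  ultimately show ?thesis unfolding eq using 1 by blast
qed

lemma exterior_boundary_sheet: "exterior_boundary tongue_sheet = region k {1}"
proof -
  have eq: "exterior_boundary tongue_sheet = (region k {1} \<union> region k {1/3}) \<inter> closure outer_side"
    unfolding exterior_boundary_def boundary_tongue_sheet tongue_hull_def[symmetric] inside_outside_eq ..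
  have o: "open (region k {0<..<1})" using k by (intro region_open) auto
  have "region k {0<..<1} \<inter> outer_side = {}"
    using region_mono[OF unit_intervals(5), of k] unfolding outer_side_def by auto
  then have "region k {0<..<1} \<inter> closure outer_side = {}" using o by (simp add: open_Int_closure_eq_empty)
  moreover have "region k {1/3} \<subseteq> region k {0<..<1}" by (rule region_mono) auto
  moreover have "region k {1} \<subseteq> closure outer_side"
  proof
    fix a assume a: "a \<in> region k {1}"
    have ao: "a \<in> outer_plane" using region_outer[OF k, of "{1}"] a by auto
    then have na: "1 < norm a" by (simp add: outer_plane_def)
    then have an: "a \<noteq> 0" by auto
    have os: "of_real s * a \<in> outer_side" if s: "1 < s" for s
    proof -
      have "0 < deltoid (of_real s * a)" using deltoid_scale[of a s] region_line_deltoid[OF a] s an by simp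
      moreover have "deltoid b \<le> 0" if "b \<in> region k {0<..1}" for b
        using that deltoid_tangent_point_le(1)[of "cis _"] unfolding region_def strip_def fix_param_def by auto
      ultimately have "of_real s * a \<notin> region k {0<..1}" by force
      moreover have "norm a \<le> s * norm a" using s na by (simp add: mult_le_cancel_right1)
      ultimately show ?thesis unfolding outer_side_def outer_plane_def using na s by (simp add: norm_mult)
    qed
    have "of_real (1 + 1 / real (Suc n)) * a \<in> outer_side" for n by (rule os) simp
    moreover have "(\<lambda>n. of_real (1 + 1 / real (Suc n)) * a) \<longlonglongrightarrow> of_real (1 + 0) * a"
      by (intro tendsto_intros LIMSEQ_Suc lim_1_over_n)
    ultimately show "a \<in> closure outer_side" unfolding closure_sequential
      by (intro exI[of _ "\<lambda>n. of_real (1 + 1 / real (Suc n)) * a"] conjI allI) (simp_all only: add_0_right of_real_1 mult_1)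
  qed
  ultimately show ?thesis unfolding eq by blast
qed

lemma components_boundary_sheet:
  "components (boundary_in_plane tongue_sheet) = {region k {1}, region k {1/3}}"
proof (rule components_eq_open_partition)
  have d: "region k {1} \<inter> region k {1/3} = {}" using k by (intro region_disjoint) auto
  then show "pairwise disjnt {region k {1}, region k {1/3}}" by (auto simp: pairwise_def disjnt_def)
  show "\<Union> {region k {1}, region k {1/3}} = boundary_in_plane tongue_sheet"
    unfolding boundary_tongue_sheet by auto
  fix A assume A: "A \<in> {region k {1}, region k {1/3}}"
  then obtain t where t: "A = region k {t}" by blast
  show "connected A" unfolding t by (rule region_connected) simp
  show "A \<noteq> {}" unfolding t by (rule region_nonempty) simp
  have h: "region k {t} = region_hull k {t} \<inter> outer_plane" if "t > 0" for t
    using region_hull_outer[of "{t}" k] that by auto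
  have e: "region k {1} = boundary_in_plane tongue_sheet \<inter> - region_hull k {1/3}"
    "region k {1/3} = boundary_in_plane tongue_sheet \<inter> - region_hull k {1}"
    using h[of 1] h[of "1/3"] d unfolding boundary_tongue_sheet by auto
  show "openin (top_of_set (boundary_in_plane tongue_sheet)) A"
  proof -
    have "open (- region_hull k {t})" for t by (intro open_Compl compact_imp_closed region_hull_compact) auto
    then have "openin (top_of_set B) (B \<inter> - region_hull k {t})" for t B by (intro openin_open_Int)
    then have "openin (top_of_set (boundary_in_plane tongue_sheet)) (region k {1})"
      "openin (top_of_set (boundary_in_plane tongue_sheet)) (region k {1/3})" by (simp_all only: e)
    then show ?thesis using A by blast
  qed
qed

lemma interior_line_homeomorphic: "region k {1/3} homeomorphic {0<..<1::real}"
proof -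
  have "strip k {1/3} homeomorphic region k {1/3}"
  proof -
    have o: "open (strip k {0<..<1})" by (rule strip_open) simp
    obtain g where "homeomorphism (strip k {0<..<1}) (fix_param ` strip k {0<..<1}) fix_param g"
      using invariance_of_domain_homeomorphism[OF o fix_param_continuous order_refl fix_param_inj_on[OF k unit_intervals(5)]] .
    then have g: "homeomorphism (strip k {0<..<1}) (region k {0<..<1}) fix_param g" unfolding region_def .
    have "homeomorphism (strip k {1/3}) (region k {1/3}) fix_param g"
      by (rule homeomorphism_of_subsets[OF g _ region_mono[OF unit_intervals(9)]])
         (auto simp: strip_def region_def)
    then show ?thesis unfolding homeomorphic_def by blast
  qed
  moreover have "arc_interval k homeomorphic strip k {1/3}"
  proof -
    have "homeomorphism (arc_interval k) (strip k {1/3}) (\<lambda>x. Complex x (1/3)) Re"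
    proof (rule homeomorphismI)
      show "continuous_on (arc_interval k) (\<lambda>x. Complex x (1/3))"
        unfolding Complex_eq by (intro continuous_intros)
      show "continuous_on (strip k {1/3}) Re" by (intro continuous_intros)
    qed (auto simp: strip_def complex_eq_iff)
    then show ?thesis unfolding homeomorphic_def by blast
  qed
  moreover have "{0<..<1::real} homeomorphic arc_interval k"
  proof -
    have "2 * pi * real k / 3 - pi / 3 < 2 * pi * real k / 3 + pi / 3" using pi_gt_zero by simp
    then have "arc_interval k homeomorphic (UNIV :: real set)"
      unfolding arc_interval_def by (rule homeomorphic_open_interval_UNIV)
    moreover have "{0<..<1::real} homeomorphic (UNIV :: real set)"
      by (rule homeomorphic_open_interval_UNIV) simp
    ultimately show ?thesis using homeomorphic_trans homeomorphic_sym by blast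
  qed
  ultimately show ?thesis using homeomorphic_trans homeomorphic_sym by meson
qed

end


section \<open>Fatou's theorem on critical points in immediate basins\<close>

lemma locally_injective_open_image:
  fixes f :: "complex \<Rightarrow> complex"
  assumes "open U" "f holomorphic_on U" "\<And>w. w \<in> U \<Longrightarrow> deriv f w \<noteq> 0" "open S" "S \<subseteq> U"
  shows "open (f ` S)"
  unfolding open_subopen[of "f ` S"]
proof
  fix y assume "y \<in> f ` S"
  then obtain x where x: "x \<in> S" "y = f x" by auto
  obtain r where r: "0 < r" "ball x r \<subseteq> S" "inj_on f (ball x r)"
    using has_complex_derivative_locally_injective[of f S x] holomorphic_on_subset[OF assms(2,5)] assms(3,4,5) x by blast
  have "open (f ` ball x r)"
    using r assms(5) continuous_on_subset[OF holomorphic_on_imp_continuous_on[OF assms(2)]]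
    by (intro invariance_of_domain) auto
  then show "\<exists>T. open T \<and> y \<in> T \<and> T \<subseteq> f ` S" using r x by (intro exI[of _ "f ` ball x r"]) auto
qed

text \<open>
  Properness makes the fibres finite and keeps preimages of points near \<open>y\<close> close to the fibre over
  \<open>y\<close>. A small neighbourhood of \<open>y\<close> therefore lifts to disjoint homeomorphic copies around the
  points of the fibre.
\<close>
lemma proper_unramified_covering:
  fixes f :: "complex \<Rightarrow> complex"
  assumes U: "open U" "U \<noteq> {}" and V: "open V" "connected V"
    and hol: "f holomorphic_on U" and der: "\<And>w. w \<in> U \<Longrightarrow> deriv f w \<noteq> 0"
    and sub: "f ` U \<subseteq> V"
    and proper: "\<And>K. compact K \<Longrightarrow> K \<subseteq> V \<Longrightarrow> compact {w \<in> U. f w \<in> K}"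
  shows "covering_space U f V"
proof
  note cont = holomorphic_on_imp_continuous_on[OF hol]
  show "continuous_on U f" by (rule cont)
  have oi: "open (f ` S)" if "open S" "S \<subseteq> U" for S
    using locally_injective_open_image[OF U(1) hol der that] by blast
  have clos: "closedin (top_of_set V) (f ` U)"
  proof -
    have "y \<in> f ` U" if y: "y \<in> V" "y \<in> closure (f ` U)" for y
    proof -
      obtain e where e: "e > 0" "cball y e \<subseteq> V" using V(1) y(1) open_contains_cball by blast
      define P where "P = {w \<in> U. f w \<in> cball y e}"
      have "compact P" unfolding P_def using e by (intro proper) auto
      then have "compact (f ` P)"
        by (intro compact_continuous_image continuous_on_subset[OF cont]) (auto simp: P_def)
      then have cl: "closed (f ` P)" by (rule compact_imp_closed)
      have "\<exists>x\<in>f ` P. dist x y < d" if "d > 0" for d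
      proof -
        have "0 < min d e" using that e by simp
        then obtain x where "x \<in> f ` U" "dist x y < min d e" using y(2) unfolding closure_approachable by blast
        then show ?thesis unfolding P_def by (force simp: dist_commute)
      qed
      then have "y \<in> f ` P" using closed_approachable[OF cl] by blast
      then show ?thesis unfolding P_def by auto
    qed
    then have "f ` U = V \<inter> closure (f ` U)" using sub closure_subset[of "f ` U"] by auto
    then show ?thesis using closedin_closed_Int[OF closed_closure[of "f ` U"], of V] by simp
  qed
  have opn: "openin (top_of_set V) (f ` U)"
    using oi[OF U(1)] sub by (simp add: openin_open_eq V(1))
  show surj: "f ` U = V" using V(2) clos opn U(2) unfolding connected_clopen by blast
  fix y assume y: "y \<in> V"
  obtain e where e: "e > 0" "cball y e \<subseteq> V" using V(1) y open_contains_cball by blast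
  define P where "P = {w \<in> U. f w \<in> {y}}"
  have compP: "compact P" unfolding P_def using y by (intro proper) auto
  have "\<exists>r>0. ball w r \<subseteq> U \<and> inj_on f (ball w r)" if "w \<in> U" for w
    using has_complex_derivative_locally_injective[of f U w] hol der that U(1) by blast
  then obtain R where R: "\<And>w. w \<in> U \<Longrightarrow> 0 < R w" "\<And>w. w \<in> U \<Longrightarrow> ball w (R w) \<subseteq> U"
    "\<And>w. w \<in> U \<Longrightarrow> inj_on f (ball w (R w))" by metis
  have "finite P"
  proof -
    have cover: "P \<subseteq> (\<Union>w\<in>P. ball w (R w))" using R(1) unfolding P_def by fastforce
    obtain D where D: "D \<subseteq> P" "finite D" "P \<subseteq> (\<Union>w\<in>D. ball w (R w))"
      by (rule compactE_image[OF compP _ cover]) auto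
    have "P \<subseteq> D"
    proof
      fix x assume x: "x \<in> P"
      then obtain w where w: "w \<in> D" "x \<in> ball w (R w)" using D by auto
      then have "w \<in> P" using D by auto
      then have "f x = f w" "w \<in> ball w (R w)" using x R(1) unfolding P_def by auto
      then have "x = w" using R(3)[of w] w \<open>w \<in> P\<close> unfolding P_def inj_on_def by blast
      then show "x \<in> D" using w by simp
    qed
    then show ?thesis using D finite_subset by blast
  qed
  define Q where "Q = R ` P \<union> (\<lambda>(x, x'). dist x x' / 2) ` {(x, x'). x \<in> P \<and> x' \<in> P \<and> x \<noteq> x'}"
  define r where "r = Min (insert 1 Q)"
  have "finite {(x, x'). x \<in> P \<and> x' \<in> P \<and> x \<noteq> x'}"
    by (rule finite_subset[of _ "P \<times> P"]) (use \<open>finite P\<close> in auto)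
  then have finQ: "finite Q" unfolding Q_def using \<open>finite P\<close> by auto
  have posQ: "\<And>q. q \<in> Q \<Longrightarrow> 0 < q" unfolding Q_def using R(1) by (auto simp: P_def)
  have r0: "0 < r" unfolding r_def using finQ posQ by (subst Min_gr_iff) auto
  have rle: "\<And>q. q \<in> Q \<Longrightarrow> r \<le> q" unfolding r_def using finQ by simp
  have rR: "r \<le> R w" if "w \<in> P" for w using rle[of "R w"] that unfolding Q_def by auto
  have PU: "P \<subseteq> U" unfolding P_def by auto
  have br: "ball w r \<subseteq> U" "inj_on f (ball w r)" if "w \<in> P" for w
  proof -
    have "ball w r \<subseteq> ball w (R w)" using rR[OF that] by auto
    moreover have "w \<in> U" using that PU by auto
    ultimately show "ball w r \<subseteq> U" "inj_on f (ball w r)" using R(2)[of w] inj_on_subset[OF R(3)[of w]] by auto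
  qed
  have disj: "ball w r \<inter> ball w' r = {}" if "w \<in> P" "w' \<in> P" "w \<noteq> w'" for w w'
  proof -
    have "r \<le> dist w w' / 2" using rle[of "dist w w' / 2"] that unfolding Q_def by force
    then show ?thesis by (intro disjoint_ballI) auto
  qed
  define N where "N = (\<Union>w\<in>P. ball w r)"
  define K where "K = {w \<in> U. f w \<in> cball y e}"
  have "compact K" unfolding K_def using e by (intro proper) auto
  then have "compact (K - N)" unfolding N_def by (intro compact_diff) auto
  then have "compact (f ` (K - N))"
    by (intro compact_continuous_image continuous_on_subset[OF cont]) (auto simp: K_def)
  then have cl: "closed (f ` (K - N))" by (rule compact_imp_closed)
  define T where "T = ball y e \<inter> - f ` (K - N) \<inter> (\<Inter>w\<in>P. f ` ball w r)"
  have oT: "open T" unfolding T_def using cl \<open>finite P\<close> br oi by (intro open_Int open_INT) auto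
  have yT: "y \<in> T"
  proof -
    have "y \<notin> f ` (K - N)"
    proof
      assume "y \<in> f ` (K - N)"
      then obtain w where "w \<in> K - N" "f w = y" by auto
      then have "w \<in> P" unfolding K_def P_def by auto
      then show False using \<open>w \<in> K - N\<close> r0 unfolding N_def by auto
    qed
    moreover have "y \<in> f ` ball w r" if "w \<in> P" for w using that r0 unfolding P_def by (intro image_eqI[of _ _ w]) auto
    ultimately show ?thesis unfolding T_def using e by auto
  qed
  have TV: "T \<subseteq> V" using e(2) unfolding T_def by auto
  define v where "v = (\<lambda>w. ball w r \<inter> f -` T) ` P"
  have "\<Union>v = U \<inter> f -` T"
  proof
    show "\<Union>v \<subseteq> U \<inter> f -` T" unfolding v_def using br by auto
    show "U \<inter> f -` T \<subseteq> \<Union>v"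
    proof
      fix x assume x: "x \<in> U \<inter> f -` T"
      then have "x \<in> K" unfolding K_def T_def by auto
      moreover have "f x \<notin> f ` (K - N)" using x unfolding T_def by auto
      ultimately have "x \<in> N" by blast
      then show "x \<in> \<Union>v" using x unfolding v_def N_def by auto
    qed
  qed
  moreover have "\<forall>u\<in>v. openin (top_of_set U) u"
  proof
    fix u assume "u \<in> v"
    then obtain w where w: "w \<in> P" "u = ball w r \<inter> f -` T" unfolding v_def by auto
    have "open (ball w r \<inter> f -` T)"
      using continuous_open_preimage[OF continuous_on_subset[OF cont br(1)[OF w(1)]] open_ball oT] .
    then show "openin (top_of_set U) u" using w br(1)[OF w(1)] U(1) by (auto simp: openin_open_eq)
  qed
  moreover have "pairwise disjnt v"
  proof (rule pairwiseI)
    fix u u' assume u: "u \<in> v" "u' \<in> v" "u \<noteq> u'"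
    then obtain w w' where "w \<in> P" "u = ball w r \<inter> f -` T" "w' \<in> P" "u' = ball w' r \<inter> f -` T"
      unfolding v_def by auto
    then show "disjnt u u'" using disj[of w w'] u(3) unfolding disjnt_def by auto
  qed
  moreover have "\<forall>u\<in>v. \<exists>q. homeomorphism u T f q"
  proof
    fix u assume "u \<in> v"
    then obtain w where w: "w \<in> P" "u = ball w r \<inter> f -` T" unfolding v_def by auto
    have ou: "open u" unfolding w(2)
      using continuous_open_preimage[OF continuous_on_subset[OF cont br(1)[OF w(1)]] open_ball oT] .
    have uU: "u \<subseteq> U" using w br(1) by auto
    have inj: "inj_on f u" using inj_on_subset[OF br(2)[OF w(1)]] w(2) by auto
    have "f ` u = T"
    proof
      show "f ` u \<subseteq> T" using w by auto
      show "T \<subseteq> f ` u"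
      proof
        fix t assume t: "t \<in> T"
        then obtain x where "x \<in> ball w r" "t = f x" using w(1) unfolding T_def by auto
        then show "t \<in> f ` u" using t w(2) by auto
      qed
    qed
    then show "\<exists>q. homeomorphism u T f q"
      using invariance_of_domain_homeomorphism[OF ou continuous_on_subset[OF cont uU] order_refl inj] by metis
  qed
  ultimately show "\<exists>T. y \<in> T \<and> openin (top_of_set V) T \<and>
          (\<exists>v. \<Union>v = U \<inter> f -` T \<and> (\<forall>u\<in>v. openin (top_of_set U) u) \<and> pairwise disjnt v \<and> (\<forall>u\<in>v. \<exists>q. homeomorphism u T f q))"
    using yT oT TV V(1) by (intro exI[of _ T] conjI exI[of _ v]) (auto simp: openin_open_eq)
qed

text \<open>
  This is Fatou's argument. If \<open>f\<close> is unramified on \<open>U\<close>, all its iterates have inverse branches on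
  one fixed disc around the fixed point, with values in \<open>U\<close>. Since \<open>U\<close> omits a disc around 0, the
  reciprocals of these branches are uniformly bounded, and so are their derivatives at the fixed
  point by Cauchy's inequality. But these derivatives grow like the inverse powers of the multiplier.
\<close>
lemma unramified_not_attracting:
  fixes f :: "complex \<Rightarrow> complex"
  assumes U: "open U" "connected U" "z \<in> U"
    and hol: "f holomorphic_on U" and der: "\<And>w. w \<in> U \<Longrightarrow> deriv f w \<noteq> 0"
    and sub: "f ` U \<subseteq> U"
    and proper: "\<And>K. compact K \<Longrightarrow> K \<subseteq> U \<Longrightarrow> compact {w \<in> U. f w \<in> K}"
    and fz: "f z = z" and r: "0 < r" "\<And>w. w \<in> U \<Longrightarrow> r \<le> norm w"
  shows "1 \<le> norm (deriv f z)"
proof (rule ccontr)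
  assume "\<not> 1 \<le> norm (deriv f z)"
  then have lt: "norm (deriv f z) < 1" by simp
  have cov: "covering_space U f U"
    using proper_unramified_covering[OF U(1) _ U(1,2) hol der sub proper] U(3) by blast
  obtain \<rho> where \<rho>: "\<rho> > 0" "ball z \<rho> \<subseteq> U" using U open_contains_ball by blast
  define D where "D = ball z \<rho>"
  have zD: "z \<in> D" using \<rho> D_def by simp
  have scD: "simply_connected D" "locally path_connected D"
    unfolding D_def by (auto intro: convex_imp_simply_connected convex_imp_locally_path_connected)
  have branch: "\<exists>g. continuous_on D g \<and> g ` D \<subseteq> U \<and> g z = z \<and> (\<forall>w\<in>D. (f ^^ n) (g w) = w)" for n
  proof (induction n)
    case 0
    show ?case using \<rho> by (intro exI[of _ "\<lambda>w. w"]) (auto simp: D_def)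
  next
    case (Suc n)
    then obtain g where g: "continuous_on D g" "g ` D \<subseteq> U" "g z = z" "\<And>w. w \<in> D \<Longrightarrow> (f ^^ n) (g w) = w" by blast
    have gU: "g \<in> D \<rightarrow> U" using g(2) by auto
    have gz: "g z = f z" using g(3) fz by simp
    obtain h where h: "continuous_on D h" "h \<in> D \<rightarrow> U" "h z = z" "\<And>w. w \<in> D \<Longrightarrow> f (h w) = g w"
      using covering_space_lift_strong[OF cov U(3) zD scD g(1) gU gz] by metis
    have "(f ^^ Suc n) (h w) = w" if "w \<in> D" for w
      using h(4)[OF that] g(4)[OF that] by (simp add: funpow_swap1)
    then show ?case using h by (intro exI[of _ h]) auto
  qed
  have fU: "f w \<in> U" if "w \<in> U" for w using sub that by auto
  have itU: "(f ^^ n) w \<in> U" if "w \<in> U" for n w using that fU by (induction n) auto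
  have dern: "\<exists>d. d \<noteq> 0 \<and> ((f ^^ n) has_field_derivative d) (at w)" if "w \<in> U" for n w
  proof (induction n)
    case 0
    show ?case using DERIV_ident[of "at w"] by (intro exI[of _ 1]) (auto simp: id_def)
  next
    case (Suc n)
    then obtain d where d: "d \<noteq> 0" "((f ^^ n) has_field_derivative d) (at w)" by blast
    have "(f has_field_derivative deriv f ((f ^^ n) w)) (at ((f ^^ n) w))"
      using holomorphic_derivI[OF hol U(1) itU[OF that]] .
    from DERIV_chain[OF this d(2)]
    have "((f ^^ Suc n) has_field_derivative deriv f ((f ^^ n) w) * d) (at w)" unfolding funpow.simps(2) .
    moreover have "deriv f ((f ^^ n) w) * d \<noteq> 0" using d(1) der[OF itU[OF that]] by simp
    ultimately show ?case by blast
  qed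
  have derz: "((f ^^ n) has_field_derivative deriv f z ^ n) (at z)" for n
  proof (induction n)
    case 0
    show ?case using DERIV_ident[of "at z"] by (auto simp: id_def)
  next
    case (Suc n)
    have "(f ^^ n) z = z" using fz by (induction n) auto
    then have "(f has_field_derivative deriv f z) (at ((f ^^ n) z))"
      using holomorphic_derivI[OF hol U(1) U(3)] by simp
    from DERIV_chain[OF this Suc] show ?case unfolding funpow.simps(2) power_Suc .
  qed
  define M where "M = norm z ^ 2 * (1 / r / (\<rho> / 2))"
  have bound: "norm (inverse (deriv f z ^ n)) \<le> M" for n
  proof -
    obtain g where g: "continuous_on D g" "g ` D \<subseteq> U" "g z = z" "\<And>w. w \<in> D \<Longrightarrow> (f ^^ n) (g w) = w"
      using branch by blast
    have cg: "isCont g w" if "w \<in> D" for w using g(1) that D_def by (simp add: continuous_on_eq_continuous_at)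
    have inv: "(g has_field_derivative inverse d) (at w)"
      if "w \<in> D" "d \<noteq> 0" "((f ^^ n) has_field_derivative d) (at (g w))" for w d
      by (rule has_field_derivative_inverse_basic[OF that(3,2) cg[OF that(1)] _ that(1) g(4)]) (auto simp: D_def)
    have hg: "g holomorphic_on D"
      unfolding holomorphic_on_def
      by (metis dern g(2) image_subset_iff inv field_differentiable_at_within field_differentiable_def)
    have dg: "deriv g z = inverse (deriv f z ^ n)"
      using inv[OF zD, of "deriv f z ^ n"] derz[of n] der[OF U(3)] g(3) by (simp add: DERIV_imp_deriv)
    have gr: "r \<le> norm (g w)" if "w \<in> D" for w using r(2) g(2) that by auto
    have g0: "g w \<noteq> 0" if "w \<in> D" for w using gr[OF that] r by auto
    have hi: "(\<lambda>w. inverse (g w)) holomorphic_on D" using hg g0 by (intro holomorphic_intros) auto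
    have sD: "cball z (\<rho> / 2) \<subseteq> D" using \<rho> unfolding D_def by auto
    have "norm ((deriv ^^ 1) (\<lambda>w. inverse (g w)) z) \<le> fact 1 * (1 / r) / (\<rho> / 2) ^ 1"
    proof (rule Cauchy_inequality)
      show "(\<lambda>w. inverse (g w)) holomorphic_on ball z (\<rho> / 2)"
        using hi sD by (meson ball_subset_cball holomorphic_on_subset subset_trans)
      show "continuous_on (cball z (\<rho> / 2)) (\<lambda>w. inverse (g w))"
        using hi sD by (meson continuous_on_subset holomorphic_on_imp_continuous_on)
      fix x assume "norm (z - x) = \<rho> / 2"
      then have "x \<in> D" using sD by (auto simp: dist_norm)
      then show "norm (inverse (g x)) \<le> 1 / r"
        using gr r(1) by (simp add: norm_inverse divide_inverse le_imp_inverse_le)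
    qed (use \<rho> in auto)
    moreover have "((\<lambda>w. inverse (g w)) has_field_derivative - (inverse (g z) * deriv g z * inverse (g z))) (at z)"
      using holomorphic_derivI[OF hg _ zD] g0[OF zD] by (intro DERIV_inverse') (auto simp: D_def)
    then have "deriv (\<lambda>w. inverse (g w)) z = - (inverse z * inverse (deriv f z ^ n) * inverse z)"
      using dg g(3) by (simp add: DERIV_imp_deriv)
    then have "norm (deriv (\<lambda>w. inverse (g w)) z) = norm (inverse (deriv f z ^ n)) / (norm z)\<^sup>2"
      by (simp only: norm_minus_cancel norm_mult norm_inverse)
         (simp only: power2_eq_square divide_inverse inverse_mult_distrib mult_ac)
    ultimately have "norm (inverse (deriv f z ^ n)) / (norm z)\<^sup>2 \<le> 1 / r / (\<rho> / 2)"
      by (simp only: funpow.simps One_nat_def comp_def id_def fact_Suc fact_0 of_nat_1 mult_1 power_Suc power_0 mult_1_right)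
    moreover have "0 < (norm z)\<^sup>2" using g0[OF zD] g(3) by simp
    ultimately show ?thesis unfolding M_def by (simp only: pos_divide_le_eq mult.commute)
  qed
  have pos: "0 < norm (deriv f z)" using der[OF U(3)] by simp
  then have "1 < inverse (norm (deriv f z))" using lt by (simp add: one_less_inverse_iff)
  then obtain n where "M < inverse (norm (deriv f z)) ^ n" using real_arch_pow by blast
  then show False using bound[of n] by (simp add: norm_inverse norm_power power_inverse)
qed


section \<open>Basins of attracting fixed points\<close>

text \<open>
  Near the superattracting points 0 and infinity there are trapping regions, which the basin of a
  point on the circle has to avoid.
\<close>
lemma blaschke_near_0:
  assumes "2 \<le> norm a" "norm w \<le> 1 / (2 * norm a)"
  shows "norm (blaschke a w) \<le> 1 / (2 * norm a)"
proof -
  define n where "n = norm a"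
  define x where "x = norm w"
  have n: "2 \<le> n" and x: "0 \<le> x" "x \<le> 1 / (2 * n)" using assms n_def x_def by auto
  have xn: "x * n \<le> 1/2" using x n by (simp add: field_simps)
  have "norm (cnj a * w) \<le> 1/2" using xn unfolding n_def x_def by (simp add: norm_mult mult.commute)
  then have den: "1/2 \<le> norm (1 - cnj a * w)" using norm_triangle_ineq2[of 1 "cnj a * w"] by simp
  have num: "norm (w - a) \<le> x + n" unfolding x_def n_def by (rule norm_triangle_ineq4)
  have "norm (blaschke a w) = x ^ 3 * norm (w - a) / norm (1 - cnj a * w)"
    unfolding blaschke_def x_def by (simp add: norm_mult norm_divide norm_power)
  also have "\<dots> \<le> x ^ 3 * (x + n) / (1/2)"
    using num den x n by (intro frac_le mult_left_mono) auto
  also have "\<dots> = 2 * x * ((x * x) * x + x * (x * n))" by (simp add: algebra_simps power3_eq_cube)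
  also have "\<dots> \<le> 2 * x * (1/4 * 1/4 * 1/4 + 1/4 * (1/2))"
  proof -
    have "1 / (2 * n) \<le> 1/4" using n by (simp add: field_simps)
    then have x4: "x \<le> 1/4" using x by linarith
    have "x * x \<le> 1/4 * (1/4)" using x4 x by (intro mult_mono) auto
    then have 1: "x * x * x \<le> 1/4 * (1/4) * (1/4)" using x4 x by (intro mult_mono) auto
    have 2: "x * (x * n) \<le> 1/4 * (1/2)" using x4 x xn n by (intro mult_mono) auto
    show ?thesis using 1 2 x by (intro mult_left_mono) auto
  qed
  also have "\<dots> \<le> x" using x by simp
  also have "\<dots> \<le> 1 / (2 * norm a)" using assms x_def by simp
  finally show ?thesis .
qed

lemma blaschke_near_infinity:
  assumes "2 \<le> norm a" "2 * norm a \<le> norm w"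
  shows "2 * norm a \<le> norm (blaschke a w)"
proof -
  define n where "n = norm a"
  define x where "x = norm w"
  have n: "2 \<le> n" and x: "2 * n \<le> x" using assms n_def x_def by auto
  have x0: "0 < x" using n x by linarith
  have nx: "1 < n * x" using mult_mono[of 2 n 4 x] n x by auto
  have "1 < norm (cnj a * w)" using nx unfolding n_def x_def by (simp add: norm_mult)
  then have den0: "0 < norm (1 - cnj a * w)" by (metis norm_one zero_less_norm_iff eq_iff_diff_eq_0 less_irrefl)
  have den: "norm (1 - cnj a * w) \<le> 2 * n * x"
    using norm_triangle_ineq4[of 1 "cnj a * w"] nx unfolding n_def x_def by (simp add: norm_mult)
  have num: "x / 2 \<le> norm (w - a)"
    using norm_triangle_ineq2[of w a] x unfolding n_def x_def by linarith
  have "2 * n \<le> x" by (rule x)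
  also have "x \<le> x * n" using x0 n by simp
  also have "\<dots> = x * (4 * n * n) / (4 * n)" using n by simp
  also have "\<dots> \<le> x * (x * x) / (4 * n)"
    using mult_mono[OF x x] x0 n by (intro divide_right_mono mult_left_mono) auto
  also have "\<dots> = x ^ 3 * (x / 2) / (2 * n * x)" using x0 n by (simp add: field_simps power3_eq_cube)
  also have "\<dots> \<le> x ^ 3 * norm (w - a) / norm (1 - cnj a * w)"
    using num den den0 x0 n by (intro frac_le mult_left_mono) auto
  also have "\<dots> = norm (blaschke a w)"
    unfolding blaschke_def x_def by (simp add: norm_mult norm_divide norm_power)
  finally show ?thesis unfolding n_def .
qed

text \<open>The convention \<open>1 / 0 = 0\<close> makes the reflection symmetry valid at the zeros and at the pole too.\<close>
lemma blaschke_reflection: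
  "blaschke a (inverse (cnj w)) = inverse (cnj (blaschke a w))"
proof (cases "w = 0 \<or> a = w \<or> cnj a * w = 1")
  case False
  then have n: "w \<noteq> 0" "w \<noteq> a" "cnj a * w \<noteq> 1" by auto
  have c: "cnj w \<noteq> 0" "cnj w - cnj a \<noteq> 0" "1 - a * cnj w \<noteq> 0"
  proof -
    show "cnj w \<noteq> 0" "cnj w - cnj a \<noteq> 0" using n by simp_all
    show "1 - a * cnj w \<noteq> 0"
    proof
      assume "1 - a * cnj w = 0"
      then have "cnj (1 - a * cnj w) = 0" by simp
      then show False using n(3) by simp
    qed
  qed
  show ?thesis unfolding blaschke_def using c by (simp add: divide_simps power3_eq_cube algebra_simps)
next
  case True
  then show ?thesis
  proof (elim disjE)
    assume "cnj a * w = 1"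
    then have 1: "blaschke a w = 0" by (simp add: blaschke_def)
    have "inverse w = cnj a" using \<open>cnj a * w = 1\<close> by (metis inverse_unique mult.commute)
    then have 2: "inverse (cnj w) = a" by (metis complex_cnj_cnj complex_cnj_inverse)
    have 3: "blaschke a a = 0" by (simp add: blaschke_def)
    show ?thesis by (simp only: 1 2 3 complex_cnj_zero inverse_zero)
  qed (auto simp: blaschke_def)
qed

lemma basin_singleton: "w \<in> basin a {z} \<longleftrightarrow> (\<lambda>n. (blaschke a ^^ n) w) \<longlonglongrightarrow> z"
  unfolding basin_def by (simp add: infdist_singleton tendsto_dist_iff[symmetric])

lemma basin_blaschke: "blaschke a w \<in> basin a {z} \<longleftrightarrow> w \<in> basin a {z}"
proof -
  have "(\<lambda>n. (blaschke a ^^ n) (blaschke a w)) = (\<lambda>n. (blaschke a ^^ Suc n) w)"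
    by (simp only: funpow_Suc_right o_apply)
  then show ?thesis unfolding basin_singleton using filterlim_sequentially_Suc[of "\<lambda>n. (blaschke a ^^ n) w" "nhds z"] by simp
qed

lemma basin_iterate: "(blaschke a ^^ n) w \<in> basin a {z} \<longleftrightarrow> w \<in> basin a {z}"
  by (induction n) (auto simp: basin_blaschke)

lemma basin_norm:
  assumes a: "2 \<le> norm a" and z: "norm z = 1" and w: "w \<in> basin a {z}"
  shows "1 / (2 * norm a) \<le> norm w" "norm w \<le> 2 * norm a"
proof -
  have lim: "(\<lambda>n. norm ((blaschke a ^^ n) w)) \<longlonglongrightarrow> 1"
    using w z unfolding basin_singleton by (metis tendsto_norm)
  show "1 / (2 * norm a) \<le> norm w"
  proof (rule ccontr)
    assume "\<not> 1 / (2 * norm a) \<le> norm w"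
    then have "norm ((blaschke a ^^ n) w) \<le> 1 / (2 * norm a)" for n
      by (induction n) (auto intro: blaschke_near_0[OF a])
    then have "1 \<le> 1 / (2 * norm a)" using LIMSEQ_le_const2[OF lim] by blast
    moreover have "1 / (2 * norm a) < 1" using a by (simp add: divide_less_eq)
    ultimately show False by simp
  qed
  show "norm w \<le> 2 * norm a"
  proof (rule ccontr)
    assume "\<not> norm w \<le> 2 * norm a"
    then have "2 * norm a \<le> norm ((blaschke a ^^ n) w)" for n
      by (induction n) (auto intro: blaschke_near_infinity[OF a])
    then have "2 * norm a \<le> 1" using LIMSEQ_le_const[OF lim] by blast
    then show False using a by simp
  qed
qed

lemma basin_reflection:
  assumes "w \<in> basin a {z}" "norm z = 1"
  shows "inverse (cnj w) \<in> basin a {z}"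
proof -
  have e: "(blaschke a ^^ n) (inverse (cnj w)) = inverse (cnj ((blaschke a ^^ n) w))" for n
    by (induction n) (auto simp: blaschke_reflection)
  have "(\<lambda>n. inverse (cnj ((blaschke a ^^ n) w))) \<longlonglongrightarrow> inverse (cnj z)"
    using assms unfolding basin_singleton by (intro tendsto_inverse tendsto_cnj) auto
  moreover have "inverse (cnj z) = z" using unit_circle_cnj(1)[OF assms(2)] by (metis inverse_unique mult.commute)
  ultimately show ?thesis unfolding basin_singleton e by simp
qed

lemma crit_formula:
  assumes "2 \<le> norm a"
  obtains s :: real where "s\<^sup>2 = ((norm a)\<^sup>2 - 4) * ((norm a)\<^sup>2 - 1)"
    "crit_plus a = a / of_real (3 * (norm a)\<^sup>2) * of_real (2 + (norm a)\<^sup>2 + s)"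
    "crit_minus a = a / of_real (3 * (norm a)\<^sup>2) * of_real (2 + (norm a)\<^sup>2 - s)"
proof
  let ?D = "((norm a)\<^sup>2 - 4) * ((norm a)\<^sup>2 - 1)"
  have "4 \<le> (norm a)\<^sup>2" using power_mono[OF assms, of 2] by simp
  then have D: "0 \<le> ?D" by simp
  then show "(sqrt ?D)\<^sup>2 = ?D" by simp
  have "csqrt (of_real ?D) = of_real (sqrt ?D)" using D by (rule of_real_sqrt[symmetric])
  then show "crit_plus a = a / of_real (3 * (norm a)\<^sup>2) * of_real (2 + (norm a)\<^sup>2 + sqrt ?D)"
    "crit_minus a = a / of_real (3 * (norm a)\<^sup>2) * of_real (2 + (norm a)\<^sup>2 - sqrt ?D)"
    unfolding crit_plus_def crit_minus_def by simp_all
qed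

lemma crit_reflection:
  assumes "2 \<le> norm a"
  shows "crit_plus a * cnj (crit_minus a) = 1" "crit_plus a + crit_minus a = of_real (4 + 2 * (norm a)\<^sup>2) / (3 * cnj a)"
proof -
  obtain s :: real where s: "s\<^sup>2 = ((norm a)\<^sup>2 - 4) * ((norm a)\<^sup>2 - 1)"
    "crit_plus a = a / of_real (3 * (norm a)\<^sup>2) * of_real (2 + (norm a)\<^sup>2 + s)"
    "crit_minus a = a / of_real (3 * (norm a)\<^sup>2) * of_real (2 + (norm a)\<^sup>2 - s)"
    using crit_formula[OF assms] .
  define A where "A = (norm a)\<^sup>2"
  have A0: "A \<noteq> 0" "a \<noteq> 0" using assms unfolding A_def by auto
  have AA: "a * cnj a = of_real A" unfolding A_def by (rule complex_norm_square[symmetric])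
  have "crit_plus a * cnj (crit_minus a) = a * cnj a * of_real ((2 + A + s) * (2 + A - s)) / of_real (9 * A\<^sup>2)"
    unfolding s(2,3) A_def[symmetric] by (simp add: power2_eq_square)
  also have "\<dots> = of_real (A * ((2 + A + s) * (2 + A - s)) / (9 * A\<^sup>2))" unfolding AA by simp
  also have "(2 + A + s) * (2 + A - s) = 9 * A" using s(1) unfolding A_def by algebra
  finally show "crit_plus a * cnj (crit_minus a) = 1" using A0 by (simp add: power2_eq_square)
  have "crit_plus a + crit_minus a = a / of_real (3 * A) * of_real (4 + 2 * A)"
    unfolding s(2,3) A_def[symmetric] distrib_left[symmetric] of_real_add[symmetric] by simp
  also have "complex_of_real (3 * A) = 3 * (a * cnj a)" using AA by simp
  finally show "crit_plus a + crit_minus a = of_real (4 + 2 * (norm a)\<^sup>2) / (3 * cnj a)"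
    unfolding A_def using A0 by simp
qed

lemma critical_points:
  assumes a: "2 \<le> norm a" and w: "w \<noteq> 0" "cnj a * w \<noteq> 1" and d: "deriv (blaschke a) w = 0"
  shows "w = crit_plus a \<or> w = crit_minus a"
proof -
  have a0: "a \<noteq> 0" "cnj a \<noteq> 0" using a by auto
  have AA: "a * cnj a = of_real ((norm a)\<^sup>2)" by (rule complex_norm_square[symmetric])
  have "(3 * w ^ 2 * (w - a) * (1 - cnj a * w) + w ^ 3 * (1 - cnj a * w) + cnj a * w ^ 3 * (w - a))
      / (1 - cnj a * w)\<^sup>2 = 0"
    using DERIV_imp_deriv[OF blaschke_field_derivative[OF w(2)]] d by simp
  then have "3 * w ^ 2 * (w - a) * (1 - cnj a * w) + w ^ 3 * (1 - cnj a * w) + cnj a * w ^ 3 * (w - a) = 0"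
    using w(2) by simp
  then have "w\<^sup>2 * (- 3 * cnj a * w\<^sup>2 + (4 + 2 * (a * cnj a)) * w - 3 * a) = 0" by algebra
  then have q: "- 3 * cnj a * w\<^sup>2 + (4 + 2 * (a * cnj a)) * w - 3 * a = 0" using w(1) by simp
  have S: "3 * cnj a * (crit_plus a + crit_minus a) = 4 + 2 * (a * cnj a)"
    unfolding crit_reflection(2)[OF a] AA using a0 by simp
  have P: "cnj a * (crit_plus a * crit_minus a) = a"
  proof -
    obtain s :: real where s: "s\<^sup>2 = ((norm a)\<^sup>2 - 4) * ((norm a)\<^sup>2 - 1)"
      "crit_plus a = a / of_real (3 * (norm a)\<^sup>2) * of_real (2 + (norm a)\<^sup>2 + s)"
      "crit_minus a = a / of_real (3 * (norm a)\<^sup>2) * of_real (2 + (norm a)\<^sup>2 - s)"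
      using crit_formula[OF a] .
    have "cnj (crit_minus a) * a = cnj a * crit_minus a" unfolding s(3) by simp
    then show ?thesis using crit_reflection(1)[OF a] by algebra
  qed
  have "cnj a * ((w - crit_plus a) * (w - crit_minus a)) = 0" using q S P by algebra
  then show ?thesis using a0 by auto
qed

lemma basin_contains_disc:
  assumes "1 < norm a" "norm z = 1" "blaschke a z = z" "norm (deriv (blaschke a) z) < 1"
  obtains \<rho> where "0 < \<rho>" "ball z \<rho> \<subseteq> basin a {z}"
proof -
  let ?f = "blaschke a"
  obtain c where c: "norm (deriv ?f z) < c" "c < 1" using assms(4) dense by blast
  have c0: "0 < c" using c(1) norm_ge_zero le_less_trans by blast
  have "cnj a * z \<noteq> 1" using unit_circle_neq(3)[OF assms(2,1)] by auto
  then have "(?f has_field_derivative deriv ?f z) (at z)"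
    using blaschke_field_derivative DERIV_imp_deriv by metis
  then have "((\<lambda>w. norm ((?f w - ?f z) / (w - z))) \<longlongrightarrow> norm (deriv ?f z)) (at z)"
    unfolding has_field_derivative_iff by (rule tendsto_norm)
  then have "\<forall>\<^sub>F w in at z. norm ((?f w - ?f z) / (w - z)) < c" using c(1) by (rule order_tendstoD)
  then obtain \<rho> where \<rho>: "\<rho> > 0" "\<And>w. w \<noteq> z \<Longrightarrow> dist w z < \<rho> \<Longrightarrow> norm ((?f w - ?f z) / (w - z)) < c"
    unfolding eventually_at by auto
  have contr: "dist (?f w) z \<le> c * dist w z" if "dist w z < \<rho>" for w
  proof (cases "w = z")
    case False
    then have "norm (?f w - z) / norm (w - z) < c" using \<rho>(2)[OF False that] assms(3) by (simp add: norm_divide)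
    then show ?thesis using False by (simp add: dist_norm pos_divide_less_eq)
  qed (use assms in simp)
  have it: "dist ((?f ^^ n) w) z \<le> c ^ n * dist w z \<and> dist ((?f ^^ n) w) z < \<rho>" if "dist w z < \<rho>" for w n
  proof (induction n)
    case (Suc n)
    have "dist ((?f ^^ Suc n) w) z \<le> c * dist ((?f ^^ n) w) z" using contr Suc by simp
    moreover have "c * dist ((?f ^^ n) w) z \<le> c * (c ^ n * dist w z)" using Suc c0 by (intro mult_left_mono) auto
    moreover have "c * dist ((?f ^^ n) w) z \<le> 1 * dist ((?f ^^ n) w) z" using c by (intro mult_right_mono) auto
    ultimately show ?case using Suc by auto
  qed (use that in auto)
  have "ball z \<rho> \<subseteq> basin a {z}"
  proof
    fix w assume "w \<in> ball z \<rho>"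
    then have w: "dist w z < \<rho>" by (simp add: dist_commute)
    have l0: "(\<lambda>n. c ^ n * dist w z) \<longlonglongrightarrow> 0"
      using c c0 by (intro tendsto_mult_left_zero LIMSEQ_power_zero) auto
    have "\<forall>n. norm (dist ((?f ^^ n) w) z) \<le> c ^ n * dist w z" using it[OF w] by simp
    then have "(\<lambda>n. dist ((?f ^^ n) w) z) \<longlonglongrightarrow> 0"
      by (rule Lim_null_comparison[OF always_eventually l0])
    then show "w \<in> basin a {z}" unfolding basin_singleton by (subst tendsto_dist_iff)
  qed
  then show ?thesis using that \<rho>(1) by blast
qed

text \<open>
  The immediate basin \<open>U\<close> is open and \<open>f\<close> maps it properly into itself, so it contains a
  critical point by Fatou's argument. Reflection in the circle preserves \<open>U\<close> and exchanges the two
  free critical points.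
\<close>
lemma attracting_fixed_marked:
  assumes a: "2 \<le> norm a" and att: "attracting_periodic a 1 z"
  shows "marked_point a z"
proof -
  let ?f = "blaschke a" and ?B = "basin a {z}"
  have a1: "1 < norm a" using a by simp
  have z: "norm z = 1" "?f z = z" "norm (deriv ?f z) < 1"
    using att unfolding attracting_periodic_def circle_periodic_1 multiplier_def by auto
  have z0: "z \<noteq> 0" using z by auto
  have zB: "z \<in> ?B" unfolding basin_singleton
  proof -
    have "(?f ^^ n) z = z" for n using z by (induction n) auto
    then show "(\<lambda>n. (?f ^^ n) z) \<longlonglongrightarrow> z" by simp
  qed
  have B0: "w \<noteq> 0" if "w \<in> ?B" for w using basin_norm(1)[OF a z(1) that] a by (auto simp: field_simps)
  have Bpole: "cnj a * w \<noteq> 1" if "w \<in> ?B" for w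
  proof
    assume "cnj a * w = 1"
    then have "?f w = 0" by (simp add: blaschke_def)
    then show False using B0[of "?f w"] that basin_blaschke by blast
  qed
  have contf: "isCont ?f w" if "cnj a * w \<noteq> 1" for w
    using DERIV_isCont[OF blaschke_field_derivative[OF that]] .
  have openB: "open ?B"
  proof -
    obtain \<rho> where \<rho>: "0 < \<rho>" "ball z \<rho> \<subseteq> ?B" using basin_contains_disc[OF a1 z] .
    have "\<exists>T. open T \<and> w \<in> T \<and> T \<subseteq> ?B" if w: "w \<in> ?B" for w
    proof -
      have itc: "isCont (?f ^^ n) w" for n
      proof (induction n)
        case (Suc n)
        have "cnj a * (?f ^^ n) w \<noteq> 1" using Bpole w basin_iterate by blast
        then show ?case using isCont_o2[OF Suc contf] by (simp add: o_def)
      qed (simp add: id_def)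
      have "\<forall>\<^sub>F n in sequentially. dist ((?f ^^ n) w) z < \<rho>"
        using w \<rho>(1) unfolding basin_singleton by (rule tendstoD)
      then obtain n where n: "(?f ^^ n) w \<in> ball z \<rho>" unfolding eventually_sequentially by (auto simp: dist_commute)
      have "\<forall>\<^sub>F x in nhds w. (?f ^^ n) x \<in> ball z \<rho>"
        using itc[of n] n by (metis continuous_at topological_tendstoD open_ball tendsto_at_iff_tendsto_nhds)
      then obtain T where "open T" "w \<in> T" "\<And>x. x \<in> T \<Longrightarrow> (?f ^^ n) x \<in> ball z \<rho>"
        unfolding eventually_nhds by blast
      then have "T \<subseteq> ?B" using \<rho>(2) basin_iterate[of n a _ z] by blast
      then show ?thesis using \<open>open T\<close> \<open>w \<in> T\<close> by blast
    qed
    then show ?thesis using open_subopen[of ?B] by simp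
  qed
  define U where "U = connected_component_set ?B z"
  have UB: "U \<subseteq> ?B" unfolding U_def by (rule connected_component_subset)
  have zU: "z \<in> U" unfolding U_def using zB by auto
  have oU: "open U" unfolding U_def using openB by (rule open_connected_component)
  have cU: "connected U" unfolding U_def by (rule connected_connected_component)
  have maxU: "S \<subseteq> U" if S: "connected S" "S \<subseteq> ?B" "S \<inter> U \<noteq> {}" for S
  proof -
    obtain s where s: "s \<in> S" "s \<in> U" using S(3) by blast
    then have "connected_component_set ?B s = U" unfolding U_def using connected_component_eq[of s ?B z] by blast
    then show ?thesis using connected_component_maximal[OF s(1) S(1,2)] by simp
  qed
  have hol: "?f holomorphic_on U"
    using blaschke_field_derivative Bpole UB oU unfolding holomorphic_on_def
    by (meson field_differentiable_at_within field_differentiable_def subsetD)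
  have contU: "continuous_on U ?f" using hol by (rule holomorphic_on_imp_continuous_on)
  have fU: "?f ` U \<subseteq> U"
  proof (rule maxU)
    show "connected (?f ` U)" using contU cU by (rule connected_continuous_image)
    show "?f ` U \<subseteq> ?B" using UB basin_blaschke[of a _ z] by auto
    have "z \<in> ?f ` U" using zU z(2) by (intro image_eqI[of _ _ z]) auto
    then show "?f ` U \<inter> U \<noteq> {}" using zU by blast
  qed
  have proper: "compact {w \<in> U. ?f w \<in> K}" if K: "compact K" "K \<subseteq> U" for K
  proof -
    have "{w \<in> U. ?f w \<in> K} \<subseteq> cball 0 (2 * norm a)" using UB basin_norm(2)[OF a z(1)] by auto
    then have bd: "bounded {w \<in> U. ?f w \<in> K}" by (rule bounded_subset[OF bounded_cball])
    have "closed {w \<in> U. ?f w \<in> K}" unfolding closed_sequential_limits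
    proof (intro allI impI)
      fix x w assume "(\<forall>n. x n \<in> {w \<in> U. ?f w \<in> K}) \<and> x \<longlonglongrightarrow> w"
      then have x: "\<And>n. x n \<in> U" "\<And>n. ?f (x n) \<in> K" "x \<longlonglongrightarrow> w" by auto
      \<comment> \<open>The limit is not the pole, as otherwise \<open>f (x n)\<close> would be unbounded.\<close>
      have np: "cnj a * w \<noteq> 1"
      proof
        assume p: "cnj a * w = 1"
        obtain M where M: "\<And>y. y \<in> K \<Longrightarrow> norm y \<le> M" using compact_imp_bounded[OF K(1)] unfolding bounded_iff by blast
        have e: "?f (x n) * (1 - cnj a * x n) = x n ^ 3 * (x n - a)" for n
          using Bpole[of "x n"] x(1) UB by (auto simp: blaschke_def)
        have "(\<lambda>n. 1 - cnj a * x n) \<longlonglongrightarrow> 1 - cnj a * w" using x(3) by (intro tendsto_intros)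
        then have l0: "(\<lambda>n. 1 - cnj a * x n) \<longlonglongrightarrow> 0" using p by simp
        have "(\<lambda>n. ?f (x n) * (1 - cnj a * x n)) \<longlonglongrightarrow> 0"
          by (rule Lim_null_comparison[of _ "\<lambda>n. M * norm (1 - cnj a * x n)"])
             (use M x(2) tendsto_mult_right_zero[OF tendsto_norm_zero[OF l0], of M] in \<open>auto simp: norm_mult intro!: always_eventually mult_right_mono\<close>)
        then have "(\<lambda>n. x n ^ 3 * (x n - a)) \<longlonglongrightarrow> 0" unfolding e .
        moreover have "(\<lambda>n. x n ^ 3 * (x n - a)) \<longlonglongrightarrow> w ^ 3 * (w - a)" using x(3) by (intro tendsto_intros)
        ultimately have "w ^ 3 * (w - a) = 0" using LIMSEQ_unique by blast
        then have "w = 0 \<or> w = a" by auto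
        then have "w = a" using p by auto
        then have "of_real ((norm a)\<^sup>2) = (1::complex)" using p complex_norm_square[of a] by (simp add: mult.commute)
        then have "(norm a)\<^sup>2 = 1" using of_real_eq_1_iff by blast
        then show False using a by (simp add: power2_eq_1_iff)
      qed
      have lim: "(\<lambda>n. ?f (x n)) \<longlonglongrightarrow> ?f w" using isCont_tendsto_compose[OF contf[OF np] x(3)] .
      have fw: "?f w \<in> K"
        using closed_sequentially[OF compact_imp_closed[OF K(1)], of "\<lambda>n. ?f (x n)"] x(2) lim by blast
      then have wB: "w \<in> ?B" using K(2) UB basin_blaschke[of a w z] by auto
      then obtain e where e: "e > 0" "ball w e \<subseteq> ?B" using openB open_contains_ball by blast
      obtain n where "dist (x n) w < e" using metric_LIMSEQ_D[OF x(3) e(1)] order_refl by blast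
      then have "x n \<in> ball w e \<inter> U" using x(1) by (simp add: dist_commute)
      then have "ball w e \<subseteq> U" using maxU[OF connected_ball e(2)] by blast
      then show "w \<in> {w \<in> U. ?f w \<in> K}" using e(1) fw by auto
    qed
    then show ?thesis using bd by (simp add: compact_eq_bounded_closed)
  qed
  have "\<exists>w\<in>U. deriv ?f w = 0"
  proof (rule ccontr)
    assume "\<not> (\<exists>w\<in>U. deriv ?f w = 0)"
    then have nc: "\<And>w. w \<in> U \<Longrightarrow> deriv ?f w \<noteq> 0" by blast
    have "1 \<le> norm (deriv ?f z)"
    proof (rule unramified_not_attracting[OF oU cU zU hol nc fU proper z(2)])
      show "0 < 1 / (2 * norm a)" using a by (intro divide_pos_pos) linarith+
      show "\<And>w. w \<in> U \<Longrightarrow> 1 / (2 * norm a) \<le> norm w" using basin_norm(1)[OF a z(1)] UB by blast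
    qed
    then show False using z(3) by simp
  qed
  then obtain w where w: "w \<in> U" "deriv ?f w = 0" by blast
  have wc: "w = crit_plus a \<or> w = crit_minus a"
    using critical_points[OF a _ _ w(2)] B0 Bpole w(1) UB by blast
  have refl: "inverse (cnj u) \<in> U" if "u \<in> U" for u
  proof -
    have "(\<lambda>u. inverse (cnj u)) ` U \<subseteq> U"
    proof (rule maxU)
      show "connected ((\<lambda>u. inverse (cnj u)) ` U)"
        using B0 UB by (intro connected_continuous_image continuous_intros cU) auto
      show "(\<lambda>u. inverse (cnj u)) ` U \<subseteq> ?B" using UB basin_reflection[OF _ z(1)] by auto
      have "inverse (cnj z) = z" using unit_circle_cnj(1)[OF z(1)] by (metis inverse_unique mult.commute)
      then have "z \<in> (\<lambda>u. inverse (cnj u)) ` U" using zU by (intro image_eqI[of _ _ z]) auto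
      then show "(\<lambda>u. inverse (cnj u)) ` U \<inter> U \<noteq> {}" using zU by blast
    qed
    then show ?thesis using that by blast
  qed
  have r1: "inverse (cnj (crit_minus a)) = crit_plus a"
    using crit_reflection(1)[OF a] by (metis inverse_unique mult.commute)
  have r2: "inverse (cnj (crit_plus a)) = crit_minus a"
    using r1 by (metis complex_cnj_cnj complex_cnj_inverse inverse_inverse_eq)
  have crit: "crit_plus a \<in> U" "crit_minus a \<in> U" using wc w(1) refl r1 r2 by metis+
  have "(?f ^^ n) z = z" for n using z by (induction n) auto
  then have cyc: "cycle a z = {z}" unfolding cycle_def by auto
  have ib: "immediate_basin a (cycle a z) = U" unfolding immediate_basin_def cyc U_def by simp
  have "U \<in> components U" using cU zU by (auto simp: in_components_self)
  then show ?thesis unfolding marked_point_def ib using att zU crit by blast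
qed


section \<open>Lifts and the type of a parameter\<close>

lemma mono_periodic_imp_fixed:
  fixes g :: "real \<Rightarrow> real"
  assumes "mono g" "(g ^^ p) x = x" "0 < p"
  shows "g x = x"
proof -
  have up: "g x \<le> (g ^^ Suc n) x" if "x \<le> g x" for n
  proof (induction n)
    case (Suc n)
    then have "x \<le> (g ^^ Suc n) x" using that by simp
    then have "g x \<le> g ((g ^^ Suc n) x)" using assms(1) by (rule monoD[rotated])
    then show ?case by simp
  qed simp
  have down: "(g ^^ Suc n) x \<le> g x" if "g x \<le> x" for n
  proof (induction n)
    case (Suc n)
    then have "(g ^^ Suc n) x \<le> x" using that by simp
    then have "g ((g ^^ Suc n) x) \<le> g x" using assms(1) by (rule monoD[rotated])
    then show ?case by simp
  qed simp
  obtain n where "p = Suc n" using assms(3) gr0_implies_Suc by blast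
  then show ?thesis using up[of n] down[of n] assms(2) by (cases "x \<le> g x") auto
qed

locale degree_two_lift =
  fixes F :: "real \<Rightarrow> real" and M :: real
  assumes mono: "mono F" and deg: "\<And>x. F (x + 1) = F x + 2" and bound: "\<And>x. \<bar>F x - 2 * x\<bar> \<le> M"
begin

lemma shift: "F (x + of_int k) = F x + 2 * of_int k"
proof -
  have n: "F (x + real n) = F x + 2 * real n" for x n
  proof (induction n)
    case (Suc n)
    then show ?case using deg[of "x + real n"] by (simp add: algebra_simps)
  qed simp
  show ?thesis
  proof (cases "0 \<le> k")
    case True then show ?thesis using n[of x "nat k"] by simp
  next
    case False then show ?thesis using n[of "x + of_int k" "nat (- k)"] by simp
  qed
qed

lemma iterate_shift: "(F ^^ n) (x + of_int k) = (F ^^ n) x + 2 ^ n * of_int k"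
proof (induction n)
  case (Suc n)
  have "F ((F ^^ n) x + of_int (2 ^ n * k)) = F ((F ^^ n) x) + 2 * of_int (2 ^ n * k)" by (rule shift)
  then show ?case using Suc by simp
qed simp

lemma normalized_iterates_tendsto: "(\<lambda>n. (F ^^ n) x / 2 ^ n) \<longlonglongrightarrow> semiconj F x"
proof -
  define h where "h = (\<lambda>n. (F ^^ n) x / 2 ^ n)"
  have nb: "norm (h (Suc n) - h n) \<le> M * (1/2) ^ n" for n
  proof -
    have "h (Suc n) - h n = (F ((F ^^ n) x) - 2 * (F ^^ n) x) / 2 / 2 ^ n"
      unfolding h_def by (simp add: field_simps)
    then have "norm (h (Suc n) - h n) = \<bar>F ((F ^^ n) x) - 2 * (F ^^ n) x\<bar> / 2 / 2 ^ n" by simp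
    also have "\<dots> \<le> M / 2 ^ n" using bound[of "(F ^^ n) x"] by (intro divide_right_mono) auto
    also have "M / 2 ^ n = M * (1/2) ^ n" by (simp add: power_divide)
    finally show ?thesis .
  qed
  have sg: "summable (\<lambda>n. M * (1/2) ^ n)" by (rule summable_mult, rule summable_geometric) simp
  have "summable (\<lambda>n. h (Suc n) - h n)" by (rule summable_comparison_test'[OF sg, of 0]) (rule nb)
  then have "convergent (\<lambda>n. h n - h 0)"
    unfolding summable_iff_convergent sum_lessThan_telescope .
  then have "convergent h" using convergent_add_const_right_iff[of h "- h 0"] by simp
  then show ?thesis unfolding semiconj_def h_def by (simp add: convergent_LIMSEQ_iff)
qed

text \<open>
  Comparing the limits at \<open>x\<close> and at \<open>(F ^^ p) x\<close> yields \<open>k = (2 ^ p - 1) * m\<close>. So \<open>x\<close> is a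
  genuine periodic point of the lift \<open>F - m\<close>, which is monotone.
\<close>
lemma periodic_semiconj_int_imp_fixed:
  assumes p: "0 < p" "(F ^^ p) x = x + of_int k" and m: "semiconj F x = of_int m"
  shows "F x = x + of_int m"
proof -
  let ?h = "\<lambda>n y. (F ^^ n) y / 2 ^ n"
  have "(\<lambda>n. ?h (n + p) x) \<longlonglongrightarrow> semiconj F x" using normalized_iterates_tendsto by (rule LIMSEQ_ignore_initial_segment)
  then have "(\<lambda>n. 2 ^ p * ?h (n + p) x) \<longlonglongrightarrow> 2 ^ p * semiconj F x" by (rule tendsto_mult_left)
  moreover have "2 ^ p * ?h (n + p) x = ?h n x + of_int k" for n
  proof -
    have "(F ^^ (n + p)) x = (F ^^ n) x + 2 ^ n * of_int k" using iterate_shift p(2) by (simp add: funpow_add)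
    then show ?thesis by (simp add: field_simps power_add)
  qed
  moreover have "(\<lambda>n. ?h n x + of_int k) \<longlonglongrightarrow> semiconj F x + of_int k"
    by (intro tendsto_add normalized_iterates_tendsto tendsto_const)
  ultimately have "2 ^ p * semiconj F x = semiconj F x + of_int k" using LIMSEQ_unique by simp
  then have km: "of_int k = (2 ^ p - 1) * (of_int m :: real)" unfolding m by (simp add: algebra_simps)
  define G where "G = (\<lambda>y. F y - of_int m)"
  have G: "(G ^^ n) x = (F ^^ n) x - (2 ^ n - 1) * of_int m" for n
  proof (induction n)
    case (Suc n)
    have "(G ^^ Suc n) x = F ((F ^^ n) x + of_int (- ((2 ^ n - 1) * m))) - of_int m"
      using Suc by (simp add: G_def)
    also have "\<dots> = (F ^^ Suc n) x - (2 ^ Suc n - 1) * of_int m"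
      unfolding shift by (simp add: algebra_simps)
    finally show ?case .
  qed simp
  have "(G ^^ p) x = x" unfolding G p(2) km by simp
  moreover have "mono G" using mono unfolding G_def mono_def by simp
  ultimately have "G x = x" using mono_periodic_imp_fixed p(1) by blast
  then show ?thesis unfolding G_def by simp
qed

lemma fixed_semiconj:
  assumes "F x = x + of_int m" shows "semiconj F x = of_int m"
proof -
  have it: "(F ^^ n) x = x + (2 ^ n - 1) * of_int m" for n
  proof (induction n)
    case (Suc n)
    have "(F ^^ Suc n) x = F (x + of_int ((2 ^ n - 1) * m))" using Suc by simp
    also have "\<dots> = x + (2 ^ Suc n - 1) * of_int m" unfolding shift assms by (simp add: algebra_simps)
    finally show ?case .
  qed simp
  have "(\<lambda>n. of_int m + (x - of_int m) * (1/2) ^ n) \<longlonglongrightarrow> of_int m + (x - of_int m) * 0"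
    by (intro tendsto_intros LIMSEQ_power_zero) auto
  moreover have "(F ^^ n) x / 2 ^ n = of_int m + (x - of_int m) * (1/2) ^ n" for n
    unfolding it by (simp add: field_simps power_one_over)
  ultimately have "(\<lambda>n. (F ^^ n) x / 2 ^ n) \<longlonglongrightarrow> of_int m" by simp
  then show ?thesis using LIMSEQ_unique normalized_iterates_tendsto by blast
qed

end

text \<open>
  On the circle \<open>f z = z\<^sup>2 (a - z) / cnj (a - z)\<close>, and \<open>w / cnj w\<close> has twice the argument of
  \<open>w\<close>. Factoring \<open>a - z = a * (1 - z / a)\<close>, where the second factor has positive real part,
  provides a continuous choice of the argument.
\<close>
definition std_lift :: "complex \<Rightarrow> real \<Rightarrow> real" where
  "std_lift a x = 2 * x + (Arg a + Im (Ln (1 - cis (2 * pi * x) / a))) / pi"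

lemma cis_double_Im_Ln:
  assumes "w \<noteq> 0" shows "cis (2 * Im (Ln w)) = w / cnj w"
proof -
  have e: "exp (Ln w) = w" using assms by simp
  have "cis (2 * Im (Ln w)) = exp (Ln w - cnj (Ln w))"
    unfolding cis_conv_exp by (rule arg_cong[of _ _ exp]) (simp add: complex_eq_iff)
  also have "\<dots> = exp (Ln w) / cnj (exp (Ln w))" by (simp add: exp_diff exp_cnj)
  finally show ?thesis using e by simp
qed

lemma std_lift_props:
  assumes a: "2 \<le> norm a"
  shows "circle_lift a (std_lift a)" "mono (std_lift a)" "std_lift a (x + 1) = std_lift a x + 2"
    "\<bar>std_lift a x - 2 * x\<bar> \<le> (\<bar>Arg a\<bar> + pi) / pi"
proof -
  have a0: "a \<noteq> 0" and a1: "1 < norm a" using a by auto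
  let ?w = "\<lambda>x. 1 - cis (2 * pi * x) / a"
  have small: "norm (cis t / a) < 1" for t using a1 a by (simp add: norm_divide divide_less_eq)
  have Re: "0 < Re (?w x)" for x
    using small[of "2 * pi * x"] abs_Re_le_cmod[of "cis (2 * pi * x) / a"] by simp
  then have nonneg: "?w x \<notin> \<real>\<^sub>\<le>\<^sub>0" for x by (metis complex_nonpos_Reals_iff less_le_not_le)
  have w0: "?w x \<noteq> 0" for x using Re[of x] by force
  have der: "(std_lift a has_real_derivative circle_slope a (cis (2 * pi * x))) (at x)" for x
  proof -
    let ?z = "cis (2 * pi * x)"
    have "((\<lambda>z. 1 - exp (\<i> * (2 * of_real pi * z)) / a) has_field_derivative
        - (exp (\<i> * (2 * of_real pi * of_real x)) * (\<i> * (2 * of_real pi)) / a)) (at (of_real x))"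
      using a0 by (auto intro!: derivative_eq_intros)
    then have "((\<lambda>x. 1 - exp (\<i> * (2 * of_real pi * of_real x)) / a) has_vector_derivative
        - (exp (\<i> * (2 * of_real pi * of_real x)) * (\<i> * (2 * of_real pi)) / a)) (at x)"
      by (rule has_vector_derivative_real_field)
    then have "((\<lambda>x. ?w x) has_vector_derivative (2 * pi) *\<^sub>R (- (\<i> * ?z / a))) (at x)"
      by (simp add: cis_conv_exp scaleR_conv_of_real mult_ac)
    then have "(Ln \<circ> ?w has_vector_derivative (2 * pi) *\<^sub>R (- (\<i> * ?z / a)) * inverse (?w x)) (at x)"
      using has_field_derivative_Ln[OF nonneg[of x]] by (rule field_vector_diff_chain_at)
    then have "((\<lambda>x. Im (Ln (?w x))) has_vector_derivative Im ((2 * pi) *\<^sub>R (- (\<i> * ?z / a)) * inverse (?w x))) (at x)"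
      unfolding o_def by (rule bounded_linear.has_vector_derivative[OF bounded_linear_Im])
    then have d: "((\<lambda>x. Im (Ln (?w x))) has_real_derivative Im ((2 * pi) *\<^sub>R (- (\<i> * ?z / a)) * inverse (?w x))) (at x)"
      by (simp add: has_real_derivative_iff_has_vector_derivative)
    have az: "a - ?z \<noteq> 0" using a by (metis eq_iff_diff_eq_0 norm_cis a1 less_irrefl)
    have "(\<i> * ?z / a) * inverse (?w x) = \<i> * (?z / (a - ?z))"
      using w0[of x] a0 az by (simp add: field_simps)
    moreover have "Im ((2 * pi) *\<^sub>R (- (\<i> * W))) = - 2 * pi * Re W" for W by simp
    ultimately have "Im ((2 * pi) *\<^sub>R (- (\<i> * ?z / a)) * inverse (?w x)) = - 2 * pi * Re (?z / (a - ?z))"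
      by (simp only: mult_scaleR_left mult_minus_left)
    also have "?z / (a - ?z) = - (?z / (?z - a))" by (metis minus_diff_eq minus_divide_right)
    finally have v: "Im ((2 * pi) *\<^sub>R (- (\<i> * ?z / a)) * inverse (?w x)) = 2 * pi * Re (?z / (?z - a))" by simp
    have "((\<lambda>x. 2 * x + (Arg a + Im (Ln (?w x))) / pi) has_real_derivative
        2 + (0 + 2 * pi * Re (?z / (?z - a))) / pi) (at x)"
      by (rule DERIV_add[OF DERIV_cmult_Id DERIV_cdivide[OF DERIV_add[OF DERIV_const d[unfolded v]]]])
    then show ?thesis unfolding std_lift_def circle_slope_def by simp
  qed
  have slope: "0 \<le> circle_slope a z" if "norm z = 1" for z
  proof -
    have "1 \<le> norm (z - a)" using norm_triangle_ineq2[of a z] a that by (simp add: norm_minus_commute)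
    then have "norm (z / (z - a)) \<le> 1" using that by (simp add: norm_divide divide_le_eq)
    then show ?thesis unfolding circle_slope_def using abs_Re_le_cmod[of "z / (z - a)"] by linarith
  qed
  show "mono (std_lift a)"
    using der slope by (intro monoI DERIV_nonneg_imp_nondecreasing[of _ _ "std_lift a"]) (auto intro!: exI)
  have "cis (2 * pi * std_lift a x) = blaschke a (cis (2 * pi * x))" for x
  proof -
    let ?z = "cis (2 * pi * x)"
    have "2 * pi * std_lift a x = 2 * (2 * pi * x) + 2 * Im (Ln a) + 2 * Im (Ln (?w x))"
      unfolding std_lift_def by (simp add: field_simps Arg_eq_Im_Ln a0)
    then have "cis (2 * pi * std_lift a x) = cis (2 * (2 * pi * x)) * cis (2 * Im (Ln a)) * cis (2 * Im (Ln (?w x)))"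
      by (simp only: cis_mult)
    also have "\<dots> = ?z\<^sup>2 * (a / cnj a) * (?w x / cnj (?w x))"
      unfolding cis_double_Im_Ln[OF a0] cis_double_Im_Ln[OF w0]
      using Complex.DeMoivre[of "2 * pi * x" 2] by simp
    also have "\<dots> = ?z\<^sup>2 * ((a * ?w x) / cnj (a * ?w x))" by simp
    also have "a * ?w x = - (?z - a)" using a0 by (simp add: field_simps)
    also have "?z\<^sup>2 * (- (?z - a) / cnj (- (?z - a))) = ?z\<^sup>2 * ((?z - a) / cnj (?z - a))"
      by (simp only: complex_cnj_minus minus_divide_left[symmetric] minus_divide_right[symmetric] minus_minus)
    also have "\<dots> = blaschke a ?z" using blaschke_on_circle[of ?z a] a1 by simp
    finally show ?thesis .
  qed
  moreover have "continuous_on UNIV (std_lift a)"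
    using der DERIV_isCont continuous_at_imp_continuous_on by blast
  ultimately show "circle_lift a (std_lift a)" unfolding circle_lift_def by blast
  have "cis (2 * pi * (x + 1)) = cis (2 * pi * x) * cis (2 * pi)"
    by (simp only: cis_mult distrib_left mult_1_right)
  then have "cis (2 * pi * (x + 1)) = cis (2 * pi * x)" by simp
  then show "std_lift a (x + 1) = std_lift a x + 2" unfolding std_lift_def by simp
  have "\<bar>Im (Ln (?w x))\<bar> \<le> pi" using w0[of x] mpi_less_Im_Ln Im_Ln_le_pi by (metis abs_le_iff less_imp_le minus_le_iff)
  then have "\<bar>Arg a + Im (Ln (?w x))\<bar> \<le> \<bar>Arg a\<bar> + pi" by linarith
  then show "\<bar>std_lift a x - 2 * x\<bar> \<le> (\<bar>Arg a\<bar> + pi) / pi"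
    unfolding std_lift_def by (simp add: divide_right_mono)
qed

lemma cis_eq_imp_int: assumes "cis (2 * pi * x) = cis (2 * pi * y)" obtains n :: int where "x = y + of_int n"
proof -
  have "sin (2 * pi * x) = sin (2 * pi * y) \<and> cos (2 * pi * x) = cos (2 * pi * y)" using assms by (simp add: complex_eq_iff)
  then obtain n :: int where "2 * pi * x = 2 * pi * y + 2 * pi * of_int n" using sin_cos_eq_iff by blast
  then have "2 * pi * x = 2 * pi * (y + of_int n)" by (simp only: distrib_left)
  then show ?thesis using that by simp
qed

text \<open>The difference of two lifts is continuous with integer values.\<close>
lemma circle_lift_unique:
  assumes a: "2 \<le> norm a" and F: "circle_lift a F"
  obtains n :: int where "F = (\<lambda>x. std_lift a x + of_int n)"
proof -
  let ?d = "\<lambda>x. F x - std_lift a x"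
  have int: "\<exists>n::int. ?d x = of_int n" for x
  proof -
    have "cis (2 * pi * F x) = cis (2 * pi * std_lift a x)"
      using F std_lift_props(1)[OF a] unfolding circle_lift_def by simp
    then obtain n :: int where "F x = std_lift a x + of_int n" using cis_eq_imp_int by blast
    then show ?thesis by (intro exI[of _ n]) simp
  qed
  have "?d constant_on UNIV"
  proof (rule continuous_discrete_range_constant)
    show "continuous_on UNIV ?d"
      using F std_lift_props(1)[OF a] unfolding circle_lift_def by (intro continuous_intros) auto
    fix x :: real
    have "1 \<le> norm (?d y - ?d x)" if "?d y \<noteq> ?d x" for y
    proof -
      obtain m n :: int where "?d y = of_int m" "?d x = of_int n" using int by blast
      then show ?thesis using that by simp
    qed
    then show "\<exists>e>0. \<forall>y. y \<in> UNIV \<and> ?d y \<noteq> ?d x \<longrightarrow> e \<le> norm (?d y - ?d x)" by (intro exI[of _ 1]) auto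
  qed auto
  then obtain c where c: "\<And>x. ?d x = c" unfolding constant_on_def by auto
  then obtain n :: int where "c = of_int n" using int by metis
  then have "F = (\<lambda>x. std_lift a x + of_int n)" using c by (simp add: fun_eq_iff algebra_simps)
  then show ?thesis using that by blast
qed

lemma circle_lift_degree_two:
  assumes a: "2 \<le> norm a" and F: "circle_lift a F"
  obtains M where "degree_two_lift F M"
proof -
  obtain n :: int where n: "F = (\<lambda>x. std_lift a x + of_int n)" using circle_lift_unique[OF assms] .
  have "degree_two_lift F ((\<bar>Arg a\<bar> + pi) / pi + \<bar>of_int n\<bar>)"
  proof
    show "mono F" using std_lift_props(2)[OF a] unfolding n mono_def by simp
    show "F (x + 1) = F x + 2" for x unfolding n std_lift_props(3)[OF a] by simp
    show "\<bar>F x - 2 * x\<bar> \<le> (\<bar>Arg a\<bar> + pi) / pi + \<bar>of_int n\<bar>" for x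
      using std_lift_props(4)[OF a, of x] unfolding n by linarith
  qed
  then show ?thesis using that by blast
qed

lemma circle_lift_iterate:
  assumes "circle_lift a F" shows "cis (2 * pi * (F ^^ n) x) = (blaschke a ^^ n) (cis (2 * pi * x))"
  using assms by (induction n) (auto simp: circle_lift_def)

lemma circle_param: assumes "norm z = 1" obtains x where "z = cis (2 * pi * x)"
proof -
  have "z = cis (Arg2pi z)" using Arg2pi[of z] assms by (auto simp: cis_conv_exp is_Arg_def)
  then show ?thesis using that[of "Arg2pi z / (2 * pi)"] by simp
qed

lemma tongue_0_eq: "tongue 0 = {a. 2 \<le> norm a \<and> (\<exists>z. attracting_periodic a 1 z)}"
proof -
  have "has_type a 0 \<longleftrightarrow> (\<exists>z. attracting_periodic a 1 z)" if a: "2 \<le> norm a" for a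
  proof
    assume "has_type a 0"
    then obtain F x where F: "circle_lift a F" "marked_point a (cis (2 * pi * x))" "semiconj F x \<in> \<int>"
      unfolding has_type_def by auto
    obtain M where "degree_two_lift F M" using circle_lift_degree_two[OF a F(1)] .
    then interpret degree_two_lift F M .
    obtain m where m: "semiconj F x = of_int m" using F(3) Ints_cases by blast
    obtain p where p: "attracting_periodic a p (cis (2 * pi * x))" using F(2) unfolding marked_point_def by blast
    then have p2: "0 < p" "(blaschke a ^^ p) (cis (2 * pi * x)) = cis (2 * pi * x)"
      "\<And>k. 0 < k \<Longrightarrow> k < p \<Longrightarrow> (blaschke a ^^ k) (cis (2 * pi * x)) \<noteq> cis (2 * pi * x)"
      unfolding attracting_periodic_def circle_periodic_def by auto
    have "cis (2 * pi * (F ^^ p) x) = cis (2 * pi * x)" using circle_lift_iterate[OF F(1)] p2 by simp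
    then obtain k :: int where k: "(F ^^ p) x = x + of_int k" using cis_eq_imp_int by blast
    have "F x = x + of_int m" using periodic_semiconj_int_imp_fixed[OF p2(1) k m] .
    then have "blaschke a (cis (2 * pi * x)) = cis (2 * pi * (x + of_int m))"
      using F(1) unfolding circle_lift_def by metis
    also have "\<dots> = cis (2 * pi * x) * cis (2 * pi * of_int m)" by (simp only: cis_mult distrib_left)
    also have "cis (2 * pi * of_int m) = 1" by (rule cis_multiple_2pi) simp
    finally have "\<not> (1 < p)" using p2(3)[of 1] by auto
    then have "p = 1" using p2(1) by simp
    then show "\<exists>z. attracting_periodic a 1 z" using p by blast
  next
    assume "\<exists>z. attracting_periodic a 1 z"
    then obtain z where z: "attracting_periodic a 1 z" by blast
    then have zz: "norm z = 1" "blaschke a z = z" unfolding attracting_periodic_def circle_periodic_1 by auto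
    obtain x where x: "z = cis (2 * pi * x)" using circle_param[OF zz(1)] .
    note F = std_lift_props(1)[OF a]
    obtain M where "degree_two_lift (std_lift a) M" using circle_lift_degree_two[OF a F] .
    then interpret degree_two_lift "std_lift a" M .
    have "cis (2 * pi * std_lift a x) = cis (2 * pi * x)" using F zz(2) x unfolding circle_lift_def by simp
    then obtain m :: int where "std_lift a x = x + of_int m" using cis_eq_imp_int by blast
    then have "semiconj (std_lift a) x = of_int m" by (rule fixed_semiconj)
    then show "has_type a 0"
      unfolding has_type_def using F attracting_fixed_marked[OF a z] x by (intro exI[of _ "std_lift a"] exI[of _ x]) auto
  qed
  then show ?thesis unfolding tongue_def by blast
qed


section \<open>Cycles of period two on the circle\<close>

text \<open>The two equations of the cycle are linear in \<open>a\<close> and \<open>cnj a\<close>; their difference is free of \<open>cnj a\<close>.\<close>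
lemma two_cycle_parameter:
  assumes "norm x = 1" "norm y = 1" "1 < norm a" "blaschke a x = y" "blaschke a y = x" "x \<noteq> y"
  shows "a * (x\<^sup>2 + x * y + y\<^sup>2) = (x + y) * (x\<^sup>2 + y\<^sup>2) + 1"
proof -
  have "x ^ 3 * (x - a) = y * (1 - cnj a * x)" "y ^ 3 * (y - a) = x * (1 - cnj a * y)"
    using assms blaschke_eq_iff by blast+
  then have "(x - y) * (a * (x\<^sup>2 + x * y + y\<^sup>2) - ((x + y) * (x\<^sup>2 + y\<^sup>2) + 1)) = 0" by algebra
  then show ?thesis using assms(6) by simp
qed

lemma two_cycle_difference:
  assumes "x\<^sup>2 + x * y + y\<^sup>2 \<noteq> (0::complex)" "a * (x\<^sup>2 + x * y + y\<^sup>2) = (x + y) * (x\<^sup>2 + y\<^sup>2) + 1"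
  shows "x - a = - (1 + y ^ 3) / (x\<^sup>2 + x * y + y\<^sup>2)"
proof -
  have "(x - a) * (x\<^sup>2 + x * y + y\<^sup>2) = - (1 + y ^ 3)" using assms(2) by algebra
  then show ?thesis using assms(1) by (simp add: eq_divide_eq)
qed

text \<open>Conjugating the equation for \<open>a\<close> recovers the value of \<open>cnj a\<close>.\<close>
lemma two_cycle_parameter_imp:
  assumes "norm x = 1" "norm y = 1" "1 < norm a" and S: "x\<^sup>2 + x * y + y\<^sup>2 \<noteq> 0"
    and e: "a * (x\<^sup>2 + x * y + y\<^sup>2) = (x + y) * (x\<^sup>2 + y\<^sup>2) + 1"
  shows "blaschke a x = y"
proof -
  have c: "x * cnj x = 1" "y * cnj y = 1" using unit_circle_cnj assms by auto
  have ce: "cnj a * (cnj x ^ 2 + cnj x * cnj y + cnj y ^ 2) = (cnj x + cnj y) * (cnj x ^ 2 + cnj y ^ 2) + 1"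
    using arg_cong[OF e, of cnj] by simp
  have "cnj a * (cnj x ^ 2 + cnj x * cnj y + cnj y ^ 2) * (x ^ 2 * y ^ 2) * (x * y)
    = ((cnj x + cnj y) * (cnj x ^ 2 + cnj y ^ 2) + 1) * (x ^ 2 * y ^ 2) * (x * y)" by (simp only: ce)
  then have "cnj a * (x\<^sup>2 + x * y + y\<^sup>2) * (x * y) = (x + y) * (x\<^sup>2 + y\<^sup>2) + x ^ 3 * y ^ 3"
    using c by algebra
  then have "(x ^ 3 * (x - a) - y * (1 - cnj a * x)) * (x\<^sup>2 + x * y + y\<^sup>2) = 0"
    using e by algebra
  then have "x ^ 3 * (x - a) = y * (1 - cnj a * x)" using S by simp
  then show ?thesis using assms blaschke_eq_iff by blast
qed

text \<open>
  With \<open>c = Im p\<close>, the 2-cycle \<open>{cis (m + d), cis (m - d)}\<close> occurs for the parameter with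
  coordinates \<open>Re p = m\<close> and \<open>c = cos d\<close>. The formula also makes sense for \<open>c \<ge> 1\<close>, where it
  continues the parametrization across the bifurcation curve.
\<close>
definition cycle_param :: "complex \<Rightarrow> complex" where
  "cycle_param p = of_real (4 * Im p * (2 * (Im p)\<^sup>2 - 1) / (4 * (Im p)\<^sup>2 - 1)) * cis (Re p)
    + of_real (1 / (4 * (Im p)\<^sup>2 - 1)) * cis (- 2 * Re p)"

lemma cis_pair_sums:
  fixes m d :: real
  defines "x \<equiv> cis (m + d)" and "y \<equiv> cis (m - d)"
  shows "x + y = of_real (2 * cos d) * cis m"
    "x\<^sup>2 + y\<^sup>2 = of_real (4 * (cos d)\<^sup>2 - 2) * cis m ^ 2"
    "x\<^sup>2 + x * y + y\<^sup>2 = of_real (4 * (cos d)\<^sup>2 - 1) * cis m ^ 2"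
proof -
  have xy: "x * y = cis m ^ 2" unfolding x_def y_def power2_eq_square by (simp only: cis_mult) simp
  have "x = cis m * cis d" "y = cis m * cnj (cis d)" unfolding x_def y_def by (simp_all only: cis_mult cis_cnj) simp_all
  then have "x + y = cis m * (cis d + cnj (cis d))" by (simp add: algebra_simps)
  then show 1: "x + y = of_real (2 * cos d) * cis m" unfolding complex_add_cnj by simp
  have "x\<^sup>2 + y\<^sup>2 = (x + y)\<^sup>2 - 2 * (x * y)" by algebra
  then show 2: "x\<^sup>2 + y\<^sup>2 = of_real (4 * (cos d)\<^sup>2 - 2) * cis m ^ 2"
    unfolding 1 xy by (simp add: power_mult_distrib algebra_simps)
  have "x\<^sup>2 + x * y + y\<^sup>2 = (x + y)\<^sup>2 - (x * y)" by algebra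
  then show "x\<^sup>2 + x * y + y\<^sup>2 = of_real (4 * (cos d)\<^sup>2 - 1) * cis m ^ 2"
    unfolding 1 xy by (simp add: power_mult_distrib algebra_simps)
qed

lemma two_cycle_cycle_param_iff:
  fixes m d :: real
  assumes "4 * (cos d)\<^sup>2 - 1 \<noteq> 0"
  defines "x \<equiv> cis (m + d)" and "y \<equiv> cis (m - d)"
  shows "a * (x\<^sup>2 + x * y + y\<^sup>2) = (x + y) * (x\<^sup>2 + y\<^sup>2) + 1 \<longleftrightarrow> a = cycle_param (Complex m (cos d))"
proof -
  let ?c = "cos d" and ?m = "cis m"
  let ?D = "4 * (complex_of_real ?c)\<^sup>2 - 1"
  have D: "?D \<noteq> 0"
  proof
    assume "?D = 0"
    then have "complex_of_real (4 * ?c\<^sup>2 - 1) = of_real 0" by simp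
    then show False using assms(1) of_real_eq_iff by blast
  qed
  have m0: "?m \<noteq> 0" by simp
  have m2: "cis (- (2 * m)) = inverse (?m ^ 2)" using Complex.DeMoivre[of m 2] cis_inverse[of "2 * m"] by simp
  have G: "cycle_param (Complex m ?c) = (4 * of_real ?c * (2 * (of_real ?c)\<^sup>2 - 1) * ?m + inverse (?m ^ 2)) / ?D"
    unfolding cycle_param_def by (simp add: m2 add_divide_distrib)
  have e: "(x + y) * (x\<^sup>2 + y\<^sup>2) + 1 = (4 * of_real ?c * (2 * (of_real ?c)\<^sup>2 - 1) * ?m + inverse (?m ^ 2)) * ?m ^ 2"
    unfolding x_def y_def cis_pair_sums using m0 by (simp add: field_simps power2_eq_square)
  have s: "x\<^sup>2 + x * y + y\<^sup>2 = ?D * ?m ^ 2" unfolding x_def y_def cis_pair_sums by simp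
  have key: "a * (P * M) = N * M \<longleftrightarrow> a = N / P" if "P \<noteq> 0" "M \<noteq> 0" for P M N :: complex
    using that by (simp add: eq_divide_eq mult.assoc[symmetric])
  show ?thesis unfolding e s G by (rule key[OF D]) simp
qed

lemma two_cycle_slope:
  fixes m d :: real
  assumes D: "4 * (cos d)\<^sup>2 - 1 \<noteq> 0" and a: "a = cycle_param (Complex m (cos d))"
    and k: "cos (3 * m / 2 - 3 * d / 2) \<noteq> 0"
  shows "circle_slope a (cis (m + d)) =
    2 - (4 * (cos d)\<^sup>2 - 1) * cos (3 * m / 2 + 5 * d / 2) / cos (3 * m / 2 - 3 * d / 2)"
proof -
  define x where "x = cis (m + d)"
  define y where "y = cis (m - d)"
  define b where "b = 3 * m / 2 - 3 * d / 2"
  have e: "a * (x\<^sup>2 + x * y + y\<^sup>2) = (x + y) * (x\<^sup>2 + y\<^sup>2) + 1"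
    unfolding x_def y_def using two_cycle_cycle_param_iff[OF D] a by blast
  have s: "x\<^sup>2 + x * y + y\<^sup>2 = of_real (4 * (cos d)\<^sup>2 - 1) * cis m ^ 2"
    unfolding x_def y_def cis_pair_sums ..
  then have s0: "x\<^sup>2 + x * y + y\<^sup>2 \<noteq> 0" using D by (simp only: mult_eq_0_iff of_real_eq_0_iff power_eq_0_iff cis_neq_zero) simp
  have y3: "1 + y ^ 3 = of_real (2 * cos b) * cis b"
  proof -
    have "y ^ 3 = cis (2 * b)" unfolding y_def cis_cube b_def by (simp add: algebra_simps)
    also have "1 + cis (2 * b) = cis b * (cis b + cnj (cis b))"
      using cis_mult[of b b] unit_circle_cnj(1)[of "cis b"] by (simp add: distrib_left)
    finally show ?thesis unfolding complex_add_cnj by simp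
  qed
  have b0: "cos b \<noteq> 0" using k b_def by simp
  have "x / (x - a) = - (x * (of_real (4 * (cos d)\<^sup>2 - 1) * cis m ^ 2) / (1 + y ^ 3))"
  proof -
    have "x / (- P / S) = - (x * S / P)" for P S :: complex by simp
    then show ?thesis unfolding two_cycle_difference[OF s0 e] s[symmetric] .
  qed
  also have "\<dots> = - (of_real ((4 * (cos d)\<^sup>2 - 1) / (2 * cos b)) * (x * cis m ^ 2 / cis b))"
    unfolding y3 by simp
  also have "x * cis m ^ 2 / cis b = cis (3 * m / 2 + 5 * d / 2)"
  proof -
    have "x * cis m ^ 2 / cis b = cis ((m + d) + 2 * m - b)"
      unfolding x_def using Complex.DeMoivre[of m 2] by (simp add: cis_mult cis_divide)
    also have "(m + d) + 2 * m - b = 3 * m / 2 + 5 * d / 2" unfolding b_def by (simp add: field_simps)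
    finally show ?thesis .
  qed
  finally have "Re (x / (x - a)) = - ((4 * (cos d)\<^sup>2 - 1) / (2 * cos b) * cos (3 * m / 2 + 5 * d / 2))"
    by (simp only: uminus_complex.sel times_complex.sel Re_complex_of_real Im_complex_of_real cis.sel mult_zero_left diff_zero)
  then show ?thesis unfolding circle_slope_def x_def[symmetric] b_def[symmetric] using b0 by (simp add: field_simps)
qed

text \<open>
  Product formulas for the cosine turn the multiplier into a polynomial in \<open>c\<close> and \<open>C\<close>. The
  factor \<open>1 - c\<^sup>2\<close> reflects that the multiplier is 1 when the cycle collapses, and at \<open>c = 1\<close> the
  last factor equals \<open>16 - 11 * C\<close>, so that the multiplier drops below 1 as \<open>c\<close> does.
\<close>
lemma two_cycle_multiplier_identity:
  fixes m d :: real
  defines "c \<equiv> cos d" and "C \<equiv> cos (3 * m)"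
  assumes k: "cos (3 * m / 2 - 3 * d / 2) \<noteq> 0" "cos (3 * m / 2 + 3 * d / 2) \<noteq> 0"
  shows "(1 - (2 - (4 * c\<^sup>2 - 1) * cos (3 * m / 2 + 5 * d / 2) / cos (3 * m / 2 - 3 * d / 2))
    * (2 - (4 * c\<^sup>2 - 1) * cos (3 * m / 2 - 5 * d / 2) / cos (3 * m / 2 + 3 * d / 2)))
    * (2 * (cos (3 * m / 2 - 3 * d / 2) * cos (3 * m / 2 + 3 * d / 2)))
    = 8 * (1 - c\<^sup>2) * (8 * c ^ 3 * (4 * c ^ 4 - 3 * c\<^sup>2 + 1) - C * (16 * c ^ 4 - 6 * c\<^sup>2 + 1))"
proof -
  define b where "b = 3 * m / 2"
  define D where "D = 4 * c\<^sup>2 - 1"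
  define p where "p = cos (b - 3 * d / 2)"
  define q where "q = cos (b + 3 * d / 2)"
  define r where "r = cos (b + 5 * d / 2)"
  define s where "s = cos (b - 5 * d / 2)"
  have C: "C = cos (2 * b)" unfolding C_def b_def by simp
  have c2: "cos (2 * d) = 2 * c\<^sup>2 - 1" unfolding c_def by (rule cos_double_cos)
  have c3: "cos (3 * d) = 4 * c ^ 3 - 3 * c" unfolding c_def by (rule cos_treble_cos)
  have c4: "cos (4 * d) = 8 * c ^ 4 - 8 * c\<^sup>2 + 1"
  proof -
    have "cos (4 * d) = 2 * (cos (2 * d))\<^sup>2 - 1" using cos_double_cos[of "2 * d"] by simp
    then show ?thesis unfolding c2 by (simp add: power2_eq_square power4_eq_xxxx algebra_simps)
  qed
  have c5: "cos (5 * d) = 16 * c ^ 5 - 20 * c ^ 3 + 5 * c"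
  proof -
    have "cos (5 * d) + cos d = 2 * (cos (3 * d) * cos (2 * d))"
      using cos_times_cos[of "3 * d" "2 * d"] by (simp add: algebra_simps)
    then show ?thesis unfolding c2 c3 c_def[symmetric] by algebra
  qed
  have pq: "2 * (p * q) = C + cos (3 * d)" unfolding p_def q_def cos_times_cos C by (simp add: algebra_simps)
  have rs: "2 * (r * s) = C + cos (5 * d)" unfolding r_def s_def cos_times_cos C by (simp add: algebra_simps)
  have rq: "2 * (r * q) = cos (2 * b + 4 * d) + c"
    unfolding r_def q_def cos_times_cos c_def by (simp add: algebra_simps)
  have sp: "2 * (s * p) = cos (2 * b - 4 * d) + c"
  proof -
    have "2 * (s * p) = cos (- d) + cos (2 * b - 4 * d)" unfolding s_def p_def cos_times_cos by (simp add: algebra_simps)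
    then show ?thesis unfolding c_def by simp
  qed
  have sum: "cos (2 * b + 4 * d) + cos (2 * b - 4 * d) = 2 * C * cos (4 * d)"
    unfolding C by (simp add: cos_add cos_diff)
  have p0: "p \<noteq> 0" "q \<noteq> 0" using k unfolding p_def q_def b_def by auto
  have "(1 - (2 - D * r / p) * (2 - D * s / q)) * (2 * (p * q))
    = - 3 * (2 * (p * q)) + 2 * D * (2 * (r * q) + 2 * (s * p)) - D\<^sup>2 * (2 * (r * s))"
    using p0 by (simp add: field_simps power2_eq_square)
  also have "\<dots> = - 3 * (C + cos (3 * d)) + 2 * D * (2 * C * cos (4 * d) + 2 * c) - D\<^sup>2 * (C + cos (5 * d))"
    unfolding pq rs rq sp using sum by (simp add: algebra_simps)
  also have "\<dots> = 8 * (1 - c\<^sup>2) * (8 * c ^ 3 * (4 * c ^ 4 - 3 * c\<^sup>2 + 1) - C * (16 * c ^ 4 - 6 * c\<^sup>2 + 1))"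
    unfolding c3 c4 c5 D_def by algebra
  finally show ?thesis unfolding p_def q_def r_def s_def D_def b_def .
qed

lemma two_cycle_multiplier_less_1:
  fixes m d :: real
  assumes a: "a = cycle_param (Complex m (cos d))" and d: "99/100 < cos d" "cos d < 1"
    and k: "0 < cos (3 * m / 2 - 3 * d / 2) * cos (3 * m / 2 + 3 * d / 2)"
  shows "circle_slope a (cis (m + d)) * circle_slope a (cis (m - d)) < 1"
proof -
  define c where "c = cos d"
  define C where "C = cos (3 * m)"
  have c: "99/100 < c" "c < 1" using d c_def by auto
  have c2: "98/100 < c\<^sup>2" "c\<^sup>2 < 1" using power_strict_mono[OF c(1), of 2] power_strict_mono[OF c(2), of 2] c by (auto simp: power2_eq_square)
  have D: "4 * (cos d)\<^sup>2 - 1 \<noteq> 0" using c2 c_def by simp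
  have k0: "cos (3 * m / 2 - 3 * d / 2) \<noteq> 0" "cos (3 * m / 2 + 3 * d / 2) \<noteq> 0" using k by auto
  have s1: "circle_slope a (cis (m + d)) = 2 - (4 * c\<^sup>2 - 1) * cos (3 * m / 2 + 5 * d / 2) / cos (3 * m / 2 - 3 * d / 2)"
    unfolding c_def by (intro two_cycle_slope[OF D a k0(1)])
  have s2: "circle_slope a (cis (m - d)) = 2 - (4 * c\<^sup>2 - 1) * cos (3 * m / 2 - 5 * d / 2) / cos (3 * m / 2 + 3 * d / 2)"
    using two_cycle_slope[of "- d" a m] D a k0 unfolding c_def by simp
  have "C * (16 * c ^ 4 - 6 * c\<^sup>2 + 1) \<le> 1 * (16 * c ^ 4 - 6 * c\<^sup>2 + 1)"
  proof (rule mult_right_mono)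
    have "16 * c ^ 4 - 6 * c\<^sup>2 + 1 = 16 * (c\<^sup>2 - 3/16)\<^sup>2 + 7/16" by algebra
    then show "0 \<le> 16 * c ^ 4 - 6 * c\<^sup>2 + 1" by simp
  qed (simp add: C_def)
  moreover have "16 * c ^ 4 - 6 * c\<^sup>2 + 1 < 8 * c ^ 3 * (4 * c ^ 4 - 3 * c\<^sup>2 + 1)"
  proof -
    \<comment> \<open>At \<open>c = 1\<close> the inequality reads \<open>11 < 16\<close>; the crude bound on \<open>c\<close> leaves enough room.\<close>
    have lo: "(99/100) ^ n \<le> c ^ n" and hi: "c ^ n \<le> 1" for n
      using c by (auto intro!: power_mono simp: power_le_one_iff)
    have "8 * c ^ 3 * (4 * c ^ 4 - 3 * c\<^sup>2 + 1) - (16 * c ^ 4 - 6 * c\<^sup>2 + 1)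
      = 32 * c ^ 7 - 24 * c ^ 5 + 8 * c ^ 3 - 16 * c ^ 4 + 6 * c\<^sup>2 - 1" by algebra
    moreover have "0 < 32 * c ^ 7 - 24 * c ^ 5 + 8 * c ^ 3 - 16 * c ^ 4 + 6 * c\<^sup>2 - 1"
      using lo[of 7] hi[of 5] lo[of 3] hi[of 4] lo[of 2] by (simp add: power_numeral_reduce)
    ultimately show ?thesis by simp
  qed
  ultimately have "0 < 8 * c ^ 3 * (4 * c ^ 4 - 3 * c\<^sup>2 + 1) - C * (16 * c ^ 4 - 6 * c\<^sup>2 + 1)" by simp
  then have "0 < 8 * (1 - c\<^sup>2) * (8 * c ^ 3 * (4 * c ^ 4 - 3 * c\<^sup>2 + 1) - C * (16 * c ^ 4 - 6 * c\<^sup>2 + 1))"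
    using c2 by (intro mult_pos_pos) auto
  also have "\<dots> = (1 - circle_slope a (cis (m + d)) * circle_slope a (cis (m - d)))
      * (2 * (cos (3 * m / 2 - 3 * d / 2) * cos (3 * m / 2 + 3 * d / 2)))"
    unfolding s1 s2 unfolding c_def C_def by (rule two_cycle_multiplier_identity[OF k0, symmetric])
  finally have "0 < (1 - circle_slope a (cis (m + d)) * circle_slope a (cis (m - d)))
      * (2 * (cos (3 * m / 2 - 3 * d / 2) * cos (3 * m / 2 + 3 * d / 2)))" .
  moreover have "0 < 2 * (cos (3 * m / 2 - 3 * d / 2) * cos (3 * m / 2 + 3 * d / 2))" using k by simp
  ultimately have "0 < 1 - circle_slope a (cis (m + d)) * circle_slope a (cis (m - d))" by (rule zero_less_mult_pos2)
  then show ?thesis by simp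
qed

lemma multiplier_two_cycle:
  assumes "1 < norm a" "norm x = 1" "norm y = 1" "blaschke a x = y" "blaschke a y = x"
  shows "multiplier a 2 x = of_real (circle_slope a x * circle_slope a y)"
proof -
  have n: "x \<noteq> 0" "y \<noteq> 0" using assms by auto
  have dx: "(blaschke a has_field_derivative of_real (circle_slope a x) * y / x) (at x)"
    using blaschke_derivative_circle[OF assms(2,1)] assms(4) by simp
  have dy: "(blaschke a has_field_derivative of_real (circle_slope a y) * x / y) (at (blaschke a x))"
    using blaschke_derivative_circle[OF assms(3,1)] assms(4,5) by simp
  have "(blaschke a ^^ 2) = blaschke a \<circ> blaschke a" by (simp add: numeral_2_eq_2)
  moreover have "(blaschke a \<circ> blaschke a has_field_derivative
      (of_real (circle_slope a y) * x / y) * (of_real (circle_slope a x) * y / x)) (at x)"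
    using DERIV_chain[OF dy dx] .
  ultimately show ?thesis unfolding multiplier_def using n by (simp add: DERIV_imp_deriv mult.commute)
qed

section \<open>Local coordinates at the bifurcation curve\<close>

text \<open>
  Both parametrizations, by the fixed point and by the 2-cycle, combine \<open>cis m\<close> and
  \<open>cis (- 2 * m)\<close> with real coefficients that depend on the second coordinate only. This covers
  both derivatives at once.
\<close>
lemma epitrochoid_derivative:
  fixes \<alpha> \<beta> :: "real \<Rightarrow> real"
  assumes "(\<alpha> has_real_derivative \<alpha>') (at (Im p))" "(\<beta> has_real_derivative \<beta>') (at (Im p))"
  shows "((\<lambda>p. of_real (\<alpha> (Im p)) * cis (Re p) + of_real (\<beta> (Im p)) * cis (- 2 * Re p)) has_derivative
    (\<lambda>v. of_real (Re v) * (\<i> * (of_real (\<alpha> (Im p)) * cis (Re p) - 2 * of_real (\<beta> (Im p)) * cis (- 2 * Re p)))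
       + of_real (Im v) * (of_real \<alpha>' * cis (Re p) + of_real \<beta>' * cis (- 2 * Re p)))) (at p)"
proof -
  have a: "((\<lambda>p. complex_of_real (\<alpha> (Im p))) has_derivative (\<lambda>v. of_real (\<alpha>' * Im v))) (at p)"
    using has_derivative_compose[OF bounded_linear_imp_has_derivative[OF bounded_linear_Im] assms(1)[unfolded has_field_derivative_def]]
    by (rule has_derivative_of_real)
  have b: "((\<lambda>p. complex_of_real (\<beta> (Im p))) has_derivative (\<lambda>v. of_real (\<beta>' * Im v))) (at p)"
    using has_derivative_compose[OF bounded_linear_imp_has_derivative[OF bounded_linear_Im] assms(2)[unfolded has_field_derivative_def]]
    by (rule has_derivative_of_real)
  have c: "((\<lambda>p. cis (s * Re p)) has_derivative (\<lambda>v. of_real (s * Re v) * (\<i> * cis (s * Re p)))) (at p)" for s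
  proof -
    have "((\<lambda>p. \<i> * complex_of_real (s * Re p)) has_derivative (\<lambda>v. \<i> * complex_of_real (s * Re v))) (at p)"
      by (intro bounded_linear_imp_has_derivative linear_conv_bounded_linear[THEN iffD1] linearI)
         (auto simp: algebra_simps scaleR_conv_of_real)
    from has_derivative_compose[OF this DERIV_exp[unfolded has_field_derivative_def]]
    show ?thesis unfolding cis_conv_exp by (simp add: mult_ac)
  qed
  have c1: "((\<lambda>p. cis (Re p)) has_derivative (\<lambda>v. of_real (Re v) * (\<i> * cis (Re p)))) (at p)"
    using c[of 1] by simp
  show ?thesis
    by (rule has_derivative_eq_rhs[OF has_derivative_add[OF has_derivative_mult[OF a c1] has_derivative_mult[OF b c[of "-2"]]]])
       (simp add: fun_eq_iff algebra_simps)
qed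

text \<open>The Jacobian determinant of such a map.\<close>
lemma epitrochoid_cross:
  fixes \<alpha> \<beta> \<alpha>' \<beta>' m :: real
  shows "Im (cnj (\<i> * (of_real \<alpha> * cis m - 2 * of_real \<beta> * cis (- 2 * m))) * (of_real \<alpha>' * cis m + of_real \<beta>' * cis (- 2 * m)))
    = - (\<alpha> * \<alpha>' - 2 * \<beta> * \<beta>' + (\<alpha> * \<beta>' - 2 * \<beta> * \<alpha>') * cos (3 * m))"
proof -
  let ?x = "cos m" and ?y = "sin m" and ?u = "cos (2 * m)" and ?v = "sin (2 * m)"
  have C: "cos (3 * m) = ?x * ?u - ?y * ?v" using cos_add[of m "2 * m"] by simp
  have alg: "- ((2 * \<beta> * v + \<alpha> * y) * (\<alpha>' * y - \<beta>' * v)) - (\<alpha> * x - 2 * \<beta> * u) * (\<alpha>' * x + \<beta>' * u)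
    = 2 * \<beta> * \<beta>' - \<alpha> * \<alpha>' - (\<alpha> * \<beta>' - 2 * \<beta> * \<alpha>') * (x * u - y * v)"
    if "x\<^sup>2 + y\<^sup>2 = 1" "u\<^sup>2 + v\<^sup>2 = 1" for x y u v :: real using that by algebra
  show ?thesis unfolding C using alg[of ?x ?y ?u ?v] by (simp add: cis.code)
qed

lemma plane_basis_inverse:
  assumes D: "Im (cnj A * B) \<noteq> 0"
  defines "L \<equiv> \<lambda>w. Complex (Im (cnj B * w) / Im (cnj B * A)) (Im (cnj A * w) / Im (cnj A * B))"
  shows "bounded_linear L" "L (of_real (Re v) * A + of_real (Im v) * B) = v"
proof -
  show "bounded_linear L"
    unfolding L_def
    by (intro linear_conv_bounded_linear[THEN iffD1] linearI)
       (simp_all add: complex_eq_iff algebra_simps add_divide_distrib[symmetric] diff_divide_distrib[symmetric])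
  have D': "Im (cnj B * A) \<noteq> 0" using D by (simp add: algebra_simps)
  have 1: "Im (cnj A * (of_real (Re v) * A + of_real (Im v) * B)) = Im v * Im (cnj A * B)"
    by (simp add: algebra_simps)
  have 2: "Im (cnj B * (of_real (Re v) * A + of_real (Im v) * B)) = Re v * Im (cnj B * A)"
    by (simp add: algebra_simps)
  show "L (of_real (Re v) * A + of_real (Im v) * B) = v"
    unfolding L_def 1 2 using D D' by simp
qed

lemma locally_injective_partials:
  fixes f A B :: "complex \<Rightarrow> complex"
  assumes S: "open S" "p0 \<in> S"
    and der: "\<And>p. p \<in> S \<Longrightarrow> (f has_derivative (\<lambda>v. of_real (Re v) * A p + of_real (Im v) * B p)) (at p)"
    and cont: "continuous_on S A" "continuous_on S B"
    and D: "Im (cnj (A p0) * B p0) \<noteq> 0"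
  obtains r where "0 < r" "ball p0 r \<subseteq> S" "inj_on f (ball p0 r)"
proof (rule has_derivative_locally_injective[of p0 S _ "\<lambda>p v. of_real (Re v) * A p + of_real (Im v) * B p" f])
  show "bounded_linear (\<lambda>w. Complex (Im (cnj (B p0) * w) / Im (cnj (B p0) * A p0)) (Im (cnj (A p0) * w) / Im (cnj (A p0) * B p0)))"
    using plane_basis_inverse(1)[OF D] .
  show "(\<lambda>w. Complex (Im (cnj (B p0) * w) / Im (cnj (B p0) * A p0)) (Im (cnj (A p0) * w) / Im (cnj (A p0) * B p0)))
      \<circ> (\<lambda>v. of_real (Re v) * A p0 + of_real (Im v) * B p0) = id"
    unfolding o_def plane_basis_inverse(2)[OF D] by (simp add: id_def)
  fix e :: real assume e: "0 < e"
  have "isCont A p0" "isCont B p0" using cont S by (auto simp: continuous_on_eq_continuous_at)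
  then obtain d1 d2 where d: "d1 > 0" "d2 > 0" "\<And>x. dist x p0 < d1 \<Longrightarrow> dist (A x) (A p0) < e / 4"
      "\<And>x. dist x p0 < d2 \<Longrightarrow> dist (B x) (B p0) < e / 4"
    unfolding continuous_at_eps_delta using e by (metis zero_less_divide_iff zero_less_numeral)
  show "\<exists>d>0. \<forall>x. dist p0 x < d \<longrightarrow>
      onorm (\<lambda>v. (of_real (Re v) * A x + of_real (Im v) * B x) - (of_real (Re v) * A p0 + of_real (Im v) * B p0)) < e"
  proof (intro exI conjI allI impI)
    show "0 < min d1 d2" using d by simp
    fix x assume "dist p0 x < min d1 d2"
    then have x: "norm (A x - A p0) \<le> e / 4" "norm (B x - B p0) \<le> e / 4"
      using d(3,4)[of x] by (simp_all add: dist_norm norm_minus_commute)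
    have "onorm (\<lambda>v. (of_real (Re v) * A x + of_real (Im v) * B x) - (of_real (Re v) * A p0 + of_real (Im v) * B p0)) \<le> e / 2"
    proof (rule onorm_le)
      fix v
      have "norm ((of_real (Re v) * A x + of_real (Im v) * B x) - (of_real (Re v) * A p0 + of_real (Im v) * B p0))
        = norm (of_real (Re v) * (A x - A p0) + of_real (Im v) * (B x - B p0))" by (simp add: algebra_simps)
      also have "\<dots> \<le> \<bar>Re v\<bar> * norm (A x - A p0) + \<bar>Im v\<bar> * norm (B x - B p0)"
        by (rule order_trans[OF norm_triangle_ineq]) (simp add: norm_mult)
      also have "\<dots> \<le> norm v * (e / 4) + norm v * (e / 4)"
        using x abs_Re_le_cmod abs_Im_le_cmod by (intro add_mono mult_mono) auto
      finally show "norm ((of_real (Re v) * A x + of_real (Im v) * B x) - (of_real (Re v) * A p0 + of_real (Im v) * B p0))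
        \<le> e / 2 * norm v" by simp
    qed
    then show "onorm (\<lambda>v. (of_real (Re v) * A x + of_real (Im v) * B x) - (of_real (Re v) * A p0 + of_real (Im v) * B p0)) < e"
      using e by simp
  qed
qed (use assms in auto)


lemma fix_param_epitrochoid: "fix_param p = of_real (1 + Im p) * cis (Re p) + of_real (Im p) * cis (- 2 * Re p)"
proof -
  have "cnj (cis (Re p)) ^ 2 = cis (- 2 * Re p)" using Complex.DeMoivre[of "- Re p" 2] by (simp add: cis_cnj)
  then show ?thesis unfolding fix_param_def tangent_point_def by (simp add: algebra_simps)
qed

lemma fix_param_derivative:
  "(fix_param has_derivative (\<lambda>v. of_real (Re v) * (\<i> * (of_real (1 + Im p) * cis (Re p) - 2 * of_real (Im p) * cis (- 2 * Re p)))
       + of_real (Im v) * (of_real 1 * cis (Re p) + of_real 1 * cis (- 2 * Re p)))) (at p)"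
proof -
  have "fix_param = (\<lambda>p. of_real (1 + Im p) * cis (Re p) + of_real (Im p) * cis (- 2 * Re p))"
    using fix_param_epitrochoid by blast
  moreover have "((\<lambda>t. 1 + t) has_real_derivative 1) (at (Im p))" "((\<lambda>t. t) has_real_derivative 1) (at (Im p))"
    by (auto intro!: derivative_eq_intros)
  ultimately show ?thesis using epitrochoid_derivative[of "\<lambda>t. 1 + t" 1 p "\<lambda>t. t" 1] by simp
qed

text \<open>The coefficients of \<open>cycle_param\<close> and their derivatives.\<close>
definition "cyc_a c = 4 * c * (2 * c\<^sup>2 - 1) / (4 * c\<^sup>2 - 1)" for c :: real
definition "cyc_b c = 1 / (4 * c\<^sup>2 - 1)" for c :: real
definition "cyc_a' c = ((24 * c\<^sup>2 - 4) * (4 * c\<^sup>2 - 1) - (8 * c ^ 3 - 4 * c) * (8 * c)) / (4 * c\<^sup>2 - 1)\<^sup>2" for c :: real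
definition "cyc_b' c = - (8 * c) / (4 * c\<^sup>2 - 1)\<^sup>2" for c :: real

lemma cycle_param_derivative:
  assumes "1/2 < Im p"
  shows "(cycle_param has_derivative (\<lambda>v. of_real (Re v) * (\<i> * (of_real (cyc_a (Im p)) * cis (Re p) - 2 * of_real (cyc_b (Im p)) * cis (- 2 * Re p)))
       + of_real (Im v) * (of_real (cyc_a' (Im p)) * cis (Re p) + of_real (cyc_b' (Im p)) * cis (- 2 * Re p)))) (at p)"
proof -
  have "cycle_param = (\<lambda>p. of_real (cyc_a (Im p)) * cis (Re p) + of_real (cyc_b (Im p)) * cis (- 2 * Re p))"
    unfolding cycle_param_def cyc_a_def cyc_b_def by blast
  moreover have nz: "4 * (Im p)\<^sup>2 - 1 \<noteq> 0"
  proof -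
    have "(1/2)\<^sup>2 < (Im p)\<^sup>2" using assms by (intro power_strict_mono) auto
    then show ?thesis by (simp add: power2_eq_square)
  qed
  have "(cyc_a has_real_derivative cyc_a' (Im p)) (at (Im p))"
    unfolding cyc_a_def cyc_a'_def using nz
    by (auto intro!: derivative_eq_intros simp: power2_eq_square) (simp add: field_simps power3_eq_cube)?
  moreover have "(cyc_b has_real_derivative cyc_b' (Im p)) (at (Im p))"
    unfolding cyc_b_def cyc_b'_def using nz
    by (auto intro!: derivative_eq_intros simp: power2_eq_square)
  ultimately show ?thesis using epitrochoid_derivative[of cyc_a "cyc_a' (Im p)" p cyc_b "cyc_b' (Im p)"] by simp
qed

lemma cycle_param_one: "cycle_param (Complex m 1) = fix_param (Complex m (1/3))"
  unfolding cycle_param_def fix_param_epitrochoid by simp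

lemma fix_param_local_inverse:
  assumes k: "k < 3"
  obtains P where "continuous_on (region k {0<..<1}) P"
    "\<And>a. a \<in> region k {0<..<1} \<Longrightarrow> P a \<in> strip k {0<..<1} \<and> fix_param (P a) = a"
    "\<And>p. p \<in> strip k {0<..<1} \<Longrightarrow> P (fix_param p) = p"
proof -
  have o: "open (strip k {0<..<1})" by (rule strip_open) simp
  obtain P where "homeomorphism (strip k {0<..<1}) (fix_param ` strip k {0<..<1}) fix_param P"
    using invariance_of_domain_homeomorphism[OF o fix_param_continuous order_refl fix_param_inj_on[OF k unit_intervals(5)]] .
  note H = this
  show ?thesis
  proof (rule that[of P])
    show "continuous_on (region k {0<..<1}) P" unfolding region_def using homeomorphism_cont2[OF H] .
    show "P a \<in> strip k {0<..<1} \<and> fix_param (P a) = a" if "a \<in> region k {0<..<1}" for a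
      using homeomorphism_apply2[OF H] homeomorphism_image2[OF H] that unfolding region_def by blast
    show "P (fix_param p) = p" if "p \<in> strip k {0<..<1}" for p using homeomorphism_apply1[OF H that] .
  qed
qed

lemma isCont_eventually_nhds:
  assumes "isCont f x" "open S" "f x \<in> S"
  shows "\<forall>\<^sub>F p in nhds x. f p \<in> S"
proof -
  have "(f \<longlongrightarrow> f x) (nhds x)" using assms(1) tendsto_at_iff_tendsto_nhds[of f x] by (simp add: continuous_at)
  then show ?thesis using assms(2,3) by (rule topological_tendstoD)
qed

text \<open>
  The derivative of \<open>cycle_param\<close> is invertible on the bifurcation curve \<open>c = 1\<close>, which in the
  coordinates of the fixed point is \<open>t = 1/3\<close>. Off this curve, the two half-discs \<open>c < 1\<close> and
  \<open>c > 1\<close> are therefore each mapped to one side of \<open>t = 1/3\<close>, and the sign of the derivative of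
  \<open>t\<close> with respect to \<open>c\<close> tells which one.
\<close>
lemma cycle_param_coordinates:
  assumes k: "k < 3" and m0: "m0 \<in> arc_interval k"
    and P: "continuous_on (region k {0<..<1}) P"
      "\<And>a. a \<in> region k {0<..<1} \<Longrightarrow> P a \<in> strip k {0<..<1} \<and> fix_param (P a) = a"
      "\<And>p. p \<in> strip k {0<..<1} \<Longrightarrow> P (fix_param p) = p"
  defines "a0 \<equiv> fix_param (Complex m0 (1/3))"
  obtains U Q r where "open U" "a0 \<in> U" "U \<subseteq> region k {0<..<1}" "continuous_on U Q" "Q a0 = Complex m0 1"
    "\<And>a. a \<in> U \<Longrightarrow> cycle_param (Q a) = a" "0 < r" "\<And>p. p \<in> ball (Complex m0 1) r \<Longrightarrow> Q (cycle_param p) = p"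
    "\<And>a. a \<in> U \<Longrightarrow> Im (Q a) < 1 \<longleftrightarrow> Im (P a) < 1/3"
proof -
  let ?O = "region k {0<..<1}"
  define p0 where "p0 = Complex m0 1"
  define q0 where "q0 = Complex m0 (1/3)"
  have oO: "open ?O" using k by (intro region_open) auto
  have q0: "q0 \<in> strip k {0<..<1}" using m0 unfolding q0_def strip_def by simp
  have a0O: "a0 \<in> ?O" unfolding a0_def region_def using q0 q0_def by blast
  have Pa0: "P a0 = q0" unfolding a0_def q0_def[symmetric] using P(3)[OF q0] .
  have Ga0: "cycle_param p0 = a0" unfolding p0_def a0_def by (rule cycle_param_one)
  define C where "C = cos (3 * m0)"
  have C: "-1 < C" "C \<le> 1" using cos_triple_arc[OF m0] unfolding C_def by auto
  have v: "cyc_a 1 = 4/3" "cyc_b 1 = 1/3" "cyc_a' 1 = 28/9" "cyc_b' 1 = - 8/9"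
    unfolding cyc_a_def cyc_b_def cyc_a'_def cyc_b'_def by simp_all
  let ?A = "\<lambda>p. \<i> * (of_real (cyc_a (Im p)) * cis (Re p) - 2 * of_real (cyc_b (Im p)) * cis (- 2 * Re p))"
  let ?B = "\<lambda>p. of_real (cyc_a' (Im p)) * cis (Re p) + of_real (cyc_b' (Im p)) * cis (- 2 * Re p)"
  let ?X = "\<i> * (of_real (1 + Im q0) * cis (Re q0) - 2 * of_real (Im q0) * cis (- 2 * Re q0))"
  let ?Y = "of_real 1 * cis (Re q0) + of_real 1 * cis (- 2 * Re q0)"
  have XA: "?X = ?A p0" unfolding p0_def q0_def complex.sel v by simp
  have crossG: "Im (cnj (?A p0) * ?B p0) = - (128 - 88 * C) / 27"
    unfolding epitrochoid_cross unfolding p0_def complex.sel v C_def[symmetric] by (simp add: field_simps)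
  have crossX: "Im (cnj ?X * ?Y) = - (2/3) * (1 + C)"
    unfolding epitrochoid_cross unfolding q0_def complex.sel C_def[symmetric] by (simp add: field_simps)
  define S0 where "S0 = {p. 1/2 < Im p}"
  have S0: "open S0" "p0 \<in> S0" unfolding S0_def p0_def by (rule open_halfspace_Im_gt) simp
  have nz: "4 * (Im p)\<^sup>2 - 1 \<noteq> 0" if "p \<in> S0" for p
  proof -
    have "(1/2)\<^sup>2 < (Im p)\<^sup>2" using that unfolding S0_def by (intro power_strict_mono) auto
    then show ?thesis by (simp add: power2_eq_square)
  qed
  have cA: "continuous_on S0 ?A" unfolding cyc_a_def cyc_b_def cis_conv_exp using nz by (intro continuous_intros) auto
  have cB: "continuous_on S0 ?B" unfolding cyc_a'_def cyc_b'_def cis_conv_exp using nz by (intro continuous_intros) auto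
  have derG: "(cycle_param has_derivative (\<lambda>v. of_real (Re v) * ?A p + of_real (Im v) * ?B p)) (at p)" if "p \<in> S0" for p
    using cycle_param_derivative that unfolding S0_def by blast
  have "Im (cnj (?A p0) * ?B p0) \<noteq> 0" unfolding crossG using C by simp
  then obtain r1 where r1: "0 < r1" "ball p0 r1 \<subseteq> S0" "inj_on cycle_param (ball p0 r1)"
    using locally_injective_partials[OF S0 derG cA cB] by blast
  have contG: "continuous_on S0 cycle_param"
    using derG has_derivative_continuous continuous_at_imp_continuous_on by blast
  have iG: "isCont cycle_param p0" using derG[OF S0(2)] has_derivative_continuous by blast
  have iP: "isCont P a0" using P(1) oO a0O by (simp add: continuous_on_eq_continuous_at)
  have iPG: "isCont (\<lambda>p. P (cycle_param p)) p0" using isCont_o2[OF iG] iP Ga0 by simp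
  have "\<forall>\<^sub>F p in nhds p0. cycle_param p \<in> ?O"
    using isCont_eventually_nhds[OF iG oO] a0O Ga0 by simp
  moreover have "\<forall>\<^sub>F p in nhds p0. dist (P (cycle_param p)) (P (cycle_param p0)) < r1"
    using isCont_eventually_nhds[OF iPG open_ball, of "P (cycle_param p0)" r1] r1(1) by (simp add: dist_commute)
  moreover have "\<forall>\<^sub>F p in nhds p0. Re p \<in> arc_interval k"
  proof -
    have "open (Re -` arc_interval k)" unfolding arc_interval_def by (intro open_vimage continuous_intros)
    moreover have "p0 \<in> Re -` arc_interval k" using m0 unfolding p0_def by simp
    ultimately show ?thesis unfolding eventually_nhds by (intro exI[of _ "Re -` arc_interval k"]) auto
  qed
  ultimately have "\<forall>\<^sub>F p in nhds p0. cycle_param p \<in> ?O \<and> dist (P (cycle_param p)) (P (cycle_param p0)) < r1 \<and> Re p \<in> arc_interval k"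
    by (simp add: eventually_conj_iff)
  then obtain r2 where r2: "0 < r2" "\<And>p. dist p p0 < r2 \<Longrightarrow> cycle_param p \<in> ?O \<and> dist (P (cycle_param p)) (P (cycle_param p0)) < r1 \<and> Re p \<in> arc_interval k"
    unfolding eventually_nhds_metric by blast
  define r where "r = min r1 r2"
  have r: "0 < r" using r1 r2 r_def by simp
  define B where "B = ball p0 r"
  have Br1: "B \<subseteq> ball p0 r1" unfolding B_def r_def by auto
  have B2: "cycle_param p \<in> ?O" "dist (P (cycle_param p)) q0 < r1" "Re p \<in> arc_interval k" if "p \<in> B" for p
    using r2(2)[of p] that Ga0 Pa0 unfolding B_def r_def by (auto simp: dist_commute)
  have injB: "inj_on cycle_param B" using inj_on_subset[OF r1(3) Br1] .
  have BS0: "B \<subseteq> S0" using Br1 r1(2) by blast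
  have oB: "open B" unfolding B_def by simp
  obtain Q where Q: "homeomorphism B (cycle_param ` B) cycle_param Q"
    using invariance_of_domain_homeomorphism[OF oB continuous_on_subset[OF contG BS0] order_refl injB] .
  have oU: "open (cycle_param ` B)" using invariance_of_domain[OF continuous_on_subset[OF contG BS0] oB injB] .
  define h where "h = (\<lambda>p. Im (P (cycle_param p)))"
  have conth: "continuous_on B h"
  proof -
    have "continuous_on B (\<lambda>p. P (cycle_param p))"
      by (rule continuous_on_compose2[OF P(1) continuous_on_subset[OF contG BS0]]) (use B2 in auto)
    then show ?thesis unfolding h_def by (intro continuous_intros)
  qed
  \<comment> \<open>A parameter on the curve is \<open>cycle_param\<close> of some point with \<open>c = 1\<close>, which is \<open>p\<close> by injectivity.\<close>
  have h1: "Im p = 1" if p: "p \<in> B" "h p = 1/3" for p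
  proof -
    define m where "m = Re (P (cycle_param p))"
    have "P (cycle_param p) = Complex m (1/3)" using p(2) unfolding h_def m_def by (simp add: complex_eq_iff)
    then have e: "cycle_param p = cycle_param (Complex m 1)" using P(2)[OF B2(1)[OF p(1)]] cycle_param_one by metis
    have "\<bar>m - m0\<bar> \<le> norm (P (cycle_param p) - q0)" unfolding m_def q0_def using abs_Re_le_cmod[of "P (cycle_param p) - Complex m0 (1/3)"] by simp
    then have "\<bar>m - m0\<bar> < r1" using B2(2)[OF p(1)] by (simp add: dist_norm)
    moreover have "dist p0 (Complex m 1) = \<bar>m - m0\<bar>"
      unfolding p0_def dist_norm by (simp add: cmod_def abs_minus_commute)
    ultimately have "Complex m 1 \<in> ball p0 r1" by simp
    then have "p = Complex m 1" using r1(3) e Br1 p(1) unfolding inj_on_def by blast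
    then show ?thesis by simp
  qed
  have derP: "(P has_derivative (\<lambda>w. Complex (Im (cnj ?Y * w) / Im (cnj ?Y * ?X)) (Im (cnj ?X * w) / Im (cnj ?X * ?Y)))) (at a0)"
  proof -
    have D: "Im (cnj ?X * ?Y) \<noteq> 0" unfolding crossX using C by simp
    show ?thesis
    proof (rule has_derivative_inverse_basic[OF _ plane_basis_inverse(1)[OF D] _ _ oO a0O])
      show "(fix_param has_derivative (\<lambda>v. of_real (Re v) * ?X + of_real (Im v) * ?Y)) (at (P a0))"
        unfolding Pa0 by (rule fix_param_derivative)
      show "(\<lambda>w. Complex (Im (cnj ?Y * w) / Im (cnj ?Y * ?X)) (Im (cnj ?X * w) / Im (cnj ?X * ?Y)))
          \<circ> (\<lambda>v. of_real (Re v) * ?X + of_real (Im v) * ?Y) = id"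
        unfolding o_def plane_basis_inverse(2)[OF D] by (simp add: id_def)
      show "continuous (at a0) P" by (rule iP)
      show "\<And>z. z \<in> ?O \<Longrightarrow> fix_param (P z) = z" using P(2) by blast
    qed
  qed
  \<comment> \<open>\<open>\<tau>\<close> is the derivative of \<open>t\<close> with respect to \<open>c\<close>, by Cramer's rule.\<close>
  define \<tau> where "\<tau> = Im (cnj ?X * ?B p0) / Im (cnj ?X * ?Y)"
  have \<tau>: "\<tau> > 0"
  proof -
    have num: "Im (cnj ?X * ?B p0) = - (128 - 88 * C) / 27" unfolding XA by (rule crossG)
    show ?thesis unfolding \<tau>_def num crossX using C by (intro divide_neg_neg) auto
  qed
  have "((\<lambda>c. h (Complex m0 c)) has_real_derivative \<tau>) (at 1)"
  proof -
    have l: "((\<lambda>c. Complex m0 c) has_derivative (\<lambda>h. Complex 0 h)) (at 1)"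
    proof -
      have "((\<lambda>c. of_real m0 + \<i> * of_real c) has_derivative (\<lambda>h. \<i> * complex_of_real h)) (at 1)"
        by (auto intro!: derivative_eq_intros)
      then show ?thesis by (simp add: Complex_eq)
    qed
    have g: "((\<lambda>c. cycle_param (Complex m0 c)) has_derivative (\<lambda>h. of_real (Re (Complex 0 h)) * ?A p0 + of_real (Im (Complex 0 h)) * ?B p0)) (at 1)"
      by (rule has_derivative_compose[OF l]) (use derG[OF S0(2)] p0_def in simp)
    have "((\<lambda>c. P (cycle_param (Complex m0 c))) has_derivative
       (\<lambda>h. Complex (Im (cnj ?Y * (of_real (Re (Complex 0 h)) * ?A p0 + of_real (Im (Complex 0 h)) * ?B p0)) / Im (cnj ?Y * ?X))
         (Im (cnj ?X * (of_real (Re (Complex 0 h)) * ?A p0 + of_real (Im (Complex 0 h)) * ?B p0)) / Im (cnj ?X * ?Y)))) (at 1)"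
      by (rule has_derivative_compose[OF g]) (use derP Ga0 p0_def in simp)
    then have "((\<lambda>c. Im (P (cycle_param (Complex m0 c)))) has_derivative
       (\<lambda>h. Im (Complex (Im (cnj ?Y * (of_real (Re (Complex 0 h)) * ?A p0 + of_real (Im (Complex 0 h)) * ?B p0)) / Im (cnj ?Y * ?X))
         (Im (cnj ?X * (of_real (Re (Complex 0 h)) * ?A p0 + of_real (Im (Complex 0 h)) * ?B p0)) / Im (cnj ?X * ?Y))))) (at 1)"
      by (rule bounded_linear.has_derivative[OF bounded_linear_Im])
    then have d: "((\<lambda>c. Im (P (cycle_param (Complex m0 c)))) has_derivative
       (\<lambda>h. Im (cnj ?X * (of_real (Re (Complex 0 h)) * ?A p0 + of_real (Im (Complex 0 h)) * ?B p0)) / Im (cnj ?X * ?Y))) (at 1)"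
      by (simp only: complex.sel)
    have e: "Im (W * (of_real (Re (Complex 0 h)) * Z + of_real (Im (Complex 0 h)) * T)) / K = Im (W * T) / K * h"
      for W Z T :: complex and K h by (simp add: algebra_simps add_divide_distrib)
    show ?thesis using d unfolding h_def has_field_derivative_def \<tau>_def e .
  qed
  note derh = this
  have h01: "h (Complex m0 1) = 1/3" unfolding h_def using Ga0 Pa0 p0_def q0_def by simp
  have side: "Im p < 1 \<Longrightarrow> h p < 1/3" "Im p > 1 \<Longrightarrow> h p > 1/3" if p: "p \<in> B" for p
  proof -
    have near: "Complex m0 c \<in> B" if "\<bar>c - 1\<bar> < r" for c
      using that unfolding B_def p0_def by (simp add: dist_norm cmod_def abs_minus_commute)
    have conv: "connected (B \<inter> {p. Im p < 1})" "connected (B \<inter> {p. Im p > 1})"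
      unfolding B_def by (auto intro!: convex_connected convex_Int convex_halfspace_Im_lt convex_halfspace_Im_gt)
    show "h p < 1/3" if "Im p < 1"
    proof -
      obtain d where d: "d > 0" "\<And>e. 0 < e \<Longrightarrow> e < d \<Longrightarrow> h (Complex m0 (1 - e)) < h (Complex m0 1)"
        using DERIV_pos_inc_left[OF derh \<tau>] by blast
      define e where "e = min d r / 2"
      have e: "0 < e" "e < d" "e < r" unfolding e_def using d(1) r by auto
      have w: "Complex m0 (1 - e) \<in> B \<inter> {p. Im p < 1}" using near[of "1 - e"] e by simp
      have wl: "h (Complex m0 (1 - e)) < 1/3" using d(2)[OF e(1,2)] h01 by simp
      have con: "connected (h ` (B \<inter> {p. Im p < 1}))"
        using conv(1) continuous_on_subset[OF conth] by (intro connected_continuous_image) auto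
      show ?thesis
      proof (rule ccontr)
        assume "\<not> h p < 1/3"
        then have "1/3 \<in> h ` (B \<inter> {p. Im p < 1})"
          using connectedD_interval[OF con, of "h (Complex m0 (1 - e))" "h p" "1/3"] w wl p that by force
        then show False using h1 by force
      qed
    qed
    show "h p > 1/3" if "Im p > 1"
    proof -
      obtain d where d: "d > 0" "\<And>e. 0 < e \<Longrightarrow> e < d \<Longrightarrow> h (Complex m0 1) < h (Complex m0 (1 + e))"
        using DERIV_pos_inc_right[OF derh \<tau>] by blast
      define e where "e = min d r / 2"
      have e: "0 < e" "e < d" "e < r" unfolding e_def using d(1) r by auto
      have w: "Complex m0 (1 + e) \<in> B \<inter> {p. Im p > 1}" using near[of "1 + e"] e by simp
      have wl: "h (Complex m0 (1 + e)) > 1/3" using d(2)[OF e(1,2)] h01 by simp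
      have con: "connected (h ` (B \<inter> {p. Im p > 1}))"
        using conv(2) continuous_on_subset[OF conth] by (intro connected_continuous_image) auto
      show ?thesis
      proof (rule ccontr)
        assume "\<not> h p > 1/3"
        then have "1/3 \<in> h ` (B \<inter> {p. Im p > 1})"
          using connectedD_interval[OF con, of "h p" "h (Complex m0 (1 + e))" "1/3"] w wl p that by force
        then show False using h1 by force
      qed
    qed
  qed
  have onl: "h p = 1/3" if "p \<in> B" "Im p = 1" for p
  proof -
    have "p = Complex (Re p) 1" using that by (simp add: complex_eq_iff)
    then have "cycle_param p = fix_param (Complex (Re p) (1/3))" using cycle_param_one by metis
    moreover have "Complex (Re p) (1/3) \<in> strip k {0<..<1}" using B2(3)[OF that(1)] by (simp add: strip_def)
    ultimately show ?thesis unfolding h_def using P(3) by simp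
  qed
  have iff: "Im p < 1 \<longleftrightarrow> h p < 1/3" if "p \<in> B" for p
    using side[OF that] onl[OF that] by (cases "Im p" "1::real" rule: linorder_cases) auto
  have QB: "Q a \<in> B \<and> cycle_param (Q a) = a" if "a \<in> cycle_param ` B" for a
    using homeomorphism_apply2[OF Q that] homeomorphism_image2[OF Q] that by blast
  have p0B: "p0 \<in> B" unfolding B_def using r by simp
  show ?thesis
  proof (rule that[of "cycle_param ` B" Q r])
    show "open (cycle_param ` B)" by (rule oU)
    show "a0 \<in> cycle_param ` B" using p0B Ga0 by blast
    show "cycle_param ` B \<subseteq> ?O" using B2 by blast
    show "continuous_on (cycle_param ` B) Q" using homeomorphism_cont2[OF Q] .
    have inv: "Q (cycle_param p) = p" if "p \<in> B" for p using homeomorphism_apply1[OF Q that] .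
    show "Q a0 = Complex m0 1" using inv[OF p0B] Ga0 p0_def by simp
    show "cycle_param (Q a) = a" if "a \<in> cycle_param ` B" for a using QB[OF that] by blast
    show "0 < r" by (rule r)
    show "Q (cycle_param p) = p" if "p \<in> ball (Complex m0 1) r" for p using inv that unfolding B_def p0_def by blast
    show "Im (Q a) < 1 \<longleftrightarrow> Im (P a) < 1/3" if "a \<in> cycle_param ` B" for a
      using iff[of "Q a"] QB[OF that] unfolding h_def by simp
  qed
qed


section \<open>The period doubling bifurcation\<close>

lemma circle_slope_continuous:
  assumes "z0 \<noteq> a0"
  shows "isCont (\<lambda>(a, w). circle_slope a w) (a0, z0)"
  unfolding circle_slope_def case_prod_unfold using assms by (intro continuous_intros) auto

lemma blaschke_jointly_continuous:
  assumes "cnj a0 * z0 \<noteq> 1"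
  shows "isCont (\<lambda>(a, w). blaschke a w) (a0, z0)"
  unfolding blaschke_def case_prod_unfold using assms by (intro continuous_intros) auto

lemma isCont_pair_eps:
  fixes f :: "complex \<times> complex \<Rightarrow> 'b::metric_space"
  assumes "isCont f (a0, z0)" "0 < e"
  obtains d where "0 < d" "\<And>a w. dist a a0 < d \<Longrightarrow> dist w z0 < d \<Longrightarrow> dist (f (a, w)) (f (a0, z0)) < e"
proof -
  obtain d where d: "d > 0" "\<And>x. dist x (a0, z0) < d \<Longrightarrow> dist (f x) (f (a0, z0)) < e"
    using assms unfolding continuous_at_eps_delta by blast
  have "dist (f (a, w)) (f (a0, z0)) < e" if "dist a a0 < d / 2" "dist w z0 < d / 2" for a w
  proof (rule d(2))
    have "dist (a, w) (a0, z0) \<le> dist a a0 + dist w z0"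
      unfolding dist_Pair_Pair by (intro sqrt_sum_squares_le_sum) auto
    then show "dist (a, w) (a0, z0) < d" using that by simp
  qed
  then show ?thesis using that[of "d / 2"] d(1) by simp
qed

lemma circle_near:
  assumes "0 < e"
  obtains \<epsilon> where "0 < \<epsilon>" "\<And>w. norm w = 1 \<Longrightarrow> dist w (cis m) < \<epsilon> \<Longrightarrow> \<exists>t. \<bar>t\<bar> < e \<and> w = cis (m + t)"
proof -
  have "isCont Arg 1" by (rule continuous_at_Arg) simp
  then obtain \<epsilon> where \<epsilon>: "\<epsilon> > 0" "\<And>v. dist v 1 < \<epsilon> \<Longrightarrow> dist (Arg v) (Arg 1) < e"
    unfolding continuous_at_eps_delta using assms by blast
  have "\<exists>t. \<bar>t\<bar> < e \<and> w = cis (m + t)" if w: "norm w = 1" "dist w (cis m) < \<epsilon>" for w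
  proof -
    define v where "v = w / cis m"
    have nv: "norm v = 1" unfolding v_def using w by (simp add: norm_divide)
    have "v - 1 = (w - cis m) / cis m" unfolding v_def by (simp add: diff_divide_distrib)
    then have "dist v 1 = dist w (cis m)" unfolding dist_norm by (simp add: norm_divide)
    then have "\<bar>Arg v\<bar> < e" using \<epsilon>(2)[of v] w(2) by (simp add: dist_real_def)
    moreover have "v = cis (Arg v)" using cis_Arg[of v] nv by (simp add: sgn_div_norm) (metis cis_Arg norm_zero sgn_div_norm zero_neq_one inverse_1 scaleR_one)
    then have "w = cis (m + Arg v)" unfolding v_def by (metis cis_mult cis_neq_zero mult.commute nonzero_eq_divide_eq)
    ultimately show ?thesis by blast
  qed
  then show ?thesis using that \<epsilon>(1) by blast
qed

lemma one_minus_cos_le: "1 - cos d \<le> \<bar>d\<bar>" for d :: real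
proof -
  have "1 - cos d = 2 * (sin (d / 2))\<^sup>2" using cos_double_sin[of "d / 2"] by simp
  also have "\<dots> = 2 * (\<bar>sin (d / 2)\<bar> * \<bar>sin (d / 2)\<bar>)" by (simp add: power2_eq_square)
  also have "\<dots> \<le> 2 * (1 * \<bar>d / 2\<bar>)"
    by (intro mult_left_mono mult_mono abs_sin_le_one abs_sin_x_le_abs_x) auto
  finally show ?thesis by simp
qed

lemma region_mem_iff:
  assumes k: "k < 3" and a: "a = fix_param p" "p \<in> strip k {0<..1}" and J: "J \<subseteq> {0<..1}"
  shows "a \<in> region k J \<longleftrightarrow> Im p \<in> J"
proof
  assume "a \<in> region k J"
  then obtain q where q: "q \<in> strip k J" "a = fix_param q" unfolding region_def by blast
  have "q \<in> strip k {0<..1}" using q(1) J unfolding strip_def by auto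
  then have "p = q" using fix_param_inj(1)[OF a(2) _ k k] a(1) q(2) by simp
  then show "Im p \<in> J" using q(1) unfolding strip_def by simp
next
  assume "Im p \<in> J"
  then have "p \<in> strip k J" using a(2) unfolding strip_def by simp
  then show "a \<in> region k J" unfolding region_def a(1) by blast
qed

text \<open>
  A 2-cycle of \<open>f\<close> near the bifurcating fixed point has coordinates \<open>(m, c)\<close> with \<open>c < 1\<close> near
  \<open>(m0, 1)\<close>. Since these are determined by the parameter, there is at most one, and there is one
  exactly for \<open>c < 1\<close>, that is for \<open>t < 1/3\<close>. The fixed point in \<open>V\<close> is unique because all
  multipliers nearby are close to -1.
\<close>
lemma period_doubling_sheet:
  assumes k: "k < 3" and a0: "a0 \<in> region k {1/3}"
  shows "period_doubling_bifurcation (tongue_sheet k) a0"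
proof -
  let ?S = "tongue_sheet k" and ?O = "region k {0<..<1}"
  obtain m0 where m0: "m0 \<in> arc_interval k" "a0 = fix_param (Complex m0 (1/3))"
  proof -
    obtain q where q: "a0 = fix_param q" "Re q \<in> arc_interval k" "Im q = 1/3" using a0 unfolding region_def strip_def by auto
    then have "q = Complex (Re q) (1/3)" by (simp add: complex_eq_iff)
    then show ?thesis using that[of "Re q"] q by simp
  qed
  define z0 where "z0 = cis m0"
  obtain P where P: "continuous_on ?O P"
    "\<And>a. a \<in> ?O \<Longrightarrow> P a \<in> strip k {0<..<1} \<and> fix_param (P a) = a"
    "\<And>p. p \<in> strip k {0<..<1} \<Longrightarrow> P (fix_param p) = p"
    using fix_param_local_inverse[OF k] by metis
  have oO: "open ?O" using k by (intro region_open) auto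
  have Oout: "?O \<subseteq> outer_plane" using k by (intro region_outer) auto
  have a1: "1 < norm a" if "a \<in> ?O" for a using Oout that unfolding outer_plane_def by blast
  define \<zeta> where "\<zeta> = (\<lambda>a. cis (Re (P a)))"
  have P1: "P a \<in> strip k {0<..1}" "0 < Im (P a)" "Im (P a) < 1" if "a \<in> ?O" for a
    using P(2)[OF that] unfolding strip_def by auto
  have \<zeta>: "norm (\<zeta> a) = 1" "blaschke a (\<zeta> a) = \<zeta> a" "circle_slope a (\<zeta> a) = 2 - 1 / Im (P a)" if "a \<in> ?O" for a
    using fix_param_fixed[OF P1(1,2)[OF that]] P(2)[OF that] unfolding \<zeta>_def by auto
  have mult\<zeta>: "multiplier a 1 (\<zeta> a) = of_real (2 - 1 / Im (P a))" if "a \<in> ?O" for a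
    using multiplier_fixed[OF \<zeta>(1)[OF that] a1[OF that] \<zeta>(2)[OF that]] \<zeta>(3)[OF that] by simp
  have mem: "a \<in> region k J \<longleftrightarrow> Im (P a) \<in> J" if "a \<in> ?O" "J \<subseteq> {0<..1}" for a J
    using region_mem_iff[OF k _ P1(1)[OF that(1)] that(2), of a] P(2)[OF that(1)] by simp
  have inS: "a \<in> ?S \<longleftrightarrow> 1/3 < Im (P a)" if "a \<in> ?O" for a
    using mem[OF that unit_intervals(2)] P1(3)[OF that] unfolding tongue_sheet_def[OF k] by simp
  have inclS: "a \<in> closure ?S \<longleftrightarrow> 1/3 \<le> Im (P a)" if "a \<in> ?O" for a
    using mem[OF that unit_intervals(10)] P1(3)[OF that] closure_tongue_sheet[OF k] Oout that by auto
  have infr: "a \<in> frontier ?S \<longleftrightarrow> Im (P a) = 1/3" if "a \<in> ?O" for a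
    unfolding frontier_def interior_open[OF tongue_sheet_open[OF k]] using inS[OF that] inclS[OF that] by auto
  have m0s: "Complex m0 (1/3) \<in> strip k {0<..<1}" using m0(1) by (simp add: strip_def)
  have a0O: "a0 \<in> ?O" unfolding m0(2) region_def using m0s by blast
  have Pa0: "P a0 = Complex m0 (1/3)" using P(3)[OF m0s] m0(2) by simp
  have \<zeta>a0: "\<zeta> a0 = z0" unfolding \<zeta>_def Pa0 z0_def by simp
  have slope0: "circle_slope a0 z0 = -1" using \<zeta>(3)[OF a0O] \<zeta>a0 Pa0 by simp
  have fr: "a0 \<in> frontier ?S" using infr[OF a0O] Pa0 by simp
  have clo: "a0 \<in> closure (- closure ?S)"
  proof -
    have "region k {0<..<1/3} \<subseteq> - closure ?S" using compl_tongue_hull[OF k] unfolding tongue_hull_def[OF k] by blast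
    moreover have "region k {1/3} \<subseteq> closure (region k {0<..<1/3})" by (intro region_closure_lower) auto
    ultimately show ?thesis using a0 closure_mono by blast
  qed
  have circ0: "circle_periodic a0 1 z0" "multiplier a0 1 z0 = -1"
    using \<zeta>[OF a0O] mult\<zeta>[OF a0O] \<zeta>a0 Pa0 unfolding circle_periodic_1 by auto
  obtain U0 Q r where U0: "open U0" "a0 \<in> U0" "U0 \<subseteq> ?O" "continuous_on U0 Q" "Q a0 = Complex m0 1"
    "\<And>a. a \<in> U0 \<Longrightarrow> cycle_param (Q a) = a" "0 < r" "\<And>p. p \<in> ball (Complex m0 1) r \<Longrightarrow> Q (cycle_param p) = p"
    "\<And>a. a \<in> U0 \<Longrightarrow> Im (Q a) < 1 \<longleftrightarrow> Im (P a) < 1/3"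
    using cycle_param_coordinates[OF k m0(1) P, folded m0(2)] by metis
  have main: "\<exists>U V \<zeta>. open U \<and> a0 \<in> U \<and> open V \<and> z0 \<in> V \<and> V \<subseteq> W \<and>
            continuous_on U \<zeta> \<and> \<zeta> a0 = z0 \<and>
            (\<forall>a\<in>U.
               {z \<in> V. circle_periodic a 1 z} = {\<zeta> a} \<and>
               (a \<in> ?S \<longrightarrow>
                  norm (multiplier a 1 (\<zeta> a)) < 1 \<and> two_periodic_in a V = {}) \<and>
               (a \<in> frontier ?S \<longrightarrow>
                  multiplier a 1 (\<zeta> a) = - 1 \<and> two_periodic_in a V = {}) \<and>
               (a \<notin> closure ?S \<longrightarrow>
                  norm (multiplier a 1 (\<zeta> a)) > 1 \<and>
                  (\<exists>w. attracting_periodic a 2 w \<and>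
                       two_periodic_in a V = {w, blaschke a w})))" if W: "open W" "z0 \<in> W" for W
  proof -
    have nz0: "norm z0 = 1" unfolding z0_def by simp
    note ne0 = unit_circle_neq[OF nz0 a1[OF a0O]]
    \<comment> \<open>Points at angles within \<open>e\<close> of \<open>m0\<close> have \<open>(m, c)\<close> in the domain of the local coordinates.\<close>
    define e where "e = min (r / 2) (1/100)"
    have e: "0 < e" "2 * e \<le> r" "e \<le> 1/100" unfolding e_def using U0(7) by auto
    obtain \<epsilon>1 where \<epsilon>1: "0 < \<epsilon>1" "\<And>w. norm w = 1 \<Longrightarrow> dist w z0 < \<epsilon>1 \<Longrightarrow> \<exists>t. \<bar>t\<bar> < e \<and> w = cis (m0 + t)"
      using circle_near[OF e(1), of m0] unfolding z0_def by metis
    obtain \<epsilon>2 where \<epsilon>2: "0 < \<epsilon>2" "\<And>a w. dist a a0 < \<epsilon>2 \<Longrightarrow> dist w z0 < \<epsilon>2 \<Longrightarrow> \<bar>circle_slope a w + 1\<bar> < 1/2"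
      using isCont_pair_eps[OF circle_slope_continuous[OF ne0(2)], of "1/2"] slope0
      by (auto simp: dist_real_def)
    have "cnj a0 * z0 \<noteq> 1" using ne0(3) by auto
    then obtain \<epsilon>3 where \<epsilon>3: "0 < \<epsilon>3" "\<And>a w. dist a a0 < \<epsilon>3 \<Longrightarrow> dist w z0 < \<epsilon>3 \<Longrightarrow> dist (blaschke a w) z0 < \<epsilon>1"
      using isCont_pair_eps[OF blaschke_jointly_continuous \<epsilon>1(1), of a0 z0] \<zeta>(2)[OF a0O] \<zeta>a0 by auto
    \<comment> \<open>\<open>\<epsilon>1\<close> controls angles, \<open>\<epsilon>2\<close> multipliers, and \<open>\<epsilon>3\<close> the other point of the cycle.\<close>
    define V where "V = W \<inter> ball z0 (min \<epsilon>1 (min \<epsilon>2 \<epsilon>3))"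
    have V: "open V" "z0 \<in> V" "V \<subseteq> W" unfolding V_def using W \<epsilon>1(1) \<epsilon>2(1) \<epsilon>3(1) by auto
    have Vd: "dist w z0 < \<epsilon>1" "dist w z0 < \<epsilon>2" "dist w z0 < \<epsilon>3" if "w \<in> V" for w
      using that unfolding V_def by (auto simp: dist_commute)
    have cos0: "cos (3 * m0 / 2) \<noteq> 0"
      using cos_triple_arc[OF m0(1)] cos_double_cos[of "3 * m0 / 2"] by auto
    have "isCont (\<lambda>t. cis (m0 + t)) 0" unfolding cis_conv_exp by (intro continuous_intros)
    then have ev1: "\<forall>\<^sub>F t in nhds 0. cis (m0 + t) \<in> V"
      by (rule isCont_eventually_nhds) (use V z0_def in auto)
    have "isCont (\<lambda>t. cos (3 * (m0 + t) / 2) * cos (3 * m0 / 2)) 0" by (intro continuous_intros) auto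
    then have ev2: "\<forall>\<^sub>F t in nhds 0. cos (3 * (m0 + t) / 2) * cos (3 * m0 / 2) \<in> {0<..}"
      by (rule isCont_eventually_nhds) (use cos0 in \<open>auto simp: zero_less_mult_iff linorder_neq_iff\<close>)
    have "\<forall>\<^sub>F t in nhds 0. cis (m0 + t) \<in> V \<and> cos (3 * (m0 + t) / 2) * cos (3 * m0 / 2) > 0"
      using ev1 ev2 by eventually_elim simp
    then obtain d0 where d0: "0 < d0" "\<And>t. \<bar>t\<bar> < d0 \<Longrightarrow> cis (m0 + t) \<in> V \<and> cos (3 * (m0 + t) / 2) * cos (3 * m0 / 2) > 0"
      unfolding eventually_nhds_metric dist_real_def by auto
    \<comment> \<open>With \<open>m\<close> within \<open>d1\<close> of \<open>m0\<close> and half-width below \<open>d1\<close>, the whole 2-cycle lies in \<open>V\<close>.\<close>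
    define d1 where "d1 = min d0 1 / 2"
    have d1: "0 < d1" "2 * d1 \<le> d0" "d1 < pi" unfolding d1_def using d0(1) pi_gt3 by auto
    have cd1: "cos d1 < 1" using cos_monotone_0_pi[of 0 d1] d1 by simp
    have iQ: "isCont Q a0" using U0(1,2,4) by (simp add: continuous_on_eq_continuous_at)
    have iRe: "isCont (\<lambda>a. Re (Q a)) a0" and iIm: "isCont (\<lambda>a. Im (Q a)) a0"
      using iQ by (auto intro: continuous_intros)
    have i\<zeta>: "isCont \<zeta> a0"
    proof -
      have "isCont P a0" using P(1) oO a0O by (simp add: continuous_on_eq_continuous_at)
      then have "isCont (\<lambda>a. Re (P a)) a0" by (auto intro: continuous_intros)
      then show ?thesis unfolding \<zeta>_def cis_conv_exp
        by (intro isCont_exp' continuous_mult continuous_const isCont_of_real)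
    qed
    have "\<forall>\<^sub>F a in nhds a0. a \<in> U0" using U0(1,2) by (rule eventually_nhds_in_open)
    moreover have "\<forall>\<^sub>F a in nhds a0. a \<in> ball a0 (min \<epsilon>2 \<epsilon>3)"
      using \<epsilon>2(1) \<epsilon>3(1) by (intro eventually_nhds_in_open) auto
    moreover have "\<forall>\<^sub>F a in nhds a0. \<zeta> a \<in> V"
      using isCont_eventually_nhds[OF i\<zeta> V(1)] \<zeta>a0 V(2) by simp
    moreover have "\<forall>\<^sub>F a in nhds a0. Re (Q a) \<in> {m0 - d1 <..< m0 + d1}"
      by (rule isCont_eventually_nhds[OF iRe]) (use U0(5) d1 in auto)
    moreover have "\<forall>\<^sub>F a in nhds a0. Im (Q a) \<in> {max (99/100) (cos d1) <..}"
      by (rule isCont_eventually_nhds[OF iIm]) (use U0(5) cd1 in auto)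
    ultimately have "\<forall>\<^sub>F a in nhds a0. a \<in> U0 \<and> a \<in> ball a0 (min \<epsilon>2 \<epsilon>3) \<and> \<zeta> a \<in> V
        \<and> Re (Q a) \<in> {m0 - d1 <..< m0 + d1} \<and> Im (Q a) \<in> {max (99/100) (cos d1) <..}"
      by (intro eventually_conj)
    then obtain U where U: "open U" "a0 \<in> U" "\<And>a. a \<in> U \<Longrightarrow> a \<in> U0 \<and> a \<in> ball a0 (min \<epsilon>2 \<epsilon>3) \<and> \<zeta> a \<in> V
        \<and> Re (Q a) \<in> {m0 - d1 <..< m0 + d1} \<and> Im (Q a) \<in> {max (99/100) (cos d1) <..}"
      unfolding eventually_nhds by blast
    have UO: "a \<in> ?O" if "a \<in> U" for a using U(3)[OF that] U0(3) by blast
    have Ud: "dist a a0 < \<epsilon>2" "dist a a0 < \<epsilon>3" if "a \<in> U" for a using U(3)[OF that] by (auto simp: dist_commute)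
    have slope: "\<bar>circle_slope a w + 1\<bar> < 1/2" if "a \<in> U" "w \<in> V" for a w
      using \<epsilon>2(2)[OF Ud(1)[OF that(1)] Vd(2)[OF that(2)]] .
    have fixed: "{z \<in> V. circle_periodic a 1 z} = {\<zeta> a}" if a: "a \<in> U" for a
    proof -
      have "z = \<zeta> a" if z: "z \<in> V" "circle_periodic a 1 z" for z
      proof (rule unique_nonrepelling[of _ _ a])
        show "norm z = 1" "blaschke a z = z" using z(2) circle_periodic_1 by auto
        show "norm (\<zeta> a) = 1" "blaschke a (\<zeta> a) = \<zeta> a" using \<zeta>[OF UO[OF a]] by auto
        show "1 < norm a" using a1[OF UO[OF a]] .
        show "circle_slope a z \<le> 1" using slope[OF a z(1)] by linarith
        show "circle_slope a (\<zeta> a) \<le> 1" using slope[OF a conjunct1[OF conjunct2[OF conjunct2[OF U(3)[OF a]]]]] by linarith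
      qed
      moreover have "\<zeta> a \<in> V" "circle_periodic a 1 (\<zeta> a)"
        using U(3)[OF a] \<zeta>[OF UO[OF a]] circle_periodic_1 by auto
      ultimately show ?thesis by blast
    qed
    have two: "Im (Q a) < 1 \<and> w \<in> {cis (Re (Q a) + arccos (Im (Q a))), cis (Re (Q a) - arccos (Im (Q a)))}"
      if a: "a \<in> U" and w: "w \<in> V" "circle_periodic a 2 w" for a w
    proof -
      define v where "v = blaschke a w"
      have wv: "norm w = 1" "blaschke a v = w" "v \<noteq> w" using w(2) unfolding circle_periodic_2 v_def by auto
      have nv: "norm v = 1" unfolding v_def using norm_blaschke_circle[OF wv(1) a1[OF UO[OF a]]] .
      have dv: "dist v z0 < \<epsilon>1" unfolding v_def using \<epsilon>3(2)[OF Ud(2)[OF a] Vd(3)[OF w(1)]] .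
      obtain t where t: "\<bar>t\<bar> < e" "w = cis (m0 + t)" using \<epsilon>1(2)[OF wv(1) Vd(1)[OF w(1)]] by blast
      obtain s where s: "\<bar>s\<bar> < e" "v = cis (m0 + s)" using \<epsilon>1(2)[OF nv dv] by blast
      define m where "m = m0 + (t + s) / 2"
      define d where "d = (t - s) / 2"
      have "m0 + t = m + d" unfolding m_def d_def by (simp add: add_divide_distrib diff_divide_distrib)
      moreover have "m0 + s = m - d" unfolding m_def d_def by (simp add: add_divide_distrib diff_divide_distrib)
      ultimately have wm: "w = cis (m + d)" and vm: "v = cis (m - d)" unfolding t(2) s(2) by (simp_all only:)
      have ts: "- e < t" "t < e" "- e < s" "s < e" using t(1) s(1) by auto
      have mm: "\<bar>m - m0\<bar> < e" unfolding m_def abs_less_iff using ts by (simp add: field_simps)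
      have dd: "\<bar>d\<bar> < e" unfolding d_def abs_less_iff using ts by (simp add: field_simps)
      have d_ne: "d \<noteq> 0" using wv(3) wm vm by auto
      have dpi: "\<bar>d\<bar> < pi" using dd e(3) pi_gt3 by linarith
      have "cos d = cos \<bar>d\<bar>" by (simp only: cos_abs_real)
      also have "\<dots> < cos 0" using d_ne dpi by (intro cos_monotone_0_pi) auto
      finally have c1: "cos d < 1" by simp
      have c2: "1 - cos d < e" using one_minus_cos_le[of d] dd by linarith
      have D: "4 * (cos d)\<^sup>2 - 1 \<noteq> 0"
      proof -
        have "1/2 < cos d" using c2 e(3) by linarith
        then have "(1/2)\<^sup>2 < (cos d)\<^sup>2" by (intro power_strict_mono) auto
        then show ?thesis by (simp add: power2_eq_square)
      qed
      have "a * (w\<^sup>2 + w * v + v\<^sup>2) = (w + v) * (w\<^sup>2 + v\<^sup>2) + 1"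
        using two_cycle_parameter[OF wv(1) nv a1[OF UO[OF a]] v_def[symmetric] wv(2) wv(3)[symmetric]] .
      then have aG: "a = cycle_param (Complex m (cos d))" unfolding wm vm using two_cycle_cycle_param_iff[OF D] by blast
      have "dist (Complex m0 1) (Complex m (cos d)) \<le> \<bar>m0 - m\<bar> + \<bar>1 - cos d\<bar>"
        unfolding dist_norm using cmod_le[of "Complex m0 1 - Complex m (cos d)"] by simp
      also have "\<dots> < r" using mm c1 c2 e(2) by linarith
      finally have "Q a = Complex m (cos d)" unfolding aG using U0(8)[of "Complex m (cos d)"] by simp
      then have Qa: "Re (Q a) = m" "Im (Q a) = cos d" by simp_all
      have "arccos (cos d) = \<bar>d\<bar>"
      proof -
        have "arccos (cos \<bar>d\<bar>) = \<bar>d\<bar>" using dpi by (intro arccos_cos) auto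
        then show ?thesis by (simp only: cos_abs_real)
      qed
      then show ?thesis unfolding Qa using c1 wm by (auto simp: abs_if)
    qed
    have empty: "two_periodic_in a V = {}" if "a \<in> U" "1/3 \<le> Im (P a)" for a
      using two[OF that(1)] U0(9)[of a] U(3)[OF that(1)] that(2) unfolding two_periodic_in_def by force
    have birth: "\<exists>w. attracting_periodic a 2 w \<and> two_periodic_in a V = {w, blaschke a w}"
      if a: "a \<in> U" and lt: "Im (P a) < 1/3" for a
    proof -
      define c where "c = Im (Q a)"
      define m where "m = Re (Q a)"
      define d where "d = arccos c"
      have c: "99/100 < c" "cos d1 < c" "c < 1" using U(3)[OF a] U0(9)[of a] lt unfolding c_def by auto
      have cosd: "cos d = c" unfolding d_def using c by (intro cos_arccos) auto
      have d_pos: "0 < d" unfolding d_def using arccos_less_arccos[of c 1] c by simp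
      have d_lt: "d < d1"
      proof -
        have "arccos c < arccos (cos d1)" using c by (intro arccos_less_arccos) auto
        then show ?thesis unfolding d_def using d1 by (simp add: arccos_cos)
      qed
      have mm: "\<bar>m - m0\<bar> < d1" using U(3)[OF a] unfolding m_def by (auto simp: abs_if)
      have aG: "a = cycle_param (Complex m (cos d))" using U0(6)[of a] U(3)[OF a] unfolding cosd c_def m_def by simp
      define x where "x = cis (m + d)"
      define y where "y = cis (m - d)"
      have t1: "\<bar>m - m0 + d\<bar> < d0" "\<bar>m - m0 - d\<bar> < d0" using mm d_lt d_pos d1 by linarith+
      have xy: "x = cis (m0 + (m - m0 + d))" "y = cis (m0 + (m - m0 - d))" unfolding x_def y_def by simp_all
      have xV: "x \<in> V" and yV: "y \<in> V" unfolding xy using d0(2) t1 by blast+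
      have D: "4 * (cos d)\<^sup>2 - 1 \<noteq> 0"
      proof -
        have "(1/2)\<^sup>2 < c\<^sup>2" using c by (intro power_strict_mono) auto
        then show ?thesis unfolding cosd by (simp add: power2_eq_square)
      qed
      have tangent_point: "a * (x\<^sup>2 + x * y + y\<^sup>2) = (x + y) * (x\<^sup>2 + y\<^sup>2) + 1"
        unfolding x_def y_def using two_cycle_cycle_param_iff[OF D] aG by blast
      have "x\<^sup>2 + x * y + y\<^sup>2 = of_real (4 * (cos d)\<^sup>2 - 1) * cis m ^ 2" unfolding x_def y_def cis_pair_sums ..
      then have s0: "x\<^sup>2 + x * y + y\<^sup>2 \<noteq> 0" using D by (simp only: mult_eq_0_iff of_real_eq_0_iff power_eq_0_iff cis_neq_zero) simp
      have n: "norm x = 1" "norm y = 1" unfolding x_def y_def by simp_all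
      note na = a1[OF UO[OF a]]
      have bx: "blaschke a x = y" by (rule two_cycle_parameter_imp[OF n na s0 tangent_point])
      have bs0: "y\<^sup>2 + y * x + x\<^sup>2 \<noteq> 0" using s0 by (simp add: ac_simps)
      have bpar: "a * (y\<^sup>2 + y * x + x\<^sup>2) = (y + x) * (y\<^sup>2 + x\<^sup>2) + 1" using tangent_point by (simp add: ac_simps)
      have yx: "blaschke a y = x" by (rule two_cycle_parameter_imp[OF n(2,1) na bs0 bpar])
      have ne: "x \<noteq> y"
      proof
        assume "x = y"
        then have "x * cnj y = 1" using unit_circle_cnj(1)[OF n(2)] by simp
        then have "cis (2 * d) = 1" unfolding x_def y_def cis_cnj cis_mult by simp
        then have "cos (2 * d) = 1" by (metis cis.sel(1) one_complex.sel(1))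
        then have "c\<^sup>2 = 1" using cos_double_cos[of d] cosd by simp
        then show False using c by (simp add: power2_eq_1_iff)
      qed
      have per: "circle_periodic a 2 x" "circle_periodic a 2 y" unfolding circle_periodic_2 using n bx yx ne by auto
      have "{z \<in> V. circle_periodic a 2 z} = {x, y}"
        using two[OF a] per xV yV unfolding x_def y_def d_def c_def m_def by blast
      moreover have "attracting_periodic a 2 x"
      proof -
        have cc: "0 < cos (3 * m / 2 - 3 * d / 2) * cos (3 * m / 2 + 3 * d / 2)"
        proof -
          have "0 < cos (3 * (m + d) / 2) * cos (3 * m0 / 2)" "0 < cos (3 * (m - d) / 2) * cos (3 * m0 / 2)"
            using d0(2)[OF t1(1)] d0(2)[OF t1(2)] by simp_all
          then have "0 < (cos (3 * (m + d) / 2) * cos (3 * m0 / 2)) * (cos (3 * (m - d) / 2) * cos (3 * m0 / 2))" by simp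
          also have "\<dots> = (cos (3 * (m - d) / 2) * cos (3 * (m + d) / 2)) * (cos (3 * m0 / 2))\<^sup>2"
            by (simp add: power2_eq_square)
          finally have "0 < (cos (3 * (m - d) / 2) * cos (3 * (m + d) / 2)) * (cos (3 * m0 / 2))\<^sup>2" .
          moreover have "0 < (cos (3 * m0 / 2))\<^sup>2" using cos0 by simp
          ultimately have "0 < cos (3 * (m - d) / 2) * cos (3 * (m + d) / 2)" by (rule zero_less_mult_pos2)
          moreover have "3 * (m - d) / 2 = 3 * m / 2 - 3 * d / 2" "3 * (m + d) / 2 = 3 * m / 2 + 3 * d / 2"
            by (simp_all add: field_simps)
          ultimately show ?thesis by (simp only:)
        qed
        have "circle_slope a x * circle_slope a y < 1"
          unfolding x_def y_def using two_cycle_multiplier_less_1[OF aG _ _ cc] c cosd by simp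
        moreover have "0 < circle_slope a x * circle_slope a y"
          using slope[OF a xV] slope[OF a yV] by (intro mult_neg_neg) linarith+
        ultimately have "norm (multiplier a 2 x) < 1"
          unfolding multiplier_two_cycle[OF na n bx yx] norm_of_real by simp
        then show ?thesis unfolding attracting_periodic_def using per by simp
      qed
      ultimately show ?thesis unfolding two_periodic_in_def using bx by blast
    qed
    have cont\<zeta>: "continuous_on U \<zeta>"
    proof -
      have "continuous_on U P" by (rule continuous_on_subset[OF P(1)]) (use UO in blast)
      then show ?thesis unfolding \<zeta>_def cis_conv_exp by (intro continuous_intros)
    qed
    show ?thesis
    proof (rule exI[of _ U], rule exI[of _ V], rule exI[of _ \<zeta>],
        intro conjI ballI impI U(1,2) V cont\<zeta> \<zeta>a0)
      fix a assume a: "a \<in> U"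
      note aO = UO[OF a]
      show "{z \<in> V. circle_periodic a 1 z} = {\<zeta> a}" by (rule fixed[OF a])
      have t: "0 < Im (P a)" "Im (P a) < 1" using P1[OF aO] by auto
      have nm: "norm (multiplier a 1 (\<zeta> a)) = \<bar>2 - 1 / Im (P a)\<bar>" unfolding mult\<zeta>[OF aO] norm_of_real ..
      show "norm (multiplier a 1 (\<zeta> a)) < 1" if "a \<in> ?S"
      proof -
        have "1/3 < Im (P a)" using inS[OF aO] that by simp
        then have "1 < 1 / Im (P a)" "1 / Im (P a) < 3" using t by (simp_all add: field_simps)
        then show ?thesis unfolding nm by linarith
      qed
      show "two_periodic_in a V = {}" if "a \<in> ?S" using empty[OF a] inS[OF aO] that by simp
      show "multiplier a 1 (\<zeta> a) = - 1" if "a \<in> frontier ?S" 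
      proof -
        have i: "Im (P a) = 1/3" using infr[OF aO] that by simp
        show ?thesis unfolding mult\<zeta>[OF aO] i by simp
      qed
      show "two_periodic_in a V = {}" if "a \<in> frontier ?S" using empty[OF a] infr[OF aO] that by simp
      show "norm (multiplier a 1 (\<zeta> a)) > 1" if "a \<notin> closure ?S"
      proof -
        have "Im (P a) < 1/3" using inclS[OF aO] that by simp
        then have "3 < 1 / Im (P a)" using t by (simp add: field_simps)
        then show ?thesis unfolding nm by linarith
      qed
      show "\<exists>w. attracting_periodic a 2 w \<and> two_periodic_in a V = {w, blaschke a w}" if "a \<notin> closure ?S"
        using birth[OF a] inclS[OF aO] that by simp
    qed
  qed
  show ?thesis unfolding period_doubling_bifurcation_def
    using fr clo circ0 main by blast
qed

section \<open>Components of the tongue and of its extension\<close>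

lemma tongue_sheets_disjoint: "i < 3 \<Longrightarrow> j < 3 \<Longrightarrow> i \<noteq> j \<Longrightarrow> tongue_sheet i \<inter> tongue_sheet j = {}"
  by (simp add: tongue_sheet_def region_disjoint unit_intervals)

lemma attracting_sheet:
  assumes "1 < norm a" shows "(\<exists>z. attracting_periodic a 1 z) \<longleftrightarrow> (\<exists>k<3. a \<in> tongue_sheet k)"
proof -
  have "a \<in> tongue_sheet k \<longleftrightarrow> (\<exists>p\<in>strip k {1/3<..<1}. a = fix_param p)" if "k < 3" for k
    unfolding tongue_sheet_def[OF that] region_def image_iff ..
  then show ?thesis unfolding attracting_iff_sheet[OF assms] by blast
qed

definition tongue_part :: "nat \<Rightarrow> complex set" where
  "tongue_part k = tongue 0 \<inter> tongue_sheet k"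

lemma tongue_part_eq: "k < 3 \<Longrightarrow> tongue_part k = fix_param ` {p \<in> strip k {1/3<..<1}. 2 \<le> norm (fix_param p)}"
proof -
  assume k: "k < 3"
  have "(\<exists>z. attracting_periodic a 1 z)" if a: "a \<in> tongue_sheet k" for a
  proof -
    have "1 < norm a" using tongue_sheet_outer[OF k] a unfolding outer_plane_def by blast
    then show ?thesis using attracting_sheet k a by blast
  qed
  then have "tongue_part k = {a \<in> tongue_sheet k. 2 \<le> norm a}" unfolding tongue_part_def tongue_0_eq by blast
  also have "\<dots> = fix_param ` {p \<in> strip k {1/3<..<1}. 2 \<le> norm (fix_param p)}" unfolding tongue_sheet_def[OF k] region_def by auto
  finally show ?thesis .
qed

lemma tongue_part_nonempty: assumes k: "k < 3" shows "fix_param (Complex (2 * pi * real k / 3) (1/2)) \<in> tongue_part k"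
proof -
  have "3 * (2 * pi * real k / 3) = 2 * pi * real k" by simp
  moreover have "cis (2 * pi * real k) = 1" by (rule cis_multiple_2pi) simp
  ultimately have "cis (2 * pi * real k / 3) ^ 3 = 1" unfolding cis_cube by (simp only:)
  then have "(norm (fix_param (Complex (2 * pi * real k / 3) (1/2))))\<^sup>2 = 4"
    unfolding fix_param_def using norm_tangent_point[of "cis (2 * pi * real k / 3)" "1/2"] by simp
  then have "norm (fix_param (Complex (2 * pi * real k / 3) (1/2))) = 2"
    by (metis norm_ge_zero power2_eq_imp_eq zero_le_numeral four_x_squared mult_2 numeral_Bit0 power2_eq_square mult_numeral_1)
  moreover have "Complex (2 * pi * real k / 3) (1/2) \<in> strip k {1/3<..<1}" by (rule strip_nonempty) simp
  ultimately show ?thesis unfolding tongue_part_eq[OF k] by force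
qed

text \<open>
  In coordinates, \<open>norm a \<ge> 2\<close> reads \<open>3 \<le> 2 * t * (1 + t) * (1 + cos (3 * m))\<close>. Horizontal motion
  towards the centre of the rectangle increases the cosine, so every point can be joined to the
  segment in the middle.
\<close>
lemma tongue_part_connected: assumes k: "k < 3" shows "connected (tongue_part k)"
proof -
  define c where "c = 2 * pi * real k / 3"
  define T where "T = {p \<in> strip k {1/3<..<1}. 2 \<le> norm (fix_param p)}"
  have nX: "2 \<le> norm (fix_param p) \<longleftrightarrow> 3 \<le> 2 * Im p * (1 + Im p) * (1 + cos (3 * Re p))" for p
  proof -
    have "2 \<le> norm (fix_param p) \<longleftrightarrow> 2\<^sup>2 \<le> (norm (fix_param p))\<^sup>2" by (subst power_mono_iff) auto
    then show ?thesis unfolding fix_param_def norm_tangent_point[OF norm_cis] cis_cube by simp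
  qed
  have cosd: "cos (3 * x) = cos (3 * \<bar>x - c\<bar>)" for x
  proof -
    have "3 * \<bar>x - c\<bar> = \<bar>3 * (x - c)\<bar>" by (simp only: abs_mult abs_numeral)
    then have "cos (3 * \<bar>x - c\<bar>) = cos (3 * (x - c))" by (simp only: cos_abs_real)
    also have "\<dots> = cos (3 * x - 2 * pi * real k)" unfolding c_def by (simp add: algebra_simps)
    also have "\<dots> = cos (3 * x)"
      using cos_int_2pin[of "int k"] sin_int_2pin[of "int k"] by (simp add: cos_diff)
    finally show ?thesis by simp
  qed
  have arc: "x \<in> arc_interval k \<longleftrightarrow> \<bar>x - c\<bar> < pi / 3" for x
    unfolding arc_interval_def c_def by (auto simp: abs_if)
  have cT: "Complex c t \<in> T \<longleftrightarrow> 1/2 \<le> t \<and> t < 1" for t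
  proof -
    have "cos (3 * c) = 1" using cosd[of c] by simp
    then have "Complex c t \<in> T \<longleftrightarrow> 1/3 < t \<and> t < 1 \<and> 3 \<le> 4 * (t * (1 + t))"
      unfolding T_def strip_def nX arc using pi_gt_zero by simp
    moreover have "3 \<le> 4 * (t * (1 + t)) \<longleftrightarrow> 1/2 \<le> t" if "1/3 < t"
    proof -
      have "4 * (t * (1 + t)) - 3 = (2 * t - 1) * (2 * t + 3)" by algebra
      moreover have "0 \<le> (2 * t - 1) * (2 * t + 3) \<longleftrightarrow> 1/2 \<le> t" using that by (auto simp: zero_le_mult_iff)
      ultimately show ?thesis by linarith
    qed
    ultimately show ?thesis by auto
  qed
  have seg: "closed_segment p (Complex c (Im p)) \<subseteq> T" if p: "p \<in> T" for p
  proof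
    fix q assume "q \<in> closed_segment p (Complex c (Im p))"
    then obtain u where u: "0 \<le> u" "u \<le> 1" "q = (1 - u) *\<^sub>R p + u *\<^sub>R Complex c (Im p)" unfolding in_segment by blast
    have I: "Im q = Im p" unfolding u(3) by (simp add: algebra_simps)
    have "Re q - c = (1 - u) * (Re p - c)" unfolding u(3) by (simp add: algebra_simps)
    then have "\<bar>Re q - c\<bar> = (1 - u) * \<bar>Re p - c\<bar>" using u by (simp add: abs_mult)
    also have "\<dots> \<le> 1 * \<bar>Re p - c\<bar>" using u by (intro mult_right_mono) auto
    finally have le: "\<bar>Re q - c\<bar> \<le> \<bar>Re p - c\<bar>" by simp
    have pc: "\<bar>Re p - c\<bar> < pi / 3" using p arc unfolding T_def strip_def by simp
    have "cos (3 * \<bar>Re p - c\<bar>) \<le> cos (3 * \<bar>Re q - c\<bar>)"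
      using le pc by (intro cos_monotone_0_pi_le) auto
    then have "cos (3 * Re p) \<le> cos (3 * Re q)" by (simp only: cosd[of "Re p"] cosd[of "Re q"])
    moreover have "0 < Im p" using p unfolding T_def strip_def by simp
    ultimately have le2: "2 * Im p * (1 + Im p) * (1 + cos (3 * Re p)) \<le> 2 * Im p * (1 + Im p) * (1 + cos (3 * Re q))"
      by (intro mult_left_mono) auto
    have "3 \<le> 2 * Im p * (1 + Im p) * (1 + cos (3 * Re p))" using p unfolding T_def nX by blast
    from order_trans[OF this le2] show "q \<in> T" using p le pc I unfolding T_def strip_def nX arc by auto
  qed
  define L where "L = (\<lambda>t. Complex c t) ` {1/2..<1}"
  have "connected L" unfolding L_def Complex_eq by (intro connected_continuous_image continuous_intros) auto
  moreover have LT: "L \<subseteq> T" unfolding L_def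
  proof (rule image_subsetI)
    fix t :: real assume "t \<in> {1/2..<1}"
    then show "Complex c t \<in> T" using cT[of t] by simp
  qed
  ultimately have LC: "L \<subseteq> connected_component_set T (Complex c (1/2))"
    by (intro connected_component_maximal) (auto simp: L_def)
  have "connected_component T (Complex c (1/2)) p" if p: "p \<in> T" for p
  proof -
    have e: "Complex c (Im p) \<in> T" using seg[OF p] by auto
    then have "Im p \<in> {1/2..<1}" using cT[of "Im p"] by simp
    then have "Complex c (Im p) \<in> L" unfolding L_def by (rule imageI)
    then have "connected_component T (Complex c (1/2)) (Complex c (Im p))" using LC by auto
    moreover have "connected_component T (Complex c (Im p)) p"
      unfolding connected_component_def using seg[OF p] by (intro exI[of _ "closed_segment p (Complex c (Im p))"]) auto
    ultimately show ?thesis by (rule connected_component_trans)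
  qed
  then have "connected T" unfolding connected_iff_connected_component
    by (meson connected_component_sym connected_component_trans)
  then show ?thesis unfolding tongue_part_eq[OF k] T_def[symmetric]
    by (intro connected_continuous_image fix_param_continuous)
qed

lemma tongue_0_Union: "tongue 0 = (\<Union>k<3. tongue_part k)"
proof -
  have "\<exists>k<3. a \<in> tongue_sheet k" if "a \<in> tongue 0" for a
    using that attracting_sheet[of a] unfolding tongue_0_eq by auto
  then show ?thesis unfolding tongue_part_def by blast
qed

lemma components_tongue_0: "components (tongue 0) = tongue_part ` {..<3}"
proof (rule components_eq_open_partition)
  show "\<Union> (tongue_part ` {..<3}) = tongue 0" using tongue_0_Union by simp
  show "pairwise disjnt (tongue_part ` {..<3})"
    unfolding pairwise_image using tongue_sheets_disjoint by (force simp: pairwise_def disjnt_def tongue_part_def)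
  fix A assume "A \<in> tongue_part ` {..<3}"
  then obtain k where k: "k < 3" "A = tongue_part k" by auto
  show "connected A" "A \<noteq> {}" using tongue_part_connected tongue_part_nonempty k by blast+
  show "openin (top_of_set (tongue 0)) A"
    unfolding k(2) tongue_part_def using tongue_sheet_open[OF k(1)] by (rule openin_open_Int)
qed

text \<open>
  Along a path of parameters with an attracting fixed point, one cannot leave a sheet, because the
  sheets are open and disjoint.
\<close>
lemma extension_subset_sheet:
  assumes k: "k < 3" and K: "K \<subseteq> tongue_sheet k"
  shows "extension K \<subseteq> tongue_sheet k"
proof
  fix a assume "a \<in> extension K"
  then obtain \<gamma> \<xi> where g: "path \<gamma>" "path_image \<gamma> \<subseteq> outer_plane" "pathstart \<gamma> = a" "pathfinish \<gamma> \<in> K"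
    "\<forall>t\<in>{0..1}. attracting_periodic (\<gamma> t) 1 (\<xi> t)" unfolding extension_def by blast
  define N where "N = (\<Union>j\<in>{..<3} - {k}. tongue_sheet j)"
  have oN: "open N" unfolding N_def using tongue_sheet_open by blast
  have sub: "path_image \<gamma> \<subseteq> tongue_sheet k \<union> N"
  proof
    fix x assume x: "x \<in> path_image \<gamma>"
    then obtain t where t: "t \<in> {0..1}" "x = \<gamma> t" unfolding path_image_def by blast
    have "1 < norm x" using x g(2) unfolding outer_plane_def by blast
    then obtain j where "j < 3" "x \<in> tongue_sheet j" using attracting_sheet g(5) t by blast
    then show "x \<in> tongue_sheet k \<union> N" unfolding N_def by blast
  qed
  have dis: "tongue_sheet k \<inter> N = {}" unfolding N_def using tongue_sheets_disjoint k by blast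
  have "pathfinish \<gamma> \<in> tongue_sheet k \<inter> path_image \<gamma>" using g(4) K pathfinish_in_path_image by blast
  then have "N \<inter> path_image \<gamma> = {}"
    using connectedD[OF connected_path_image[OF g(1)] tongue_sheet_open[OF k] oN] sub dis by blast
  then show "a \<in> tongue_sheet k" using sub pathstart_in_path_image[of \<gamma>] g(3) by blast
qed

lemma sheet_subset_extended: assumes k: "k < 3" shows "tongue_sheet k \<subseteq> extended_fixed_tongue"
proof
  fix a assume "a \<in> tongue_sheet k"
  then obtain p where p: "p \<in> strip k {1/3<..<1}" "a = fix_param p" unfolding tongue_sheet_def[OF k] region_def by blast
  define q where "q = Complex (2 * pi * real k / 3) (1/2)"
  have q: "q \<in> strip k {1/3<..<1}" unfolding q_def by (rule strip_nonempty) simp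
  have "path_connected (strip k {1/3<..<1})" by (intro convex_imp_path_connected strip_convex) simp
  then obtain h where h: "path h" "path_image h \<subseteq> strip k {1/3<..<1}" "pathstart h = p" "pathfinish h = q"
    using p(1) q unfolding path_connected_def by blast
  have hs: "h t \<in> strip k {1/3<..<1}" if "t \<in> {0..1}" for t using h(2) that unfolding path_image_def by blast
  have st: "1 < norm (fix_param x)" "attracting_periodic (fix_param x) 1 (cis (Re x))" if x: "x \<in> strip k {1/3<..<1}" for x
  proof -
    have "0 < Im x" using x by (simp add: strip_def)
    then show 1: "1 < norm (fix_param x)" using fix_param_fixed(1)[OF x] by blast
    show "attracting_periodic (fix_param x) 1 (cis (Re x))" unfolding attracting_iff_sheet[OF 1] using k x by blast
  qed
  have "path (fix_param \<circ> h)" using h(1) fix_param_continuous by (rule path_continuous_image)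
  moreover have "path_image (fix_param \<circ> h) \<subseteq> outer_plane" unfolding path_image_def outer_plane_def using st(1) hs by auto
  moreover have "pathstart (fix_param \<circ> h) = a" "pathfinish (fix_param \<circ> h) \<in> tongue 0"
    using h p(2) tongue_part_nonempty[OF k] unfolding q_def tongue_part_def by (auto simp: pathstart_compose pathfinish_compose)
  moreover have "path ((\<lambda>x. cis (Re x)) \<circ> h)" 
    by (rule path_continuous_image[OF h(1)]) (unfold cis_conv_exp, intro continuous_intros)
  moreover have "\<forall>t\<in>{0..1}. attracting_periodic ((fix_param \<circ> h) t) 1 (((\<lambda>x. cis (Re x)) \<circ> h) t)" using st(2) hs by simp
  ultimately show "a \<in> extended_fixed_tongue" unfolding extended_fixed_tongue_def extension_def by blast
qed

lemma extended_fixed_tongue_Union: "extended_fixed_tongue = (\<Union>k<3. tongue_sheet k)"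
proof
  show "(\<Union>k<3. tongue_sheet k) \<subseteq> extended_fixed_tongue" using sheet_subset_extended by blast
  show "extended_fixed_tongue \<subseteq> (\<Union>k<3. tongue_sheet k)"
  proof
    fix a assume "a \<in> extended_fixed_tongue"
    then obtain \<gamma> \<xi> where g: "path_image \<gamma> \<subseteq> outer_plane" "pathstart \<gamma> = a"
      "\<forall>t\<in>{0..1}. attracting_periodic (\<gamma> t) 1 (\<xi> t)" unfolding extended_fixed_tongue_def extension_def by blast
    have "1 < norm a" using g(1,2) pathstart_in_path_image[of \<gamma>] unfolding outer_plane_def by blast
    moreover have "attracting_periodic a 1 (\<xi> 0)" using g(2,3) unfolding pathstart_def by auto
    ultimately show "a \<in> (\<Union>k<3. tongue_sheet k)" using attracting_sheet by blast
  qed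
qed

lemma components_extended_fixed_tongue: "components extended_fixed_tongue = tongue_sheet ` {..<3}"
proof (rule components_eq_open_partition)
  show "\<Union> (tongue_sheet ` {..<3}) = extended_fixed_tongue" using extended_fixed_tongue_Union by simp
  show "pairwise disjnt (tongue_sheet ` {..<3})"
    unfolding pairwise_image using tongue_sheets_disjoint by (force simp: pairwise_def disjnt_def)
  fix A assume "A \<in> tongue_sheet ` {..<3}"
  then obtain k where k: "k < 3" "A = tongue_sheet k" by auto
  show "connected A" "A \<noteq> {}"
    unfolding k(2) tongue_sheet_def[OF k(1)] by (auto intro!: region_connected region_nonempty)
  have "tongue_sheet k \<subseteq> extended_fixed_tongue" using sheet_subset_extended[OF k(1)] .
  then show "openin (top_of_set extended_fixed_tongue) A"
    unfolding k(2) using tongue_sheet_open[OF k(1)] openin_open_Int[of "tongue_sheet k" extended_fixed_tongue]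
    by (simp add: inf.absorb2)
qed

lemma parabolic_on_line:
  assumes k: "k < 3" and a: "a \<in> region k {t}" and t: "t = 1 \<or> t = 1/3"
  shows "\<exists>z. parabolic_fixed_point a z \<and> multiplier a 1 z = of_real (2 - 1 / t)"
proof -
  obtain p where p: "p \<in> strip k {t}" "a = fix_param p" "Im p = t" using a unfolding region_def strip_def by blast
  have "0 < Im p" using t p(3) by auto
  note f = fix_param_fixed[OF p(1) this, folded p(2)]
  have m: "multiplier a 1 (cis (Re p)) = of_real (2 - 1 / t)"
    using multiplier_fixed[OF _ f(1,2)] f(3) p(3) by simp
  have "(2 - 1 / t)\<^sup>2 = 1" using t by (elim disjE; simp only:; simp)
  then have "multiplier a 1 (cis (Re p)) ^ 2 = 1" unfolding m by (metis of_real_1 of_real_power)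
  then have "parabolic_fixed_point a (cis (Re p))"
    unfolding parabolic_fixed_point_def circle_periodic_1 using f(2) by (intro conjI exI[of _ 2]) auto
  then show ?thesis using m by blast
qed

theorem theoremC:
  "(\<forall>K\<in>components (tongue 0). \<forall>L\<in>components (tongue 0).
      K \<noteq> L \<longrightarrow> extension K \<inter> extension L \<inter> annulus12 = {}) \<and>
   (\<forall>C\<in>components extended_fixed_tongue.
      components (boundary_in_plane C) = {exterior_boundary C, interior_boundary C} \<and>
      exterior_boundary C \<inter> interior_boundary C = {} \<and>
      (\<forall>a\<in>exterior_boundary C. \<exists>z. parabolic_fixed_point a z \<and> multiplier a 1 z = 1) \<and>
      (\<forall>a\<in>interior_boundary C. \<exists>z. parabolic_fixed_point a z \<and> multiplier a 1 z = - 1) \<and>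
      interior_boundary C homeomorphic {0<..<1::real} \<and>
      (\<forall>a\<in>interior_boundary C. period_doubling_bifurcation C a))"
proof (intro conjI ballI impI)
  fix K L assume "K \<in> components (tongue 0)" "L \<in> components (tongue 0)" "K \<noteq> L"
  then obtain i j where ij: "i < 3" "j < 3" "i \<noteq> j" "K = tongue_part i" "L = tongue_part j"
    unfolding components_tongue_0 by auto
  have "extension K \<subseteq> tongue_sheet i" "extension L \<subseteq> tongue_sheet j"
    using ij extension_subset_sheet unfolding tongue_part_def by simp_all
  then show "extension K \<inter> extension L \<inter> annulus12 = {}" using tongue_sheets_disjoint[OF ij(1-3)] by blast
next
  fix C assume "C \<in> components extended_fixed_tongue"
  then obtain k where k: "k < 3" and C: "C = tongue_sheet k" unfolding components_extended_fixed_tongue by auto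
  note ext = exterior_boundary_sheet[OF k, folded C] and int = interior_boundary_sheet[OF k, folded C]
  show "components (boundary_in_plane C) = {exterior_boundary C, interior_boundary C}"
    unfolding ext int using components_boundary_sheet[OF k] C by simp
  show "exterior_boundary C \<inter> interior_boundary C = {}"
    unfolding ext int using region_disjoint[OF k k unit_intervals(6,7)] by simp
  show "\<exists>z. parabolic_fixed_point a z \<and> multiplier a 1 z = 1" if "a \<in> exterior_boundary C" for a
    using parabolic_on_line[OF k that[unfolded ext]] by simp
  show "\<exists>z. parabolic_fixed_point a z \<and> multiplier a 1 z = - 1" if "a \<in> interior_boundary C" for a
    using parabolic_on_line[OF k that[unfolded int]] by simp
  show "interior_boundary C homeomorphic {0<..<1::real}"
    unfolding int by (rule interior_line_homeomorphic[OF k])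
  show "period_doubling_bifurcation C a" if "a \<in> interior_boundary C" for a
    using period_doubling_sheet[OF k that[unfolded int]] C by simp
qed

end
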